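(* Let $E=(e_n:n\in\mathbb{N})$ be a Leja sequence for the closed unit disk $D$ with $e_0=1$, and for $d\ge 2$ let $E_d=(e_0,\ldots,e_{d-1})$. Let $\mathcal H[E_d;f]$ denote the (extended) Hakopian interpolation polynomial of $f$ at $E_d$. (1) If $f\in C^5(D)$, then $\mathcal H[E_d;f]$ converges uniformly to $f$ on $D$ as $d\to\infty$. (2) If $f\in C^\infty(D)$, then for every two-dimensional multi-index $\beta\in\mathbb{N}^2$, $\mathrm{D}^\beta\big(\mathcal H[E_d;f]\big)$ converges uniformly to $\mathrm{D}^\beta f$ on $D$ as $d\to\infty$.
   Context: $\mathbb{C}$ is identified with $\mathbb{R}^2$ via $x=(x^1,x^2)\leftrightarrow x^1+ix^2$, and $D=\{\|x\|\le 1\}$ is the closed unit disk. $C^k(D)$ is the space of (real-valued) functions that are $k$ times continuously differentiable on a neighbourhood of $D$, and $C^\infty(D)$ is the corresponding space of infinitely differentiable functions. $\mathrm{D}^\beta$ is the usual partial derivative of multi-index $\beta$. A sequence $E=(e_n:n\in\mathbb{N})$ of points of $D$ is a Leja sequence for $D$ if $\big|\prod_{j=0}^{d-1}(e_d-e_j)\big|=\max_{z\in D}\big|\prod_{j=0}^{d-1}(z-e_j)\big|$ for all $d\ge1$. (When $e_0=1$ the points $e_n$ are pairwise distinct points of the unit circle, so no three of them are collinear.) Hakopian interpolation in $\mathbb{R}^2$: for a tuple $A=(a_0,\dots,a_{d-1})$ of $d\ge2$ points in the plane, no three of which are collinear, and $f$ continuous on the convex hull of $A$, $\mathcal H[A;f]$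 is the unique real polynomial $P$ in two variables of degree at most $d-2$ such that $\int_{[a_s,a_t]}(f-P)=0$ for all $0\le s<t\le d-1$, where $\int_{[a,b]}g:=\int_0^1 g(a+w(b-a))\,dw$. *)

theory Defs
  imports "HOL-Analysis.Analysis"
begin

text \<open>
  The plane is the type \<^typ>\<open>complex\<close>: the point with real coordinates \<open>(x1, x2)\<close> is
  \<open>x1 + \<i> * x2\<close>, so the two coordinate directions are \<open>1\<close> and \<open>\<i>\<close>.
\<close>

definition partial_deriv :: "complex \<Rightarrow> (complex \<Rightarrow> real) \<Rightarrow> complex \<Rightarrow> real" where
  "partial_deriv v f x = deriv (\<lambda>t::real. f (x + t *\<^sub>R v)) 0"

fun multi_deriv :: "nat \<times> nat \<Rightarrow> (complex \<Rightarrow> real) \<Rightarrow> complex \<Rightarrow> real" where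
  "multi_deriv (b1, b2) f = (partial_deriv 1 ^^ b1) ((partial_deriv \<i> ^^ b2) f)"

text \<open>\<open>C_on k U f\<close>: \<open>f\<close> is \<open>k\<close> times continuously differentiable on the open set \<open>U\<close>.\<close>

primrec C_on :: "nat \<Rightarrow> complex set \<Rightarrow> (complex \<Rightarrow> real) \<Rightarrow> bool" where
  "C_on 0 U f \<longleftrightarrow> continuous_on U f"
| "C_on (Suc k) U f \<longleftrightarrow>
     (\<forall>x\<in>U. f differentiable (at x)) \<and> (\<forall>v\<in>{1, \<i>}. C_on k U (partial_deriv v f))"

abbreviation unit_disk :: "complex set" where
  "unit_disk \<equiv> cball 0 1"

definition C_disk :: "nat \<Rightarrow> (complex \<Rightarrow> real) set" where
  "C_disk k = {f. \<exists>U. open U \<and> unit_disk \<subseteq> U \<and> C_on k U f}"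

definition C_inf_disk :: "(complex \<Rightarrow> real) set" where
  "C_inf_disk = {f. \<exists>U. open U \<and> unit_disk \<subseteq> U \<and> (\<forall>k. C_on k U f)}"

definition leja_disk :: "(nat \<Rightarrow> complex) \<Rightarrow> bool" where
  "leja_disk e \<longleftrightarrow>
     (\<forall>n. e n \<in> unit_disk) \<and>
     (\<forall>d\<ge>1. \<forall>z\<in>unit_disk. cmod (\<Prod>j<d. z - e j) \<le> cmod (\<Prod>j<d. e d - e j))"

text \<open>Real polynomial functions in two variables of total degree at most \<open>m\<close>.\<close>

definition polys2 :: "nat \<Rightarrow> (complex \<Rightarrow> real) set" where
  "polys2 m = {P. \<exists>c :: nat \<Rightarrow> nat \<Rightarrow> real.
     \<forall>z. P z = (\<Sum>(i, j)\<in>{(i, j). i + j \<le> m}. c i j * Re z ^ i * Im z ^ j)}"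

definition seg_integral :: "complex \<Rightarrow> complex \<Rightarrow> (complex \<Rightarrow> real) \<Rightarrow> real" where
  "seg_integral a b g = integral {0..1} (\<lambda>w. g (a + w *\<^sub>R (b - a)))"

text \<open>
  Meaningful when \<open>A\<close> consists of at least two points, no three of them collinear (and in
  particular pairwise distinct), and \<open>f\<close> is continuous on their convex hull: then exactly one
  polynomial has the described property.
\<close>

definition hakopian :: "complex list \<Rightarrow> (complex \<Rightarrow> real) \<Rightarrow> complex \<Rightarrow> real" where
  "hakopian A f = (THE P. P \<in> polys2 (length A - 2) \<and>
     (\<forall>s t. s < t \<and> t < length A \<longrightarrow> seg_integral (A ! s) (A ! t) (\<lambda>x. f x - P x) = 0))"

end

theory Submission
  imports Defs "HOL-Complex_Analysis.Complex_Analysis" "HOL-Library.Function_Algebras"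
begin

text \<open>
  Write \<open>w\<close> for the monic polynomial vanishing at the first \<open>d\<close> Leja points. The first \<open>2 ^ n\<close> points are
  the roots of unity of that order, and the next \<open>2 ^ n\<close> are a rotated copy of such a section; hence
  \<open>\<bar>w\<bar> \<le> 2 * \<bar>w' (e s)\<bar>\<close> on the disk for every \<open>s < d\<close>.

  The basis dual to the segment means consists of ridge functions \<open>M' (u \<bullet> x)\<close>, where \<open>u\<close> is
  orthogonal to the chord from \<open>e s\<close> to \<open>e t\<close> and \<open>M\<close> vanishes at the projections of all nodes but one of
  these two. In Joukowski coordinates the projected node polynomial factors through \<open>w\<close>, so that the
  inequality above bounds \<open>M\<close> on an ellipse around \<open>{-1..1}\<close>, and Cauchy's estimate gives
  \<open>\<bar>M'\<bar> \<le> C * d\<^sup>2\<close>. Summing over the pairs, the interpolation operator has norm \<open>O(d ^ 4)\<close>. As a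
  \<open>C ^ k\<close> function is approximated by polynomials of degree \<open>N\<close> with error \<open>O(N ^ -k)\<close>, part (1) follows.
  For smooth \<open>f\<close> the interpolants converge faster than any power of \<open>d\<close>; a polynomial Markov
  inequality, again read off from the dual basis, transfers this to the derivatives.
\<close>

section \<open>Leja sequences\<close>

text \<open>The mean of \<open>M'\<close> along a segment is a difference quotient of
  \<open>M\<close>, so a ridge function is annihilated by every chord whose ends project to distinct
  zeros of \<open>M\<close>; a chord with equal projections needs a double zero. The nodes
  \<open>e s\<close> and \<open>e t\<close> project to the same point \<open>c\<close>, and leaving
  out one of their two factors makes \<open>c\<close> a simple zero: this separates the pair from
  all others. The same omission is the obstacle in the estimate, since the Leja inequality controls
  only \<open>(y - c) * M y\<close>. Its bound is proportional to \<open>1 - c^2\<close>, a quarter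
  of the squared chord length, and this pays for the division by \<open>y - c\<close>, provided that
  the Cauchy circle keeps away from \<open>c\<close>. The disks available in the ellipse have radius
  of order \<open>1 / d\<close> in the middle of the interval and \<open>1 / d^2\<close> at its
  ends, whence the loss of \<open>d^2\<close> per derivative. Leja sections are finite because the
  rotated copy inherits maximality only over its \<open>2 ^ n\<close> terms.\<close>

definition leja_section :: "nat \<Rightarrow> (nat \<Rightarrow> complex) \<Rightarrow> bool" where
  "leja_section N e \<longleftrightarrow>
     (\<forall>n<N. e n \<in> unit_disk) \<and>
     (\<forall>d. 1 \<le> d \<and> d < N \<longrightarrow>
        (\<forall>z\<in>unit_disk. cmod (\<Prod>j<d. z - e j) \<le> cmod (\<Prod>j<d. e d - e j)))"

lemma leja_sectionD:
  assumes "leja_section N e"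
  shows "n < N \<Longrightarrow> cmod (e n) \<le> 1"
    and "1 \<le> d \<Longrightarrow> d < N \<Longrightarrow> cmod z \<le> 1 \<Longrightarrow>
           cmod (\<Prod>j<d. z - e j) \<le> cmod (\<Prod>j<d. e d - e j)"
  using assms by (auto simp: leja_section_def)

lemma leja_section_mono: "leja_section N e \<Longrightarrow> M \<le> N \<Longrightarrow> leja_section M e"
  by (auto simp: leja_section_def)

lemma prod_diff_attains_max:
  fixes e :: "nat \<Rightarrow> complex"
  obtains v where "cmod v \<le> 1"
    and "\<And>z. cmod z \<le> 1 \<Longrightarrow> cmod (\<Prod>j<d. z - e j) \<le> cmod (\<Prod>j<d. v - e j)"
proof -
  have "\<exists>v\<in>unit_disk. \<forall>z\<in>unit_disk. cmod (\<Prod>j<d. z - e j) \<le> cmod (\<Prod>j<d. v - e j)"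
    by (rule continuous_attains_sup) (auto intro!: continuous_intros)
  then show thesis
    using that by auto
qed

lemma leja_section_snoc:
  assumes "leja_section N e" and "N \<ge> 1" and "cmod v \<le> 1"
    and "\<And>z. cmod z \<le> 1 \<Longrightarrow> cmod (\<Prod>j<N. z - e j) \<le> cmod (\<Prod>j<N. v - e j)"
  shows "leja_section (Suc N) (e(N := v))"
proof -
  have *: "(\<Prod>j<d. z - (e(N := v)) j) = (\<Prod>j<d. z - e j)" if "d \<le> N" for d z
    using that by (intro prod.cong) auto
  show ?thesis
    unfolding leja_section_def
  proof (intro conjI allI impI ballI)
    fix d z assume "1 \<le> d \<and> d < Suc N" "z \<in> unit_disk"
    then show "cmod (\<Prod>j<d. z - (e(N := v)) j) \<le> cmod (\<Prod>j<d. (e(N := v)) d - (e(N := v)) j)"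
      using assms by (cases "d = N") (auto simp: * leja_section_def)
  qed (use assms in \<open>auto simp: leja_section_def less_Suc_eq\<close>)
qed

text \<open>Greedy prolongation by maximisers. Completing a partial section to length
  \<open>2 ^ n\<close> makes the product formula applicable to a candidate maximiser.\<close>

lemma leja_section_extend:
  assumes "leja_section N e" and "1 \<le> N" and "N \<le> M"
  obtains e' where "leja_section M e'" and "\<And>j. j < N \<Longrightarrow> e' j = e j"
proof -
  have "\<exists>e'. leja_section M e' \<and> (\<forall>j<N. e' j = e j)"
    using assms(3)
  proof (induction M rule: dec_induct)
    case base
    then show ?case using assms by auto
  next
    case (step M)
    then obtain e' where e': "leja_section M e'" "\<forall>j<N. e' j = e j"
      by blast
    obtain v where "cmod v \<le> 1"
      and "\<And>z. cmod z \<le> 1 \<Longrightarrow> cmod (\<Prod>j<M. z - e' j) \<le> cmod (\<Prod>j<M. v - e' j)"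
      using prod_diff_attains_max by blast
    then have "leja_section (Suc M) (e'(M := v))"
      using leja_section_snoc e' step.hyps assms(2) by simp
    moreover have "\<forall>j<N. (e'(M := v)) j = e j"
      using e'(2) step.hyps by auto
    ultimately show ?case
      by blast
  qed
  then show thesis using that by blast
qed

lemma prod_lessThan_add:
  fixes f :: "nat \<Rightarrow> 'a::comm_monoid_mult"
  shows "(\<Prod>j<m + n. f j) = (\<Prod>j<m. f j) * (\<Prod>j<n. f (m + j))"
  by (induction n) (simp_all add: mult.assoc)

lemma cmod_power_minus_one_le: "cmod z \<le> 1 \<Longrightarrow> cmod (z ^ N - 1) \<le> 2"
  using norm_triangle_ineq4[of "z ^ N" 1] power_le_one[of "cmod z" N] by (simp add: norm_power)

lemma prod_diff_scale:
  fixes \<rho> z :: complex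
  assumes "\<rho> \<noteq> 0"
  shows "(\<Prod>j<r. z - \<rho> * u j) = \<rho> ^ r * (\<Prod>j<r. z / \<rho> - u j)"
proof -
  have "(\<Prod>j<r. z - \<rho> * u j) = (\<Prod>j<r. \<rho> * (z / \<rho> - u j))"
    by (intro prod.cong) (use assms in \<open>auto simp: field_simps\<close>)
  then show ?thesis
    by (simp add: prod.distrib)
qed

lemma cmod_eq_1_of_power:
  fixes z :: complex
  assumes "cmod (z ^ N) = 1" and "N > 0"
  shows "cmod z = 1"
  using assms power_eq_iff_eq_base[of N "cmod z" 1] by (simp add: norm_power)

text \<open>Equality case of the triangle inequality: in the disk only \<open>-1\<close> has
  distance 2 from 1.\<close>

lemma eq_minus_one_of_norm:
  fixes w :: complex
  assumes "2 \<le> cmod (w - 1)" and "cmod w \<le> 1"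
  shows "w = -1"
proof -
  have "4 \<le> (cmod (w - 1))\<^sup>2" and "(cmod w)\<^sup>2 \<le> 1"
    using power_mono[OF assms(1), of 2] power_mono[OF assms(2), of 2] by simp_all
  then have *: "4 \<le> (Re w)\<^sup>2 - 2 * Re w + 1 + (Im w)\<^sup>2" "(Re w)\<^sup>2 + (Im w)\<^sup>2 \<le> 1"
    unfolding cmod_power2 by (simp_all add: power2_diff)
  then have "Re w \<le> -1"
    by linarith
  moreover from this have "1 \<le> (Re w)\<^sup>2"
    using power_mono[of 1 "- Re w" 2] by simp
  moreover have "Im w = 0"
    using *(2) calculation power2_less_eq_zero_iff[of "Im w"] by linarith
  moreover have "(Re w)\<^sup>2 \<le> 1"
    using * \<open>Im w = 0\<close> by simp
  then have "- Re w \<le> 1"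
    using abs_square_le_1[of "Re w"] by linarith
  ultimately have "Re w = -1"
    by linarith
  with \<open>Im w = 0\<close> show ?thesis
    by (simp add: complex_eq_iff)
qed

text \<open>
  The splitting needs the product formula at level \<open>n\<close>, which in turn is inherited from the
  splitting at level \<open>n - 1\<close>. A maximiser \<open>v\<close> of \<open>\<Prod>j<r. \<bar>v - u j\<bar>\<close> extends a Leja section, hence is a
  root of unity, so \<open>\<rho> * v\<close> maximises the second factor \<open>\<bar>z ^ 2 ^ n - 1\<bar>\<close> as well.
\<close>

lemma leja_section_split_aux:
  assumes formula: "\<forall>e z. leja_section (2 ^ n) e \<longrightarrow> e 0 = 1 \<longrightarrow> (\<Prod>j<2 ^ n. z - e j) = z ^ (2 ^ n) - 1"
    and e: "leja_section (2 ^ Suc n) e" and e0: "e 0 = 1"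
  shows "\<exists>\<rho> u. \<rho> ^ (2 ^ n) = -1 \<and> cmod \<rho> = 1 \<and> leja_section (2 ^ n) u \<and> u 0 = 1 \<and>
           (\<forall>j. e (2 ^ n + j) = \<rho> * u j)"
proof -
  define N :: nat where "N = 2 ^ n"
  have N: "N \<ge> 1" "2 ^ Suc n = N + N"
    by (auto simp: N_def)
  have wN: "(\<Prod>j<N. z - e j) = z ^ N - 1" for z
    using formula[rule_format, of e z] leja_section_mono[OF e, of "2 ^ n"] e0 by (simp add: N_def)
  define \<rho> where "\<rho> = e N"
  have \<rho>1: "cmod \<rho> \<le> 1"
    using leja_sectionD(1)[OF e, of N] N by (simp add: \<rho>_def)
  \<comment> \<open>A point where \<open>\<bar>z ^ N - 1\<bar>\<close> takes its largest value 2, so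
    that the maximality of \<open>e N\<close> forces \<open>\<rho> ^ N = -1\<close>.\<close>
  define \<zeta> where "\<zeta> = cis (pi / real N)"
  have \<zeta>: "\<zeta> ^ N = -1" "cmod \<zeta> = 1"
    using N by (auto simp: \<zeta>_def Complex.DeMoivre)
  have "cmod (\<zeta> ^ N - 1) \<le> cmod (\<rho> ^ N - 1)"
    using leja_sectionD(2)[OF e, of N \<zeta>] N \<zeta> by (simp add: wN \<rho>_def)
  then have big: "2 \<le> cmod (\<rho> ^ N - 1)"
    by (simp add: \<zeta>)
  have small: "cmod (\<rho> ^ N) \<le> 1"
    using \<rho>1 by (simp add: norm_power power_le_one)
  have \<rho>: "\<rho> ^ N = -1"
    by (rule eq_minus_one_of_norm[OF big small])
  have \<rho>n: "cmod \<rho> = 1" "\<rho> \<noteq> 0"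
    using cmod_eq_1_of_power[of \<rho> N] \<rho> N by auto
  define u where "u j = e (N + j) / \<rho>" for j
  have eu: "e (N + j) = \<rho> * u j" for j
    using \<rho>n by (simp add: u_def)
  have u0: "u 0 = 1"
    using \<rho>n by (simp add: u_def \<rho>_def)
  have un: "cmod (u j) \<le> 1" if "j < N" for j
    using leja_sectionD(1)[OF e, of "N + j"] that N \<rho>n by (simp add: u_def norm_divide)
  have prod_e: "cmod (\<Prod>j<N + r. z - e j) = cmod (z ^ N - 1) * cmod (\<Prod>j<r. z / \<rho> - u j)" for r z
    unfolding prod_lessThan_add wN eu using \<rho>n
    by (simp add: prod_diff_scale norm_mult norm_power)
  have "leja_section r u" if "1 \<le> r" "r \<le> N" for r
    using that
  proof (induction r rule: dec_induct)
    case base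
    then show ?case
      using un[of 0] N by (auto simp: leja_section_def)
  next
    case (step r)
    then have r: "1 \<le> r" "r < N" and IH: "leja_section r u"
      by auto
    obtain v where v: "cmod v \<le> 1"
      and vmax: "\<And>z. cmod z \<le> 1 \<Longrightarrow> cmod (\<Prod>j<r. z - u j) \<le> cmod (\<Prod>j<r. v - u j)"
      using prod_diff_attains_max by blast
    have "leja_section (Suc r) (u(r := v))"
      using leja_section_snoc[OF IH] r v vmax by simp
    then obtain u' where u': "leja_section N u'" "\<And>j. j < Suc r \<Longrightarrow> u' j = (u(r := v)) j"
      using leja_section_extend[of "Suc r" "u(r := v)" N] r by auto
    have "u' 0 = 1"
      using u'(2)[of 0] u0 r by auto
    then have "(\<Prod>j<N. v - u' j) = v ^ N - 1"
      using formula[rule_format, of u' v] u' by (simp add: N_def)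
    moreover have "(\<Prod>j<N. v - u' j) = 0"
      using u'(2)[of r] r by (intro prod_zero bexI[of _ r]) auto
    ultimately have vN: "v ^ N = 1"
      by simp
    have "cmod (\<rho> * v) \<le> 1" "(\<rho> * v) / \<rho> = v"
      using v \<rho>n by (auto simp: norm_mult)
    then have "cmod ((\<rho> * v) ^ N - 1) * cmod (\<Prod>j<r. v - u j)
                 \<le> cmod ((e (N + r)) ^ N - 1) * cmod (\<Prod>j<r. e (N + r) / \<rho> - u j)"
      using leja_sectionD(2)[OF e, of "N + r" "\<rho> * v"] r N
      by (simp add: prod_e)
    also have "\<dots> \<le> 2 * cmod (\<Prod>j<r. u r - u j)"
      using un[of r] r \<rho>n eu by (intro mult_mono cmod_power_minus_one_le) (auto simp: norm_mult)
    finally have le: "cmod (\<Prod>j<r. v - u j) \<le> cmod (\<Prod>j<r. u r - u j)"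
      by (simp add: power_mult_distrib vN \<rho>)
    \<comment> \<open>Updating \<open>u\<close> at \<open>r\<close> by its own value reads the
      extension lemma as a statement about \<open>u\<close>.\<close>
    have "leja_section (Suc r) (u(r := u r))"
      by (rule leja_section_snoc[OF IH r(1) un[OF r(2)] order.trans[OF vmax le]])
    then show ?case by simp
  qed
  then have "leja_section N u"
    using N by simp
  then show ?thesis
    using \<rho> \<rho>n u0 eu by (auto simp: N_def intro!: exI[of _ \<rho>] exI[of _ u])
qed

text \<open>By the splitting, the two halves contribute \<open>z ^ N - 1\<close> and
  \<open>z ^ N + 1\<close> with \<open>N = 2 ^ n\<close>: rotation by an \<open>N\<close>-th root of
  -1 changes the sign of the constant.\<close>

lemma leja_section_prod:
  assumes "leja_section (2 ^ n) e" and "e 0 = 1"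
  shows "(\<Prod>j<2 ^ n. z - e j) = z ^ (2 ^ n) - 1"
  using assms
proof (induction n arbitrary: e z)
  case 0
  then show ?case by (simp add: lessThan_Suc)
next
  case (Suc n)
  obtain \<rho> u where *: "\<rho> ^ (2 ^ n) = -1" "cmod \<rho> = 1" "leja_section (2 ^ n) u" "u 0 = 1"
    "\<And>j. e (2 ^ n + j) = \<rho> * u j"
    using leja_section_split_aux[OF _ Suc.prems] Suc.IH by blast
  have "\<rho> \<noteq> 0"
    using * by auto
  have "(\<Prod>j<2 ^ Suc n. z - e j) = (\<Prod>j<2 ^ n. z - e j) * (\<Prod>j<2 ^ n. z - \<rho> * u j)"
    using prod_lessThan_add[of "\<lambda>j. z - e j" "2 ^ n" "2 ^ n"] by (simp add: * mult_2)
  also have "(\<Prod>j<2 ^ n. z - e j) = z ^ (2 ^ n) - 1"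
    using Suc.prems by (intro Suc.IH) (auto elim: leja_section_mono)
  also have "(\<Prod>j<2 ^ n. z - \<rho> * u j) = z ^ (2 ^ n) + 1"
    using \<open>\<rho> \<noteq> 0\<close> * Suc.IH[of u "z / \<rho>"]
    by (simp add: prod_diff_scale power_divide)
  finally show ?case
    by (simp add: algebra_simps power_add[symmetric] mult_2[symmetric])
qed

lemma leja_section_split:
  assumes "leja_section (2 ^ Suc n) e" and "e 0 = 1"
  shows "\<exists>\<rho> u. \<rho> ^ (2 ^ n) = -1 \<and> cmod \<rho> = 1 \<and> leja_section (2 ^ n) u \<and> u 0 = 1 \<and>
           (\<forall>j. e (2 ^ n + j) = \<rho> * u j)"
  using leja_section_split_aux[OF _ assms] leja_section_prod by blast

lemma prod_atLeastLessThan_shift: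
  fixes f :: "nat \<Rightarrow> 'a::comm_monoid_mult"
  shows "(\<Prod>j=m + r..<m + n. f j) = (\<Prod>j=r..<n. f (m + j))"
  using prod.shift_bounds_nat_ivl[of f r m n] by (simp add: add.commute)

text \<open>Each doubling of the length costs one factor of at most 2. If \<open>d\<close> lies in
  the first half, the second half enters the product at \<open>\<zeta>\<close> as a whole; otherwise
  the first half enters the product at \<open>z\<close> as a whole; and a whole half has the form
  \<open>x ^ N - 1\<close> up to rotation. Two points are kept apart because \<open>z\<close> will
  range over the disk while \<open>\<zeta>\<close> is a node.\<close>

lemma leja_section_prod_mult_le:
  assumes "leja_section (2 ^ n) e" and "e 0 = 1" and "1 \<le> d" "d \<le> 2 ^ n"
    and "cmod z \<le> 1" "cmod \<zeta> \<le> 1"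
  shows "cmod (\<Prod>j<d. z - e j) * cmod (\<Prod>j=d..<2 ^ n. \<zeta> - e j) \<le> 2 ^ Suc n"
  using assms
proof (induction n arbitrary: e d z \<zeta>)
  case 0
  then have "d = 1" by simp
  then show ?case
    using 0 cmod_power_minus_one_le[of z 1] by (simp add: lessThan_Suc)
next
  case (Suc n)
  define N :: nat where "N = 2 ^ n"
  have N: "N \<ge> 1" "2 ^ Suc n = N + N"
    by (auto simp: N_def)
  obtain \<rho> u where *: "\<rho> ^ N = -1" "cmod \<rho> = 1" "leja_section N u" "u 0 = 1"
    "\<And>j. e (N + j) = \<rho> * u j"
    using leja_section_split[OF Suc.prems(1,2)] unfolding N_def by blast
  have \<rho>0: "\<rho> \<noteq> 0" using * by auto
  have eN: "leja_section N e"
    using leja_section_mono[OF Suc.prems(1)] by (simp add: N_def)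
  have wN: "(\<Prod>j<N. x - e j) = x ^ N - 1" "(\<Prod>j<N. x - u j) = x ^ N - 1" for x
    using leja_section_prod[of n e x] leja_section_prod[of n u x] eN * Suc.prems(2)
    by (auto simp: N_def)
  have norm_quot: "cmod (z / \<rho>) \<le> 1" "cmod (\<zeta> / \<rho>) \<le> 1"
    using Suc.prems * by (auto simp: norm_divide)
  have rest: "cmod (\<Prod>j=N + r..<N + N. \<zeta> - e j) = cmod (\<Prod>j=r..<N. \<zeta> / \<rho> - u j)" for r
  proof -
    have "(\<Prod>j=N + r..<N + N. \<zeta> - e j) = (\<Prod>j=r..<N. \<rho> * (\<zeta> / \<rho> - u j))"
      unfolding prod_atLeastLessThan_shift using \<rho>0
      by (intro prod.cong) (auto simp: * right_diff_distrib)
    then show ?thesis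
      using * by (simp add: prod.distrib norm_mult norm_power)
  qed
  consider "d \<le> N" | "d = N + N" | r where "d = N + r" "1 \<le> r" "r < N"
  proof -
    have "d \<le> N + N"
      using Suc.prems N by simp
    then consider "d \<le> N" | "d = N + N" | "1 \<le> d - N" "d - N < N" "d = N + (d - N)"
      by linarith
    then show thesis
      using that by metis
  qed
  then show ?case
  proof cases
    case 1
    have "(\<Prod>j=d..<N + N. \<zeta> - e j) = (\<Prod>j=d..<N. \<zeta> - e j) * (\<Prod>j=N..<N + N. \<zeta> - e j)"
      using 1 by (simp add: prod.atLeastLessThan_concat)
    then have "cmod (\<Prod>j<d. z - e j) * cmod (\<Prod>j=d..<N + N. \<zeta> - e j) =
        (cmod (\<Prod>j<d. z - e j) * cmod (\<Prod>j=d..<N. \<zeta> - e j)) * cmod ((\<zeta> / \<rho>) ^ N - 1)"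
      using rest[of 0] by (simp add: norm_mult wN atLeast0LessThan)
    also have "\<dots> \<le> 2 ^ Suc n * 2"
      using Suc.IH[of e d z \<zeta>] Suc.prems 1 eN norm_quot
      by (intro mult_mono cmod_power_minus_one_le) (auto simp: N_def)
    finally show ?thesis
      unfolding N by simp
  next
    case 2
    then have "cmod (\<Prod>j<d. z - e j) * cmod (\<Prod>j=d..<2 ^ Suc n. \<zeta> - e j) = cmod (z ^ d - 1)"
      using leja_section_prod[OF Suc.prems(1,2)] N by simp
    also have "\<dots> \<le> 2 * 1"
      using Suc.prems cmod_power_minus_one_le by simp
    also have "\<dots> \<le> 2 * 2 ^ Suc n"
      by (intro mult_left_mono one_le_power) auto
    finally show ?thesis by simp
  next
    case 3
    have "cmod (\<Prod>j<d. z - e j) = cmod (z ^ N - 1) * cmod (\<Prod>j<r. z / \<rho> - u j)"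
      unfolding 3 prod_lessThan_add wN *(5) using \<rho>0 *(2)
      by (simp add: prod_diff_scale norm_mult norm_power)
    then have "cmod (\<Prod>j<d. z - e j) * cmod (\<Prod>j=d..<2 ^ Suc n. \<zeta> - e j) =
        cmod (z ^ N - 1) * (cmod (\<Prod>j<r. z / \<rho> - u j) * cmod (\<Prod>j=r..<N. \<zeta> / \<rho> - u j))"
      unfolding N 3 rest by simp
    also have "\<dots> \<le> 2 * 2 ^ Suc n"
      using Suc.IH[of u r "z / \<rho>" "\<zeta> / \<rho>"] Suc.prems 3 * norm_quot
      by (intro mult_mono cmod_power_minus_one_le) (auto simp: N_def)
    finally show ?thesis by simp
  qed
qed

section \<open>Node polynomials of an infinite Leja sequence\<close>

context
  fixes e :: "nat \<Rightarrow> complex"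
  assumes leja: "leja_disk e" and e0: "e 0 = 1"
begin

lemma leja_section_leja_disk: "leja_section N e"
  using leja by (auto simp: leja_disk_def leja_section_def)

lemma leja_disk_prod: "(\<Prod>j<2 ^ n. z - e j) = z ^ (2 ^ n) - 1"
  by (rule leja_section_prod[OF leja_section_leja_disk e0])

text \<open>As \<open>s < 2 ^ s\<close>, the node \<open>e s\<close> is among the roots of
  \<open>z ^ 2 ^ s - 1\<close>.\<close>

lemma norm_leja_disk: "cmod (e s) = 1"
proof (rule cmod_eq_1_of_power)
  have "(\<Prod>j<2 ^ s. e s - e j) = 0"
    by (rule prod_zero, simp, rule bexI[of _ s]) simp_all
  then show "cmod (e s ^ 2 ^ s) = 1"
    unfolding leja_disk_prod by simp
qed simp

text \<open>The product is the derivative of \<open>z ^ 2 ^ n - 1\<close> at its root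
  \<open>e s\<close>.\<close>

lemma norm_prod_leja_disk:
  assumes "s < 2 ^ n"
  shows "cmod (\<Prod>j\<in>{..<2 ^ n} - {s}. e s - e j) = 2 ^ n"
proof -
  define g where "g z = (\<Prod>j\<in>{..<2 ^ n} - {s}. z - e j)" for z
  have "(\<lambda>z. (z - e s) * g z) = (\<lambda>z. z ^ 2 ^ n - 1)"
  proof
    fix z
    show "(z - e s) * g z = z ^ 2 ^ n - 1"
      unfolding g_def leja_disk_prod[symmetric]
      by (rule prod.remove[symmetric]) (use assms in auto)
  qed
  moreover have "((\<lambda>z. (z - e s) * g z) has_field_derivative g (e s)) (at (e s))"
  proof -
    have "g field_differentiable at (e s)"
      unfolding g_def by (intro holomorphic_on_imp_differentiable_at[of _ UNIV] holomorphic_intros) auto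
    then obtain g' where "(g has_field_derivative g') (at (e s))"
      by (auto simp: field_differentiable_def)
    then show ?thesis
      by (auto intro!: derivative_eq_intros)
  qed
  moreover have "((\<lambda>z. z ^ 2 ^ n - 1) has_field_derivative of_nat (2 ^ n) * e s ^ (2 ^ n - 1)) (at (e s))"
    by (auto intro!: derivative_eq_intros)
  ultimately have "g (e s) = of_nat (2 ^ n) * e s ^ (2 ^ n - 1)"
    by (metis DERIV_unique)
  then show ?thesis
    by (simp add: g_def norm_mult norm_power norm_leja_disk)
qed

text \<open>A repeated node would annihilate a product whose modulus is a power of 2.\<close>

lemma inj_leja_disk: "inj e"
proof (rule linorder_injI)
  fix s t :: nat assume "s < t"
  show "e s \<noteq> e t"
  proof
    assume "e s = e t"
    moreover have "t < 2 ^ t" "s < 2 ^ t"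
      using \<open>s < t\<close> less_exp[of t] by linarith+
    ultimately have "(\<Prod>j\<in>{..<2 ^ t} - {t}. e t - e j) = 0"
      using \<open>s < t\<close> by (intro prod_zero bexI[of _ s]) auto
    then show False
      using norm_prod_leja_disk[OF \<open>t < 2 ^ t\<close>] by (simp only: norm_zero) simp
  qed
qed

text \<open>The nodes are completed to \<open>2 ^ d\<close> of them. The product \<open>C\<close> of
  the added factors at \<open>e s\<close> turns the right-hand product into exactly
  \<open>2 ^ d\<close> and the left-hand one into at most \<open>2 ^ Suc d\<close>; dividing by
  \<open>C\<close> leaves the factor 2.\<close>

lemma leja_disk_prod_le:
  assumes "s < d" and "cmod z \<le> 1"
  shows "cmod (\<Prod>j<d. z - e j) \<le> 2 * cmod (\<Prod>j\<in>{..<d} - {s}. e s - e j)"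
proof -
  define N :: nat where "N = 2 ^ d"
  define C where "C = cmod (\<Prod>j=d..<N. e s - e j)"
  define X where "X = cmod (\<Prod>j\<in>{..<d} - {s}. e s - e j)"
  have d: "d < N"
    unfolding N_def by (rule less_exp)
  have "{..<N} - {s} = ({..<d} - {s}) \<union> {d..<N}"
    using d assms by auto
  moreover have "(\<Prod>j\<in>({..<d} - {s}) \<union> {d..<N}. e s - e j) =
      (\<Prod>j\<in>{..<d} - {s}. e s - e j) * (\<Prod>j=d..<N. e s - e j)"
    by (rule prod.union_disjoint) auto
  ultimately have eq: "X * C = 2 ^ d"
    using norm_prod_leja_disk[of s d] assms d unfolding N_def[symmetric] X_def C_def
    by (simp add: norm_mult del: prod_norm)
  have "cmod (\<Prod>j<d. z - e j) * C \<le> 2 ^ Suc d"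
    unfolding C_def N_def
  proof (rule leja_section_prod_mult_le[OF leja_section_leja_disk e0])
    show "1 \<le> d" "cmod z \<le> 1" "cmod (e s) \<le> 1" "d \<le> 2 ^ d"
      using assms norm_leja_disk[of s] less_imp_le[OF less_exp] by auto
  qed
  also have "\<dots> = (2 * X) * C"
    using eq by simp
  finally have "cmod (\<Prod>j<d. z - e j) * C \<le> (2 * X) * C" .
  moreover have "C > 0"
  proof -
    have "C \<noteq> 0"
      using eq by (intro notI) simp
    then show ?thesis
      by (simp add: C_def)
  qed
  ultimately show ?thesis
    unfolding X_def by (simp only: mult_le_cancel_right_pos)
qed

end

section \<open>Bivariate polynomials\<close>

abbreviation deg_set :: "nat \<Rightarrow> (nat \<times> nat) set" where
  "deg_set N \<equiv> {(i, j). i + j \<le> N}"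

lemma finite_deg_set [simp]: "finite (deg_set N)"
  by (rule finite_subset[of _ "{..N} \<times> {..N}"]) auto

text \<open>A kernel evaluated at a multiple of \<open>y - x\<close> is of this kind. Integration
  over the parameter \<open>y\<close> acts on the coefficients alone and leaves a polynomial in
  \<open>x\<close> of the same degree.\<close>

definition param_polys :: "nat \<Rightarrow> (complex \<Rightarrow> complex \<Rightarrow> real) set" where
  "param_polys N = {F. \<exists>h. (\<forall>i j. continuous_on UNIV (h i j)) \<and>
     (\<forall>x y. F x y = (\<Sum>(i, j)\<in>deg_set N. h i j y * Re x ^ i * Im x ^ j))}"

lemma param_polysE:
  assumes "F \<in> param_polys N"
  obtains h where "\<And>i j. continuous_on UNIV (h i j)"
    and "\<And>x y. F x y = (\<Sum>(i, j)\<in>deg_set N. h i j y * Re x ^ i * Im x ^ j)"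
  using assms unfolding param_polys_def by blast

lemma param_polysI:
  assumes "\<And>i j. continuous_on UNIV (h i j)"
    and "\<And>x y. F x y = (\<Sum>(i, j)\<in>deg_set N. h i j y * Re x ^ i * Im x ^ j)"
  shows "F \<in> param_polys N"
  using assms unfolding param_polys_def by blast

lemma param_polys_mono:
  assumes "F \<in> param_polys N" and "N \<le> M"
  shows "F \<in> param_polys M"
proof -
  obtain h where h: "\<And>i j. continuous_on UNIV (h i j)"
    and F: "\<And>x y. F x y = (\<Sum>(i, j)\<in>deg_set N. h i j y * Re x ^ i * Im x ^ j)"
    by (rule param_polysE[OF assms(1)], rule that)
  show ?thesis
  proof (rule param_polysI[where h = "\<lambda>i j y. if i + j \<le> N then h i j y else 0"])
    show "continuous_on UNIV (\<lambda>y. if i + j \<le> N then h i j y else 0)" for i j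
      using h by (cases "i + j \<le> N") auto
    show "F x y = (\<Sum>(i, j)\<in>deg_set M. (if i + j \<le> N then h i j y else 0) * Re x ^ i * Im x ^ j)" for x y
      unfolding F using assms(2) by (intro sum.mono_neutral_cong_left) (auto split: if_splits)
  qed
qed

lemma param_polys_coeff:
  assumes "continuous_on UNIV c"
  shows "(\<lambda>x y. c y) \<in> param_polys N"
proof (rule param_polysI[where h = "\<lambda>i j y. if i = 0 \<and> j = 0 then c y else 0"])
  show "continuous_on UNIV (\<lambda>y. if i = 0 \<and> j = 0 then c y else 0)" for i j :: nat
    using assms by (cases "i = 0 \<and> j = 0") auto
  show "c y = (\<Sum>(i, j)\<in>deg_set N. (if i = 0 \<and> j = 0 then c y else 0) * Re x ^ i * Im x ^ j)" for x y
  proof -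
    have "(\<Sum>(i, j)\<in>deg_set N. (if i = 0 \<and> j = 0 then c y else 0) * Re x ^ i * Im x ^ j)
        = (\<Sum>p\<in>deg_set N. if p = (0, 0) then c y else 0)"
      by (rule sum.cong) (auto split: if_splits)
    then show ?thesis by simp
  qed
qed

lemma param_polys_add:
  assumes "F \<in> param_polys N" and "G \<in> param_polys N"
  shows "(\<lambda>x y. F x y + G x y) \<in> param_polys N"
proof -
  obtain h where h: "\<And>i j. continuous_on UNIV (h i j)"
    and F: "\<And>x y. F x y = (\<Sum>(i, j)\<in>deg_set N. h i j y * Re x ^ i * Im x ^ j)"
    by (rule param_polysE[OF assms(1)], rule that)
  obtain k where k: "\<And>i j. continuous_on UNIV (k i j)"
    and G: "\<And>x y. G x y = (\<Sum>(i, j)\<in>deg_set N. k i j y * Re x ^ i * Im x ^ j)"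
    by (rule param_polysE[OF assms(2)], rule that)
  show ?thesis
    by (rule param_polysI[where h = "\<lambda>i j y. h i j y + k i j y"])
       (auto intro!: continuous_intros h k simp: F G sum.distrib[symmetric] algebra_simps case_prod_unfold)
qed

lemma param_polys_sum:
  assumes "\<And>i. i \<in> I \<Longrightarrow> F i \<in> param_polys N"
  shows "(\<lambda>x y. \<Sum>i\<in>I. F i x y) \<in> param_polys N"
  using assms
  by (induction I rule: infinite_finite_induct) (auto intro: param_polys_add param_polys_coeff)

lemma param_polys_mult_coeff:
  assumes "F \<in> param_polys N" and "continuous_on UNIV c"
  shows "(\<lambda>x y. c y * F x y) \<in> param_polys N"
proof -
  obtain h where h: "\<And>i j. continuous_on UNIV (h i j)"
    and F: "\<And>x y. F x y = (\<Sum>(i, j)\<in>deg_set N. h i j y * Re x ^ i * Im x ^ j)"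
    by (rule param_polysE[OF assms(1)], rule that)
  show ?thesis
    by (rule param_polysI[where h = "\<lambda>i j y. c y * h i j y"])
       (auto intro!: continuous_intros h assms(2) simp: F sum_distrib_left mult.assoc case_prod_unfold)
qed

lemma param_polys_mult_Re:
  assumes "F \<in> param_polys N"
  shows "(\<lambda>x y. Re x * F x y) \<in> param_polys (Suc N)"
proof -
  obtain h where h: "\<And>i j. continuous_on UNIV (h i j)"
    and F: "\<And>x y. F x y = (\<Sum>(i, j)\<in>deg_set N. h i j y * Re x ^ i * Im x ^ j)"
    by (rule param_polysE[OF assms(1)], rule that)
  show ?thesis
  proof (rule param_polysI[where h = "\<lambda>i j y. if i = 0 then 0 else h (i - 1) j y"])
    show "continuous_on UNIV (\<lambda>y. if i = 0 then 0 else h (i - 1) j y)" for i j :: nat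
      using h by (cases "i = 0") auto
    have img: "(\<lambda>(i, j). (Suc i, j)) ` deg_set N = {p \<in> deg_set (Suc N). fst p \<noteq> 0}"
      by (auto simp: image_iff gr0_conv_Suc)
    fix x y
    have "(\<Sum>(i, j)\<in>deg_set (Suc N). (if i = 0 then 0 else h (i - 1) j y) * Re x ^ i * Im x ^ j)
        = (\<Sum>(i, j)\<in>(\<lambda>(i, j). (Suc i, j)) ` deg_set N. h (i - 1) j y * Re x ^ i * Im x ^ j)"
      by (intro sum.mono_neutral_cong_right) (auto simp: img split: if_splits)
    also have "\<dots> = (\<Sum>(i, j)\<in>deg_set N. h i j y * Re x ^ Suc i * Im x ^ j)"
      by (subst sum.reindex) (auto simp: inj_on_def case_prod_unfold)
    finally show "Re x * F x y =
        (\<Sum>(i, j)\<in>deg_set (Suc N). (if i = 0 then 0 else h (i - 1) j y) * Re x ^ i * Im x ^ j)"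
      by (simp add: F sum_distrib_left case_prod_unfold mult_ac)
  qed
qed

lemma param_polys_mult_Im:
  assumes "F \<in> param_polys N"
  shows "(\<lambda>x y. Im x * F x y) \<in> param_polys (Suc N)"
proof -
  obtain h where h: "\<And>i j. continuous_on UNIV (h i j)"
    and F: "\<And>x y. F x y = (\<Sum>(i, j)\<in>deg_set N. h i j y * Re x ^ i * Im x ^ j)"
    by (rule param_polysE[OF assms(1)], rule that)
  show ?thesis
  proof (rule param_polysI[where h = "\<lambda>i j y. if j = 0 then 0 else h i (j - 1) y"])
    show "continuous_on UNIV (\<lambda>y. if j = 0 then 0 else h i (j - 1) y)" for i j :: nat
      using h by (cases "j = 0") auto
    have img: "(\<lambda>(i, j). (i, Suc j)) ` deg_set N = {p \<in> deg_set (Suc N). snd p \<noteq> 0}"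
      by (auto simp: image_iff gr0_conv_Suc)
    fix x y
    have "(\<Sum>(i, j)\<in>deg_set (Suc N). (if j = 0 then 0 else h i (j - 1) y) * Re x ^ i * Im x ^ j)
        = (\<Sum>(i, j)\<in>(\<lambda>(i, j). (i, Suc j)) ` deg_set N. h i (j - 1) y * Re x ^ i * Im x ^ j)"
      by (intro sum.mono_neutral_cong_right) (auto simp: img split: if_splits)
    also have "\<dots> = (\<Sum>(i, j)\<in>deg_set N. h i j y * Re x ^ i * Im x ^ Suc j)"
      by (subst sum.reindex) (auto simp: inj_on_def case_prod_unfold)
    finally show "Im x * F x y =
        (\<Sum>(i, j)\<in>deg_set (Suc N). (if j = 0 then 0 else h i (j - 1) y) * Re x ^ i * Im x ^ j)"
      by (simp add: F sum_distrib_left case_prod_unfold mult_ac)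
  qed
qed

lemma param_polys_mult_monom:
  assumes "F \<in> param_polys N"
  shows "(\<lambda>x y. Re x ^ i * Im x ^ j * F x y) \<in> param_polys (N + i + j)"
proof (induction i)
  case 0
  show ?case
  proof (induction j)
    case 0
    then show ?case using assms by simp
  next
    case (Suc j)
    then show ?case
      using param_polys_mult_Im[OF Suc] by (simp add: mult_ac)
  qed
next
  case (Suc i)
  then show ?case
    using param_polys_mult_Re[OF Suc] by (simp add: mult_ac)
qed

lemma param_polys_mult:
  assumes "F \<in> param_polys N" and "G \<in> param_polys M"
  shows "(\<lambda>x y. F x y * G x y) \<in> param_polys (N + M)"
proof -
  obtain h where h: "\<And>i j. continuous_on UNIV (h i j)"
    and F: "\<And>x y. F x y = (\<Sum>(i, j)\<in>deg_set N. h i j y * Re x ^ i * Im x ^ j)"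
    by (rule param_polysE[OF assms(1)], rule that)
  have "(\<lambda>x y. \<Sum>p\<in>deg_set N. h (fst p) (snd p) y * (Re x ^ fst p * Im x ^ snd p * G x y))
      \<in> param_polys (N + M)"
  proof (rule param_polys_sum)
    fix p assume "p \<in> deg_set N"
    then have "M + fst p + snd p \<le> N + M"
      by auto
    with param_polys_mult_monom[OF assms(2)]
    have "(\<lambda>x y. Re x ^ fst p * Im x ^ snd p * G x y) \<in> param_polys (N + M)"
      by (rule param_polys_mono)
    then show "(\<lambda>x y. h (fst p) (snd p) y * (Re x ^ fst p * Im x ^ snd p * G x y)) \<in> param_polys (N + M)"
      using h by (rule param_polys_mult_coeff)
  qed
  then show ?thesis
    by (simp add: F sum_distrib_right case_prod_unfold mult.assoc)
qed

lemma param_polys_power: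
  assumes "F \<in> param_polys N"
  shows "(\<lambda>x y. F x y ^ k) \<in> param_polys (k * N)"
proof (induction k)
  case 0
  show ?case by (simp add: param_polys_coeff)
next
  case (Suc k)
  then show ?case
    using param_polys_mult[OF assms Suc] by simp
qed

lemma param_polys_Re: "(\<lambda>x y. Re x) \<in> param_polys 1"
  using param_polys_mult_Re[OF param_polys_coeff[of "\<lambda>y. 1" 0]] by simp

lemma param_polys_Im: "(\<lambda>x y. Im x) \<in> param_polys 1"
  using param_polys_mult_Im[OF param_polys_coeff[of "\<lambda>y. 1" 0]] by simp

lemma polys2_of_param: "F \<in> param_polys N \<Longrightarrow> (\<lambda>x. F x y) \<in> polys2 N"
  unfolding param_polys_def polys2_def by force

lemma param_of_polys2: "P \<in> polys2 N \<Longrightarrow> (\<lambda>x y. P x) \<in> param_polys N"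
  unfolding polys2_def by (auto intro: param_polysI[where h = "\<lambda>i j y. _ i j"])

lemma integral_param_polys:
  assumes "F \<in> param_polys N" and "compact B" and "B \<in> sets lborel" and "continuous_on B f"
  shows "(\<lambda>x. \<integral>y\<in>B. f y * F x y \<partial>lborel) \<in> polys2 N"
proof -
  obtain h where h: "\<And>i j. continuous_on UNIV (h i j)"
    and F: "\<And>x y. F x y = (\<Sum>(i, j)\<in>deg_set N. h i j y * Re x ^ i * Im x ^ j)"
    by (rule param_polysE[OF assms(1)], rule that)
  have int: "set_integrable lborel B (\<lambda>y. f y * h i j y)" for i j
    unfolding set_integrable_def using assms(2,4) continuous_on_subset[OF h]
    by (intro borel_integrable_compact continuous_on_mult) auto
  have "(\<integral>y\<in>B. f y * F x y \<partial>lborel) =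
      (\<Sum>(i, j)\<in>deg_set N. (\<integral>y\<in>B. f y * h i j y \<partial>lborel) * Re x ^ i * Im x ^ j)" for x
  proof -
    have "f y * F x y = (\<Sum>p\<in>deg_set N. (f y * h (fst p) (snd p) y) * (Re x ^ fst p * Im x ^ snd p))" for y
      by (simp add: F sum_distrib_left case_prod_unfold mult.assoc)
    then have "(\<integral>y\<in>B. f y * F x y \<partial>lborel) =
        (\<integral>y\<in>B. (\<Sum>p\<in>deg_set N. (f y * h (fst p) (snd p) y) * (Re x ^ fst p * Im x ^ snd p)) \<partial>lborel)"
      by simp
    also have "\<dots> = (\<Sum>p\<in>deg_set N. (\<integral>y\<in>B. (f y * h (fst p) (snd p) y) * (Re x ^ fst p * Im x ^ snd p) \<partial>lborel))"
      unfolding set_lebesgue_integral_def scaleR_sum_right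
      by (rule Bochner_Integration.integral_sum)
         (use set_integrable_mult_left[OF int] in \<open>auto simp: set_integrable_def\<close>)
    also have "\<dots> = (\<Sum>p\<in>deg_set N. (\<integral>y\<in>B. (f y * h (fst p) (snd p) y) \<partial>lborel) * (Re x ^ fst p * Im x ^ snd p))"
      by simp
    finally show ?thesis
      by (simp add: case_prod_unfold mult.assoc)
  qed
  then show ?thesis
    unfolding polys2_def mem_Collect_eq
    by (intro exI[of _ "\<lambda>i j. \<integral>y\<in>B. f y * h i j y \<partial>lborel"] allI) (simp add: case_prod_unfold)
qed

lemma polys2_add: "P \<in> polys2 N \<Longrightarrow> Q \<in> polys2 N \<Longrightarrow> (\<lambda>x. P x + Q x) \<in> polys2 N"
  by (rule polys2_of_param[OF param_polys_add[OF param_of_polys2 param_of_polys2]])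

lemma polys2_mult: "P \<in> polys2 N \<Longrightarrow> Q \<in> polys2 M \<Longrightarrow> (\<lambda>x. P x * Q x) \<in> polys2 (N + M)"
  by (rule polys2_of_param[OF param_polys_mult[OF param_of_polys2 param_of_polys2]])

lemma polys2_power: "P \<in> polys2 N \<Longrightarrow> (\<lambda>x. P x ^ k) \<in> polys2 (k * N)"
  by (rule polys2_of_param[OF param_polys_power[OF param_of_polys2]])

lemma polys2_mono: "P \<in> polys2 N \<Longrightarrow> N \<le> M \<Longrightarrow> P \<in> polys2 M"
  by (rule polys2_of_param[OF param_polys_mono[OF param_of_polys2]])

lemma polys2_const: "(\<lambda>x. c) \<in> polys2 N"
  by (rule polys2_of_param[OF param_polys_coeff]) simp

lemma polys2_Re: "Re \<in> polys2 1"
  using polys2_of_param[OF param_polys_Re] .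

lemma polys2_Im: "Im \<in> polys2 1"
  using polys2_of_param[OF param_polys_Im] .

lemma polys2_cmult: "P \<in> polys2 N \<Longrightarrow> (\<lambda>x. c * P x) \<in> polys2 N"
  using polys2_mult[OF polys2_const[of c 0]] by simp

lemma polys2_diff: "P \<in> polys2 N \<Longrightarrow> Q \<in> polys2 N \<Longrightarrow> (\<lambda>x. P x - Q x) \<in> polys2 N"
  using polys2_add[OF _ polys2_cmult[of Q N "-1"]] by simp

lemma polys2_sum: "(\<And>i. i \<in> I \<Longrightarrow> P i \<in> polys2 N) \<Longrightarrow> (\<lambda>x. \<Sum>i\<in>I. P i x) \<in> polys2 N"
  by (induction I rule: infinite_finite_induct) (auto intro: polys2_add polys2_const)

lemma polys2_monom: "i + j \<le> N \<Longrightarrow> (\<lambda>x. Re x ^ i * Im x ^ j) \<in> polys2 N"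
  using polys2_mono[OF polys2_mult[OF polys2_power[OF polys2_Re] polys2_power[OF polys2_Im]]] by simp

lemma polys2E:
  assumes "P \<in> polys2 N"
  obtains c where "P = (\<lambda>z. \<Sum>p\<in>deg_set N. c p * (Re z ^ fst p * Im z ^ snd p))"
proof -
  from assms obtain c where "\<And>z. P z = (\<Sum>(i, j)\<in>deg_set N. c i j * Re z ^ i * Im z ^ j)"
    unfolding polys2_def by blast
  then show thesis
    by (intro that[of "\<lambda>p. c (fst p) (snd p)"]) (simp add: fun_eq_iff case_prod_unfold mult.assoc)
qed

lemma continuous_on_polys2: "P \<in> polys2 N \<Longrightarrow> continuous_on S P"
  by (erule polys2E) (auto intro!: continuous_intros)

text \<open>The degree is left at \<open>N\<close>, so that all derivatives of an interpolant stay
  in the one space \<open>polys2 (d - 2)\<close>.\<close>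

lemma has_derivative_polys2:
  assumes "P \<in> polys2 N"
  obtains P1 P2 where "P1 \<in> polys2 N" "P2 \<in> polys2 N"
    and "\<And>x. (P has_derivative (\<lambda>h. Re h * P1 x + Im h * P2 x)) (at x)"
proof -
  obtain c where c: "P = (\<lambda>z. \<Sum>p\<in>deg_set N. c p * (Re z ^ fst p * Im z ^ snd p))"
    by (rule polys2E[OF assms], rule that)
  \<comment> \<open>At exponent 0 the truncated \<open>fst p - 1\<close> is harmless, because the
    factor \<open>fst p\<close> vanishes.\<close>
  define P1 where "P1 z = (\<Sum>p\<in>deg_set N. c p * (of_nat (fst p) * (Re z ^ (fst p - 1) * Im z ^ snd p)))" for z
  define P2 where "P2 z = (\<Sum>p\<in>deg_set N. c p * (of_nat (snd p) * (Re z ^ fst p * Im z ^ (snd p - 1))))" for z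
  show thesis
  proof
    show "P1 \<in> polys2 N" "P2 \<in> polys2 N"
      unfolding P1_def P2_def by (intro polys2_sum polys2_cmult polys2_monom; force)+
    show "(P has_derivative (\<lambda>h. Re h * P1 x + Im h * P2 x)) (at x)" for x
      unfolding c P1_def P2_def
      by (auto intro!: derivative_eq_intros ext simp: sum.distrib sum_distrib_left algebra_simps)
  qed
qed

lemma partial_deriv_eq:
  assumes "(f has_derivative f') (at x)"
  shows "partial_deriv v f x = f' v"
proof -
  have "((\<lambda>t. f (x + t *\<^sub>R v)) has_derivative (\<lambda>t. f' (t *\<^sub>R v))) (at 0)"
    by (rule has_derivative_compose[of "\<lambda>t. x + t *\<^sub>R v" "\<lambda>t. t *\<^sub>R v" 0 UNIV f f'])
       (auto intro!: derivative_eq_intros assms)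
  moreover have "(\<lambda>t. f' (t *\<^sub>R v)) = (*) (f' v)"
    using linear_scale[OF has_derivative_linear[OF assms]] by (auto simp: fun_eq_iff)
  ultimately show ?thesis
    unfolding partial_deriv_def by (intro DERIV_imp_deriv) (simp add: has_field_derivative_def)
qed

lemma partial_deriv_polys2:
  assumes "P \<in> polys2 N" and "v \<in> {1, \<i>}"
  shows "partial_deriv v P \<in> polys2 N"
proof -
  obtain P1 P2 where "P1 \<in> polys2 N" "P2 \<in> polys2 N"
    and *: "\<And>x. (P has_derivative (\<lambda>h. Re h * P1 x + Im h * P2 x)) (at x)"
    using has_derivative_polys2[OF assms(1)] by blast
  moreover have "partial_deriv v P = (if v = 1 then P1 else P2)"
    using assms(2) by (auto simp: fun_eq_iff partial_deriv_eq[OF *])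
  ultimately show ?thesis by simp
qed

section \<open>Expansion with respect to a dual basis\<close>

definition scale_fun :: "real \<Rightarrow> (complex \<Rightarrow> real) \<Rightarrow> complex \<Rightarrow> real" where
  "scale_fun c f = (\<lambda>x. c * f x)"

interpretation fun_space: vector_space scale_fun
  by unfold_locales (auto simp: scale_fun_def fun_eq_iff algebra_simps)

lemma sum_scale_fun: "(\<Sum>v\<in>S. scale_fun (c v) v) = (\<lambda>x. \<Sum>v\<in>S. c v * v x)"
  by (induction S rule: infinite_finite_induct) (auto simp: scale_fun_def fun_eq_iff)

text \<open>
  If the dual basis did not span, it could be enlarged by a polynomial annihilated by all functionals.
\<close>

lemma polys2_dual_basis_expansion:
  fixes \<phi> :: "'i \<Rightarrow> (complex \<Rightarrow> real) \<Rightarrow> real"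
  assumes fin: "finite I" and card: "card (deg_set N) \<le> card I"
    and B: "\<And>i. i \<in> I \<Longrightarrow> B i \<in> polys2 N"
    and lin: "\<And>i (S :: (complex \<Rightarrow> real) set) c. i \<in> I \<Longrightarrow> finite S \<Longrightarrow> S \<subseteq> polys2 N \<Longrightarrow>
                \<phi> i (\<lambda>x. \<Sum>v\<in>S. c v * v x) = (\<Sum>v\<in>S. c v * \<phi> i v)"
    and dual: "\<And>i k. i \<in> I \<Longrightarrow> k \<in> I \<Longrightarrow> \<phi> i (B k) = (if i = k then 1 else 0)"
    and P: "P \<in> polys2 N"
  shows "P x = (\<Sum>i\<in>I. \<phi> i P * B i x)"
proof (rule ccontr)
  assume neq: "P x \<noteq> (\<Sum>i\<in>I. \<phi> i P * B i x)"
  have injB: "inj_on B I"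
  proof (rule inj_onI)
    fix i k assume "i \<in> I" "k \<in> I" "B i = B k"
    then show "i = k"
      using dual[of i k] dual[of i i] by (auto split: if_splits)
  qed
  define g where "g = inv_into I B"
  have gB: "g (B i) = i" if "i \<in> I" for i
    using injB that by (simp add: g_def)
  define S where "S = insert P (B ` I)"
  have SP: "S \<subseteq> polys2 N" "finite S"
    using B P fin by (auto simp: S_def)
  have PB: "P \<notin> B ` I"
  proof
    assume "P \<in> B ` I"
    then obtain k where k: "k \<in> I" "P = B k" by auto
    have "(\<Sum>i\<in>I. \<phi> i P * B i x) = (\<Sum>i\<in>I. if i = k then B k x else 0)"
      using k by (intro sum.cong) (auto simp: dual)
    then show False
      using neq k fin by simp
  qed
  have "\<not> fun_space.dependent S"
  proof
    assume "fun_space.dependent S"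
    then obtain c v where v: "v \<in> S" "c v \<noteq> 0" and "(\<Sum>v\<in>S. scale_fun (c v) v) = 0"
      using fun_space.dependent_finite[OF SP(2)] by auto
    then have zero: "(\<lambda>x. \<Sum>v\<in>S. c v * v x) = (\<lambda>x. 0)"
      by (simp add: sum_scale_fun zero_fun_def)
    have sumS: "(\<Sum>v\<in>S. c v * h v) = c P * h P + (\<Sum>i\<in>I. c (B i) * h (B i))" for h :: "_ \<Rightarrow> real"
      using fin PB injB by (simp add: S_def sum.reindex)
    \<comment> \<open>Applying \<open>\<phi> i\<close> to the vanishing combination isolates the
      coefficient of \<open>B i\<close>.\<close>
    have coeff: "c (B i) = - c P * \<phi> i P" if "i \<in> I" for i
    proof -
      have "(\<Sum>v\<in>S. c v * \<phi> i v) = \<phi> i (\<lambda>x. 0)"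
        using lin[OF that SP(2,1), of c] zero by simp
      also have "\<dots> = 0"
        using lin[OF that, of "{}" c] by simp
      finally have "c P * \<phi> i P + (\<Sum>k\<in>I. c (B k) * \<phi> i (B k)) = 0"
        unfolding sumS .
      moreover have "(\<Sum>k\<in>I. c (B k) * \<phi> i (B k)) = (\<Sum>k\<in>I. if k = i then c (B i) else 0)"
        using that by (intro sum.cong) (auto simp: dual)
      ultimately show ?thesis
        using fin that by simp
    qed
    have "c P * P x + (\<Sum>i\<in>I. c (B i) * B i x) = 0"
      using fun_cong[OF zero, of x] sumS[of "\<lambda>v. v x"] by simp
    \<comment> \<open>With these coefficients the relation at \<open>x\<close> becomes
      \<open>c P\<close> times the assumed discrepancy.\<close>
    moreover have "(\<Sum>i\<in>I. c (B i) * B i x) = - c P * (\<Sum>i\<in>I. \<phi> i P * B i x)"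
      unfolding sum_distrib_left by (intro sum.cong) (auto simp: coeff)
    ultimately have "c P * (P x - (\<Sum>i\<in>I. \<phi> i P * B i x)) = 0"
      by (simp add: algebra_simps)
    then have "c P = 0"
      using neq by simp
    then have "c w = 0" if "w \<in> S" for w
      using that coeff by (auto simp: S_def)
    then show False
      using v by blast
  qed
  \<comment> \<open>The monomials of degree at most \<open>N\<close> span \<open>S\<close>, whereas
    an independent \<open>S\<close> would have \<open>card I + 1\<close> elements, more than there
    are monomials.\<close>
  moreover define T where "T = (\<lambda>p z. Re z ^ fst p * Im z ^ snd p) ` deg_set N"
  have T: "finite T" "card T \<le> card (deg_set N)"
    unfolding T_def by (auto intro: card_image_le)
  moreover have "S \<subseteq> fun_space.span T"
  proof
    fix Q assume "Q \<in> S"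
    then obtain c where c: "Q = (\<lambda>z. \<Sum>p\<in>deg_set N. c p * (Re z ^ fst p * Im z ^ snd p))"
      using SP polys2E by blast
    have "(\<Sum>p\<in>A. scale_fun (c p) (\<lambda>z. Re z ^ fst p * Im z ^ snd p)) =
        (\<lambda>z. \<Sum>p\<in>A. c p * (Re z ^ fst p * Im z ^ snd p))" for A
      by (induction A rule: infinite_finite_induct) (auto simp: fun_eq_iff scale_fun_def)
    then have "Q = (\<Sum>p\<in>deg_set N. scale_fun (c p) (\<lambda>z. Re z ^ fst p * Im z ^ snd p))"
      unfolding c by simp
    also have "\<dots> \<in> fun_space.span T"
      unfolding T_def
      by (intro fun_space.span_sum fun_space.span_scale fun_space.span_base imageI)
    finally show "Q \<in> fun_space.span T" .
  qed
  ultimately have "card S \<le> card T"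
    using fun_space.independent_span_bound by blast
  moreover have "card S = Suc (card I)"
    using PB fin injB by (simp add: S_def card_image)
  ultimately show False
    using T card by linarith
qed

section \<open>Segment means and ridge polynomials\<close>

lemma segment_in_disk:
  assumes "cmod a \<le> 1" "cmod b \<le> 1" "w \<in> {0..1::real}"
  shows "a + w *\<^sub>R (b - a) \<in> unit_disk"
proof -
  have "(1 - w) *\<^sub>R a + w *\<^sub>R b \<in> unit_disk"
    using assms by (intro convexD[OF convex_cball]) auto
  then show ?thesis
    by (simp add: algebra_simps)
qed

lemma continuous_on_segment:
  assumes "continuous_on unit_disk f" "cmod a \<le> 1" "cmod b \<le> 1"
  shows "continuous_on {0..1} (\<lambda>w::real. f (a + w *\<^sub>R (b - a)))"
  by (rule continuous_on_compose2[OF assms(1)])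
     (use segment_in_disk[OF assms(2,3)] in \<open>auto intro!: continuous_intros\<close>)

lemma seg_integral_sum:
  assumes "cmod a \<le> 1" "cmod b \<le> 1" "finite S" "\<And>v. v \<in> S \<Longrightarrow> continuous_on unit_disk (F v)"
  shows "seg_integral a b (\<lambda>x. \<Sum>v\<in>S. c v * F v x) = (\<Sum>v\<in>S. c v * seg_integral a b (F v))"
proof -
  have "integral {0..1} (\<lambda>w. \<Sum>v\<in>S. c v * F v (a + w *\<^sub>R (b - a))) =
      (\<Sum>v\<in>S. integral {0..1} (\<lambda>w. c v * F v (a + w *\<^sub>R (b - a))))"
    using assms
    by (intro integral_sum integrable_continuous_interval continuous_intros continuous_on_segment) auto
  then show ?thesis
    by (simp add: seg_integral_def)
qed

lemma seg_integral_diff: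
  assumes "cmod a \<le> 1" "cmod b \<le> 1" "continuous_on unit_disk f" "continuous_on unit_disk g"
  shows "seg_integral a b (\<lambda>x. f x - g x) = seg_integral a b f - seg_integral a b g"
  unfolding seg_integral_def using assms
  by (intro integral_diff integrable_continuous_interval continuous_on_segment) auto

lemma seg_integral_bound:
  assumes "cmod a \<le> 1" "cmod b \<le> 1" "continuous_on unit_disk f"
    and "\<And>x. x \<in> unit_disk \<Longrightarrow> \<bar>f x\<bar> \<le> m"
  shows "\<bar>seg_integral a b f\<bar> \<le> m"
proof -
  have "norm (integral {0..1} (\<lambda>w. f (a + w *\<^sub>R (b - a)))) \<le> m * (1 - 0)"
    using assms segment_in_disk[OF assms(1,2)]
    by (intro integral_bound continuous_on_segment) auto
  then show ?thesis
    by (simp add: seg_integral_def)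
qed

lemma polys2_poly_Re:
  fixes p :: "complex poly"
  assumes "degree p \<le> N"
  shows "(\<lambda>x. Re (poly p (of_real (Re (u * x))))) \<in> polys2 N"
proof -
  have *: "(\<lambda>x. Re (u * x)) \<in> polys2 1"
    using polys2_diff[OF polys2_cmult[OF polys2_Re, of "Re u"] polys2_cmult[OF polys2_Im, of "Im u"]]
    by simp
  have "(\<lambda>x. \<Sum>i\<le>degree p. Re (coeff p i) * Re (u * x) ^ i) \<in> polys2 N"
    by (intro polys2_sum polys2_cmult polys2_mono[OF polys2_power[OF *]]) (use assms in auto)
  moreover have "Re (poly p (of_real y)) = (\<Sum>i\<le>degree p. Re (coeff p i) * y ^ i)" for y
    by (simp add: poly_altdef flip: of_real_power)
  ultimately show ?thesis
    by (simp only:)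
qed

text \<open>Along a segment a ridge function depends on one real variable, and the fundamental
  theorem of calculus applies. The first equation is kept multiplied by \<open>\<delta>\<close>; it
  is void for \<open>\<delta> = 0\<close>, where the integrand is constant instead.\<close>

lemma seg_integral_ridge:
  fixes p :: "complex poly" and u a b :: complex
  defines "\<delta> \<equiv> Re (u * b) - Re (u * a)"
  shows "\<delta> * seg_integral a b (\<lambda>x. Re (poly (pderiv p) (of_real (Re (u * x))))) =
           Re (poly p (of_real (Re (u * b)))) - Re (poly p (of_real (Re (u * a))))"
    and "\<delta> = 0 \<Longrightarrow> seg_integral a b (\<lambda>x. Re (poly (pderiv p) (of_real (Re (u * x))))) =
           Re (poly (pderiv p) (of_real (Re (u * a))))"
proof -
  define \<alpha> where "\<alpha> = Re (u * a)"
  define \<beta> where "\<beta> = Re (u * b)"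
  have \<beta>: "\<beta> = \<alpha> + \<delta>"
    by (simp add: \<delta>_def \<alpha>_def \<beta>_def)
  have "Re (u * (a + w *\<^sub>R (b - a))) = \<alpha> + w * \<delta>" for w
    by (simp add: \<delta>_def \<alpha>_def algebra_simps)
  then have seg: "seg_integral a b (\<lambda>x. Re (poly (pderiv p) (of_real (Re (u * x))))) =
      integral {0..1} (\<lambda>w. Re (poly (pderiv p) (of_real (\<alpha> + w * \<delta>))))"
    unfolding seg_integral_def by (simp only:)
  have der: "((\<lambda>w. Re (poly p (of_real (\<alpha> + w * \<delta>)))) has_real_derivative
      \<delta> * Re (poly (pderiv p) (of_real (\<alpha> + w * \<delta>)))) (at w within S)" for w S
  proof -
    have "((\<lambda>w. poly p (of_real (\<alpha> + w * \<delta>))) has_vector_derivative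
        of_real \<delta> * poly (pderiv p) (of_real (\<alpha> + w * \<delta>))) (at w within S)"
      by (rule field_vector_diff_chain_within[unfolded o_def, where g = "poly p"])
         (auto intro!: derivative_eq_intros poly_DERIV DERIV_subset[OF poly_DERIV]
           simp: has_vector_derivative_def scaleR_conv_of_real)
    from bounded_linear.has_vector_derivative[OF bounded_linear_Re this] show ?thesis
      by (simp add: has_real_derivative_iff_has_vector_derivative)
  qed
  have "((\<lambda>w. \<delta> * Re (poly (pderiv p) (of_real (\<alpha> + w * \<delta>)))) has_integral
      Re (poly p (of_real (\<alpha> + 1 * \<delta>))) - Re (poly p (of_real (\<alpha> + 0 * \<delta>)))) {0..1}"
    by (rule fundamental_theorem_of_calculus)
       (use der in \<open>auto simp: has_real_derivative_iff_has_vector_derivative[symmetric]\<close>)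
  then have "integral {0..1} (\<lambda>w. \<delta> * Re (poly (pderiv p) (of_real (\<alpha> + w * \<delta>)))) =
      Re (poly p (of_real (\<alpha> + 1 * \<delta>))) - Re (poly p (of_real (\<alpha> + 0 * \<delta>)))"
    by (rule integral_unique)
  then show "\<delta> * seg_integral a b (\<lambda>x. Re (poly (pderiv p) (of_real (Re (u * x))))) =
      Re (poly p (of_real (Re (u * b)))) - Re (poly p (of_real (Re (u * a))))"
    unfolding seg \<alpha>_def[symmetric] \<beta>_def[symmetric] \<beta> by simp
  show "seg_integral a b (\<lambda>x. Re (poly (pderiv p) (of_real (Re (u * x))))) =
      Re (poly (pderiv p) (of_real (Re (u * a))))" if "\<delta> = 0"
    unfolding seg \<alpha>_def[symmetric] using that by simp
qed

text \<open>For \<open>b\<close> on the unit circle,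
  \<open>(\<zeta> + 1 / \<zeta>) / 2 - Re b\<close> factors as
  \<open>(\<zeta> - b) * (\<zeta> - cnj b) / (2 * \<zeta>)\<close>. Multiplied over all nodes, this
  expresses the modulus of the projected node polynomial by two values of the original one, at
  \<open>u * \<zeta>\<close> and \<open>u * cnj \<zeta>\<close>.\<close>

lemma cmod_joukowski_diff:
  fixes u a \<zeta> :: complex
  assumes "cmod u = 1" "cmod a = 1" "\<zeta> \<noteq> 0"
  shows "cmod ((\<zeta> + 1 / \<zeta>) / 2 - of_real (Re (cnj u * a))) =
           cmod (u * \<zeta> - a) * cmod (u * cnj \<zeta> - a) / (2 * cmod \<zeta>)"
proof -
  define b where "b = cnj u * a"
  have uu: "u * cnj u = 1"
    using assms(1) by (simp add: complex_norm_square[symmetric])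
  have "cmod b = 1"
    using assms by (simp add: b_def norm_mult)
  then have "b * cnj b = 1"
    by (simp add: complex_norm_square[symmetric])
  have a: "a = u * b"
    using uu by (simp add: b_def mult.assoc[symmetric])
  have "(\<zeta> + 1 / \<zeta>) / 2 - of_real (Re b) = (\<zeta> - b) * (\<zeta> - cnj b) / (2 * \<zeta>)"
  proof -
    have "of_real (Re b) = (b + cnj b) / 2"
      by (simp add: complex_add_cnj)
    moreover have "(\<zeta> - b) * (\<zeta> - cnj b) = \<zeta> * \<zeta> - \<zeta> * (b + cnj b) + 1"
      using \<open>b * cnj b = 1\<close> by (simp add: algebra_simps)
    ultimately show ?thesis
      using assms(3) by (simp add: field_simps)
  qed
  moreover have "cmod (\<zeta> - cnj b) = cmod (cnj \<zeta> - b)"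
    by (metis complex_cnj_cnj complex_cnj_diff complex_mod_cnj)
  moreover have "cmod (u * x - a) = cmod (x - b)" for x
    using assms(1) by (simp add: a right_diff_distrib[symmetric] norm_mult)
  ultimately show ?thesis
    unfolding b_def[symmetric] by (simp add: norm_divide norm_mult)
qed

section \<open>Hakopian interpolation on the unit circle\<close>

text \<open>A direction orthogonal to the chord: for points on the unit circle, the reflection
  \<open>z \<mapsto> u^2 * cnj z\<close> in the line of the bisector \<open>u\<close> exchanges
  \<open>p\<close> and \<open>q\<close>.\<close>

definition bisector :: "complex \<Rightarrow> complex \<Rightarrow> complex" where
  "bisector p q = csqrt (p * q)"

lemma norm_bisector: "cmod p = 1 \<Longrightarrow> cmod q = 1 \<Longrightarrow> cmod (bisector p q) = 1"
  by (simp add: bisector_def norm_mult)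

definition coord :: "(nat \<Rightarrow> complex) \<Rightarrow> nat \<Rightarrow> nat \<Rightarrow> complex \<Rightarrow> real" where
  "coord a s t x = Re (cnj (bisector (a s) (a t)) * x)"

text \<open>The polynomial \<open>M\<close> of the pair, normalised so that its derivative is 1 at
  the common projection of \<open>a s\<close> and \<open>a t\<close>. Complex coefficients serve the
  Cauchy estimate.\<close>

definition hak_poly :: "(nat \<Rightarrow> complex) \<Rightarrow> nat \<Rightarrow> nat \<Rightarrow> nat \<Rightarrow> complex poly" where
  "hak_poly a d s t =
     smult (inverse (of_real (\<Prod>j\<in>{..<d} - {s, t}. coord a s t (a s) - coord a s t (a j))))
       (\<Prod>j\<in>{..<d} - {s}. [:- of_real (coord a s t (a j)), 1:])"

definition hak_basis :: "(nat \<Rightarrow> complex) \<Rightarrow> nat \<Rightarrow> nat \<Rightarrow> nat \<Rightarrow> complex \<Rightarrow> real" where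
  "hak_basis a d s t x = Re (poly (pderiv (hak_poly a d s t)) (of_real (coord a s t x)))"

lemma poly_hak_poly:
  "poly (hak_poly a d s t) y =
     (\<Prod>j\<in>{..<d} - {s}. y - of_real (coord a s t (a j))) /
     of_real (\<Prod>j\<in>{..<d} - {s, t}. coord a s t (a s) - coord a s t (a j))"
  by (simp add: hak_poly_def poly_prod field_simps)

lemma poly_pderiv_hak_poly:
  "poly (pderiv (hak_poly a d s t)) y =
     (\<Sum>i\<in>{..<d} - {s}. \<Prod>j\<in>{..<d} - {s} - {i}. y - of_real (coord a s t (a j))) /
     of_real (\<Prod>j\<in>{..<d} - {s, t}. coord a s t (a s) - coord a s t (a j))"
  by (simp add: hak_poly_def pderiv_smult pderiv_prod poly_sum poly_prod pderiv_pCons field_simps)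

lemma hak_basis_in_polys2:
  assumes "s < d"
  shows "hak_basis a d s t \<in> polys2 (d - 2)"
proof -
  have "degree (hak_poly a d s t) \<le> (\<Sum>j\<in>{..<d} - {s}. 1)"
    unfolding hak_poly_def
    by (intro order.trans[OF degree_smult_le] order.trans[OF degree_prod_sum_le] sum_mono) auto
  also have "\<dots> = d - 1"
    using assms by simp
  finally have "degree (pderiv (hak_poly a d s t)) \<le> d - 2"
    by (simp add: degree_pderiv)
  then show ?thesis
    unfolding hak_basis_def[abs_def] coord_def by (rule polys2_poly_Re)
qed

abbreviation pairs :: "nat \<Rightarrow> (nat \<times> nat) set" where
  "pairs d \<equiv> {(s, t). s < t \<and> t < d}"

lemma finite_pairs [simp]: "finite (pairs d)"
  by (rule finite_subset[of _ "{..<d} \<times> {..<d}"]) auto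

text \<open>Both sides are \<open>d * (d - 1) / 2\<close>. As many segment means as dimensions: this
  makes the dual family a basis.\<close>

lemma card_pairs:
  assumes "2 \<le> d"
  shows "card (pairs d) = card (deg_set (d - 2))"
proof (rule bij_betw_same_card)
  show "bij_betw (\<lambda>(s, t). (s, t - s - 1)) (pairs d) (deg_set (d - 2))"
    by (rule bij_betw_byWitness[where f' = "\<lambda>(i, j). (i, i + j + 1)"]) (use assms in auto)
qed

lemma card_pairs_le: "real (card (pairs d)) \<le> real d ^ 2"
proof -
  have "card (pairs d) \<le> card ({..<d} \<times> {..<d})"
    by (rule card_mono) auto
  then show ?thesis
    by (simp add: power2_eq_square flip: of_nat_mult)
qed

context
  fixes a :: "nat \<Rightarrow> complex" and d :: nat
  assumes norm_a: "\<And>j. j < d \<Longrightarrow> cmod (a j) = 1" and inj_a: "inj_on a {..<d}"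
begin

context
  fixes s t :: nat
  assumes st: "s < t" "t < d"
begin

private abbreviation "u \<equiv> bisector (a s) (a t)"
private abbreviation "c j \<equiv> coord a s t (a j)"

lemma norm_as: "cmod (a s) = 1" "cmod (a t) = 1" "cmod u = 1"
  using norm_a st by (auto intro!: norm_bisector)

text \<open>After rotation by \<open>cnj u\<close> the two nodes are mirror images in the real axis,
  hence have the same real part.\<close>

lemma reflect_bisector: "cnj (cnj u * a s) = cnj u * a t"
proof -
  have "u * u = a s * a t"
    by (simp add: bisector_def power2_eq_square[symmetric])
  then have "(cnj u * u) * (u * cnj (a s)) = (cnj (a s) * a s) * (cnj u * a t)"
    by (simp add: mult_ac)
  moreover have "cnj u * u = 1" "cnj (a s) * a s = 1"
    using norm_as by (simp_all add: complex_norm_square[symmetric] mult.commute[of "cnj _"])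
  ultimately show ?thesis
    by simp
qed

lemma coord_t: "c t = c s"
  unfolding coord_def reflect_bisector[symmetric] by simp

text \<open>The Joukowski factorisation at \<open>\<zeta> = cnj u * a s\<close>, a point of the unit
  circle for which \<open>u * \<zeta>\<close> and \<open>u * cnj \<zeta>\<close> are
  \<open>a s\<close> and \<open>a t\<close>.\<close>

lemma coord_diff:
  assumes "j < d"
  shows "\<bar>c s - c j\<bar> = cmod (a s - a j) * cmod (a t - a j) / 2"
proof -
  define \<zeta> where "\<zeta> = cnj u * a s"
  have \<zeta>: "cmod \<zeta> = 1"
    using norm_as by (simp add: \<zeta>_def norm_mult)
  then have "1 / \<zeta> = cnj \<zeta>"
    using complex_norm_square[of \<zeta>] by (auto simp: divide_eq_eq mult.commute)
  then have cs: "(\<zeta> + 1 / \<zeta>) / 2 = of_real (c s)"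
    using complex_add_cnj[of \<zeta>] by (simp add: coord_def \<zeta>_def[symmetric])
  have uu: "u * cnj u = 1"
    using norm_as by (simp add: complex_norm_square[symmetric])
  have u\<zeta>: "u * \<zeta> = a s" "u * cnj \<zeta> = a t"
    unfolding \<zeta>_def reflect_bisector mult.assoc[symmetric] uu by simp_all
  have "\<zeta> \<noteq> 0"
    using \<zeta> by auto
  from cmod_joukowski_diff[OF norm_as(3) norm_a[OF assms] this]
  have "cmod (of_real (c s - c j)) = cmod (a s - a j) * cmod (a t - a j) / 2"
    unfolding cs u\<zeta> \<zeta> coord_def[of a s t, symmetric] by simp
  then show ?thesis
    by (simp only: norm_of_real)
qed

text \<open>Pythagoras: the chord crosses the direction \<open>u\<close> at right angles at height
  \<open>c s\<close>, so half its length is the modulus of the imaginary part of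
  \<open>cnj u * a s\<close>.\<close>

lemma one_minus_coord_sq: "1 - (c s)\<^sup>2 = (cmod (a s - a t))\<^sup>2 / 4"
proof -
  define \<zeta> where "\<zeta> = cnj u * a s"
  have "cnj u * (a s - a t) = \<zeta> - cnj \<zeta>"
    by (simp add: \<zeta>_def reflect_bisector right_diff_distrib del: complex_cnj_mult complex_cnj_cnj)
  then have "cmod (a s - a t) = cmod (\<zeta> - cnj \<zeta>)"
    using norm_as by (metis complex_mod_cnj mult_1 norm_mult)
  also have "\<zeta> - cnj \<zeta> = of_real (2 * Im \<zeta>) * \<i>"
    by (simp add: complex_eq_iff)
  finally have "(cmod (a s - a t))\<^sup>2 / 4 = (Im \<zeta>)\<^sup>2"
    by (simp add: norm_mult power_mult_distrib)
  moreover have "(cmod \<zeta>)\<^sup>2 = 1"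
    using norm_as by (simp add: \<zeta>_def norm_mult)
  ultimately show ?thesis
    by (simp add: cmod_power2 coord_def \<zeta>_def)
qed

lemma coord_diff_nonzero: "j < d \<Longrightarrow> j \<noteq> s \<Longrightarrow> j \<noteq> t \<Longrightarrow> c j \<noteq> c s"
  using coord_diff[of j] inj_a st by (auto simp: inj_on_def)

text \<open>For \<open>j = s\<close> the factor of that index is missing, but the factor of index
  \<open>t\<close> vanishes at the same point.\<close>

lemma poly_hak_poly_root:
  assumes "j < d"
  shows "poly (hak_poly a d s t) (of_real (c j)) = 0"
proof -
  have "\<exists>i\<in>{..<d} - {s}. c j = c i"
  proof (cases "j = s")
    case True
    then show ?thesis
      using st coord_t by (intro bexI[of _ t]) auto
  next
    case False
    then show ?thesis
      using assms by (intro bexI[of _ j]) auto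
  qed
  then show ?thesis
    by (auto simp: poly_hak_poly)
qed

text \<open>Only \<open>s\<close> and \<open>t\<close> project to \<open>c s\<close>. Any other
  coincidence of projections leaves two equal factors, a double zero; for the pair itself one of the
  two factors is missing, and the simple zero has derivative 1 by the normalisation.\<close>

lemma poly_pderiv_hak_poly_double_root:
  assumes "i < k" "k < d" "c i = c k"
  shows "poly (pderiv (hak_poly a d s t)) (of_real (c i)) = (if i = s \<and> k = t then 1 else 0)"
proof (cases "i = s \<and> k = t")
  case True
  have "(\<Sum>l\<in>{..<d} - {s}. \<Prod>j\<in>{..<d} - {s} - {l}. of_real (c s) - complex_of_real (c j)) =
      (\<Sum>l\<in>{t}. \<Prod>j\<in>{..<d} - {s} - {l}. of_real (c s) - complex_of_real (c j))"
    using st coord_t by (intro sum.mono_neutral_right) (auto intro!: bexI[of _ t])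
  moreover have "{..<d} - {s} - {t} = {..<d} - {s, t}"
    by auto
  ultimately have "poly (pderiv (hak_poly a d s t)) (of_real (c s)) =
      (\<Prod>j\<in>{..<d} - {s, t}. of_real (c s) - complex_of_real (c j)) /
      of_real (\<Prod>j\<in>{..<d} - {s, t}. c s - c j)"
    by (simp add: poly_pderiv_hak_poly)
  moreover have "(\<Prod>j\<in>{..<d} - {s, t}. c s - c j) \<noteq> 0"
    using coord_diff_nonzero[THEN not_sym] by auto
  ultimately show ?thesis
    using True by (simp flip: of_real_diff of_real_prod)
next
  case False
  have neq_i: "i \<noteq> s"
    using False assms coord_diff_nonzero[of k] by auto
  have neq_k: "k \<noteq> s"
    using assms st coord_diff_nonzero[of i] by auto
  note neq = neq_i neq_k
  have "(\<Prod>j\<in>{..<d} - {s} - {l}. of_real (c i) - complex_of_real (c j)) = 0" for l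
  proof (rule prod_zero)
    show "\<exists>j\<in>{..<d} - {s} - {l}. of_real (c i) - complex_of_real (c j) = 0"
      \<comment> \<open>Whichever factor the product rule removes, one of the two coinciding factors
        survives.\<close>
      using assms neq by (intro bexI[of _ "if l = i then k else i"]) auto
  qed simp
  then have "(\<Sum>l\<in>{..<d} - {s}. \<Prod>j\<in>{..<d} - {s} - {l}. of_real (c i) - complex_of_real (c j)) = 0"
    by (intro sum.neutral ballI)
  then show ?thesis
    using False unfolding poly_pderiv_hak_poly by simp
qed

lemma seg_integral_hak_basis:
  assumes "i < k" "k < d"
  shows "seg_integral (a i) (a k) (hak_basis a d s t) = (if i = s \<and> k = t then 1 else 0)"
proof (cases "c i = c k")
  case True
  then show ?thesis
    using seg_integral_ridge(2)[of "cnj u" "a k" "a i" "hak_poly a d s t"]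
      poly_pderiv_hak_poly_double_root[OF assms True]
    unfolding hak_basis_def[abs_def] coord_def by simp
next
  case False
  then have "\<not> (i = s \<and> k = t)"
    using coord_t by auto
  moreover have "(c k - c i) * seg_integral (a i) (a k) (hak_basis a d s t) = 0"
    using seg_integral_ridge(1)[of "cnj u" "a k" "a i" "hak_poly a d s t"]
      poly_hak_poly_root[of i] poly_hak_poly_root[of k] assms
    unfolding hak_basis_def[abs_def] coord_def by simp
  ultimately show ?thesis
    using False by auto
qed

end

lemma polys2_hak_expansion:
  assumes "P \<in> polys2 (d - 2)" "2 \<le> d"
  shows "P x = (\<Sum>(s, t)\<in>pairs d. seg_integral (a s) (a t) P * hak_basis a d s t x)"
proof -
  have norm_le: "cmod (a (fst p)) \<le> 1" "cmod (a (snd p)) \<le> 1" if "p \<in> pairs d" for p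
    using that norm_a by auto
  have "P x = (\<Sum>p\<in>pairs d. seg_integral (a (fst p)) (a (snd p)) P * hak_basis a d (fst p) (snd p) x)"
  proof (rule polys2_dual_basis_expansion[where N = "d - 2"])
    show "seg_integral (a (fst p)) (a (snd p)) (\<lambda>x. \<Sum>v\<in>S. c v * v x) =
        (\<Sum>v\<in>S. c v * seg_integral (a (fst p)) (a (snd p)) v)"
      if "p \<in> pairs d" "finite S" "S \<subseteq> polys2 (d - 2)" for p c and S :: "(complex \<Rightarrow> real) set"
      using that norm_le continuous_on_polys2 by (intro seg_integral_sum) auto
    show "seg_integral (a (fst p)) (a (snd p)) (hak_basis a d (fst q) (snd q)) = (if p = q then 1 else 0)"
      if "p \<in> pairs d" "q \<in> pairs d" for p q
      using that seg_integral_hak_basis[of "fst q" "snd q" "fst p" "snd p"]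
      by (auto simp: prod_eq_iff)
  qed (use assms in \<open>auto simp: card_pairs intro!: hak_basis_in_polys2\<close>)
  then show ?thesis
    by (simp add: case_prod_unfold)
qed

text \<open>The dual basis settles existence and uniqueness at once: the sum has the prescribed
  means, and every admissible polynomial is recovered from its means by the expansion. Hence the
  definite description denotes this sum.\<close>

lemma hakopian_eq:
  assumes "continuous_on unit_disk f" "2 \<le> d"
  shows "hakopian (map a [0..<d]) f =
    (\<lambda>x. \<Sum>(s, t)\<in>pairs d. seg_integral (a s) (a t) f * hak_basis a d s t x)" (is "_ = ?H")
proof -
  have H_eq: "?H = (\<lambda>x. \<Sum>p\<in>pairs d. seg_integral (a (fst p)) (a (snd p)) f * hak_basis a d (fst p) (snd p) x)"
    by (simp add: case_prod_unfold)
  have H: "?H \<in> polys2 (d - 2)"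
    unfolding H_eq by (intro polys2_sum polys2_cmult hak_basis_in_polys2) auto
  have diff: "seg_integral (a i) (a k) (\<lambda>x. f x - P x) = seg_integral (a i) (a k) f - seg_integral (a i) (a k) P"
    if "i < k" "k < d" "P \<in> polys2 (d - 2)" for i k P
    using that norm_a assms continuous_on_polys2 by (intro seg_integral_diff) auto
  have H_integral: "seg_integral (a i) (a k) ?H = seg_integral (a i) (a k) f" if "i < k" "k < d" for i k
  proof -
    have "seg_integral (a i) (a k) ?H =
        (\<Sum>p\<in>pairs d. seg_integral (a (fst p)) (a (snd p)) f *
           seg_integral (a i) (a k) (hak_basis a d (fst p) (snd p)))"
      unfolding H_eq using that norm_a
      by (intro seg_integral_sum finite_pairs continuous_on_polys2[OF hak_basis_in_polys2]) auto
    also have "\<dots> = (\<Sum>p\<in>pairs d. if p = (i, k) then seg_integral (a i) (a k) f else 0)"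
      using that by (intro sum.cong) (auto simp: seg_integral_hak_basis split: if_splits)
    finally show ?thesis
      using that by simp
  qed
  show ?thesis
    unfolding hakopian_def
  proof (rule the_equality)
    show "?H \<in> polys2 (length (map a [0..<d]) - 2) \<and>
      (\<forall>s t. s < t \<and> t < length (map a [0..<d]) \<longrightarrow>
        seg_integral (map a [0..<d] ! s) (map a [0..<d] ! t) (\<lambda>x. f x - ?H x) = 0)"
      using H by (simp add: diff H_integral)
  next
    fix P
    assume P: "P \<in> polys2 (length (map a [0..<d]) - 2) \<and>
      (\<forall>s t. s < t \<and> t < length (map a [0..<d]) \<longrightarrow>
        seg_integral (map a [0..<d] ! s) (map a [0..<d] ! t) (\<lambda>x. f x - P x) = 0)"
    then have "seg_integral (a i) (a k) P = seg_integral (a i) (a k) f" if "i < k" "k < d" for i k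
      using that diff[of i k P] by simp
    then show "P = ?H"
      using polys2_hak_expansion[of P] P assms(2) by (auto simp: fun_eq_iff intro!: sum.cong)
  qed
qed

end

section \<open>The Lebesgue constant\<close>

text \<open>
  The ellipse \<open>\<bar>y - 1\<bar> + \<bar>y + 1\<bar> = (1 + \<rho>\<^sup>2) / \<rho>\<close> is the image of the circle \<open>\<bar>\<zeta>\<bar> = \<rho>\<close> under the Joukowski map.
\<close>

lemma joukowski_preimage:
  fixes y :: complex
  assumes d: "d \<ge> (1::nat)" and y: "cmod (y - 1) + cmod (y + 1) \<le> 2 + 1 / (4 * real d ^ 2)"
  obtains \<zeta> where "y = (\<zeta> + 1 / \<zeta>) / 2" "\<zeta> \<noteq> 0" "cmod \<zeta> \<le> 1" "cmod \<zeta> ^ d \<ge> 1 / 2"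
proof -
  \<comment> \<open>\<open>y + r\<close> and \<open>y - r\<close> are the two Joukowski preimages of
    \<open>y\<close>, inverse to each other; the one in the unit disk is taken, since the Leja
    inequality holds there.\<close>
  define r where "r = csqrt (y ^ 2 - 1)"
  have "r ^ 2 = y ^ 2 - 1"
    by (simp add: r_def)
  then have prod: "(y + r) * (y - r) = 1"
    by (simp add: power2_eq_square algebra_simps)
  obtain \<zeta> \<xi> where \<zeta>: "\<zeta> * \<xi> = 1" "\<zeta> + \<xi> = 2 * y" "cmod \<zeta> \<le> 1"
  proof (cases "cmod (y + r) \<le> 1")
    case True
    then show ?thesis using prod by (intro that[of "y + r" "y - r"]) auto
  next
    case False
    have "cmod (y + r) * cmod (y - r) = 1"
      using prod by (metis norm_mult norm_one)
    moreover have "cmod (y - r) \<le> cmod (y + r) * cmod (y - r)"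
      using False mult_right_mono[of 1 "cmod (y + r)" "cmod (y - r)"] by simp
    ultimately have "cmod (y - r) \<le> 1"
      by simp
    then show ?thesis using prod by (intro that[of "y - r" "y + r"]) (auto simp: mult.commute)
  qed
  have "\<zeta> \<noteq> 0"
    using \<zeta> by auto
  then have "\<xi> = 1 / \<zeta>"
    using \<zeta>(1) by (simp add: eq_divide_eq mult.commute)
  then have y_eq: "y = (\<zeta> + 1 / \<zeta>) / 2"
    using \<zeta> by simp
  define \<rho> where "\<rho> = cmod \<zeta>"
  have \<rho>: "0 < \<rho>" "\<rho> \<le> 1"
    using \<zeta> \<open>\<zeta> \<noteq> 0\<close> by (auto simp: \<rho>_def)
  have "y - 1 = (\<zeta> - 1)\<^sup>2 / (2 * \<zeta>)" "y + 1 = (\<zeta> + 1)\<^sup>2 / (2 * \<zeta>)"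
    using \<open>\<zeta> \<noteq> 0\<close> by (auto simp: y_eq field_simps power2_eq_square)
  then have "cmod (y - 1) + cmod (y + 1) = ((cmod (\<zeta> - 1))\<^sup>2 + (cmod (\<zeta> + 1))\<^sup>2) / (2 * \<rho>)"
    by (simp add: norm_divide norm_mult norm_power \<rho>_def add_divide_distrib)
  also have "(cmod (\<zeta> - 1))\<^sup>2 + (cmod (\<zeta> + 1))\<^sup>2 = 2 * \<rho>\<^sup>2 + 2"
    unfolding \<rho>_def cmod_power2 by (simp add: power2_eq_square algebra_simps)
  finally have "(2 * \<rho>\<^sup>2 + 2) / (2 * \<rho>) \<le> 2 + 1 / (4 * real d ^ 2)"
    using y by simp
  then have "(\<rho>\<^sup>2 + 1) \<le> 2 * \<rho> + \<rho> * (1 / (4 * real d ^ 2))"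
    using \<rho> by (simp add: divide_le_eq algebra_simps)
  moreover have "\<rho> * (1 / (4 * real d ^ 2)) \<le> 1 * (1 / (4 * real d ^ 2))"
    using \<rho> by (intro mult_right_mono) auto
  \<comment> \<open>The excess \<open>1 / (4 * d^2)\<close> is the square of
    \<open>1 / (2 * d)\<close>; so \<open>\<rho>\<close> is at least \<open>1 - 1 / (2 * d)\<close>,
    and Bernoulli's inequality keeps \<open>\<rho> ^ d\<close> above \<open>1 / 2\<close>.\<close>
  ultimately have "(1 - \<rho>)\<^sup>2 \<le> (1 / (2 * real d))\<^sup>2"
    by (simp add: power2_eq_square algebra_simps)
  then have "1 - \<rho> \<le> 1 / (2 * real d)"
    by (rule power2_le_imp_le) simp
  then have "real d * (1 - \<rho>) \<le> 1 / 2"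
    using d by (simp add: field_simps)
  moreover have "1 + real d * (\<rho> - 1) \<le> \<rho> ^ d"
    using Bernoulli_inequality[of "\<rho> - 1" d] \<rho> by simp
  ultimately have "\<rho> ^ d \<ge> 1 / 2"
    by (simp add: algebra_simps)
  then show thesis
    using that[OF y_eq \<open>\<zeta> \<noteq> 0\<close> \<zeta>(3)] by (simp add: \<rho>_def)
qed

text \<open>The thickness of the ellipse at \<open>y0\<close> is of order
  \<open>sqrt (1 - y0^2) / d\<close> in the middle and \<open>1 / d^2\<close> near the foci. Near
  the foci the triangle inequality suffices. Elsewhere it is too weak: a displacement must not count
  to first order, and the sum of the focal distances is squared to exhibit the cancellation.\<close>

lemma ball_in_ellipse:
  fixes y :: complex and y0 :: real
  assumes d: "d \<ge> (1::nat)" and y0: "\<bar>y0\<bar> \<le> 1"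
    and y: "cmod (y - of_real y0) \<le> max (sqrt (1 - y0\<^sup>2)) (1 / real d) / (8 * real d)"
  shows "cmod (y - 1) + cmod (y + 1) \<le> 2 + 1 / (4 * real d ^ 2)"
proof -
  define \<sigma> where "\<sigma> = 1 - y0\<^sup>2"
  have \<sigma>: "0 \<le> \<sigma>" "\<sigma> \<le> 1"
    using y0 by (auto simp: \<sigma>_def abs_square_le_1)
  show ?thesis
  proof (cases "sqrt \<sigma> \<le> 1 / real d")
    case True
    have "cmod (y - 1) \<le> cmod (y - of_real y0) + cmod (of_real y0 - 1)"
      using norm_triangle_ineq[of "y - of_real y0" "of_real y0 - 1"] by simp
    moreover have "cmod (y + 1) \<le> cmod (y - of_real y0) + cmod (of_real y0 + 1)"
      using norm_triangle_ineq[of "y - of_real y0" "of_real y0 + 1"] by simp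
    moreover have "cmod (of_real y0 - 1) = 1 - y0" "cmod (of_real y0 + 1) = 1 + y0"
      using y0 norm_of_real[of "y0 - 1", where 'a = complex] norm_of_real[of "y0 + 1", where 'a = complex]
      by auto
    moreover have "cmod (y - of_real y0) \<le> 1 / (8 * real d ^ 2)"
      using y True by (simp add: \<sigma>_def max_def power2_eq_square)
    ultimately show ?thesis
      by simp
  next
    case False
    define h where "h = y - of_real y0"
    define r where "r = sqrt \<sigma> / (8 * real d)"
    have "cmod h \<le> r"
      using y False by (auto simp: h_def r_def \<sigma>_def max_def)
    have r2: "r\<^sup>2 = \<sigma> / (64 * real d ^ 2)"
      using \<sigma> by (simp add: r_def power_divide power_mult_distrib)
    have "r \<le> sqrt \<sigma> * sqrt \<sigma> / 8"
    proof -
      have "sqrt \<sigma> * (1 / real d) \<le> sqrt \<sigma> * sqrt \<sigma>"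
        using False \<sigma> by (intro mult_left_mono) auto
      then show ?thesis
        by (simp add: r_def field_simps)
    qed
    then have r: "r \<le> \<sigma> / 8" "0 \<le> r"
      using \<sigma> by (simp_all add: r_def)
    have "\<sigma> > 0"
      using False \<sigma> by (cases "\<sigma> = 0") auto
    define p q where "p = Re h" and "q = Im h"
    have pq: "p\<^sup>2 + q\<^sup>2 \<le> r\<^sup>2"
      using power_mono[OF \<open>cmod h \<le> r\<close>, of 2] by (simp add: cmod_power2 p_def q_def)
    have "\<bar>p\<bar> \<le> r"
      using abs_Re_le_cmod[of h] \<open>cmod h \<le> r\<close> by (simp add: p_def)
    have "\<bar>y0 * p\<bar> \<le> 1 * r"
      unfolding abs_mult using y0 \<open>\<bar>p\<bar> \<le> r\<close> by (intro mult_mono) auto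
    then have m: "\<sigma> - 2 * y0 * p \<ge> \<sigma> / 2"
      using r by linarith
    have sq: "(cmod (y - 1) + cmod (y + 1))\<^sup>2 = 2 * (cmod y)\<^sup>2 + 2 + 2 * cmod (y\<^sup>2 - 1)"
    proof -
      have "(cmod (y - 1))\<^sup>2 + (cmod (y + 1))\<^sup>2 = 2 * (cmod y)\<^sup>2 + 2"
        unfolding cmod_power2 by (simp add: power2_eq_square algebra_simps)
      moreover have "cmod (y - 1) * cmod (y + 1) = cmod (y\<^sup>2 - 1)"
        by (simp add: norm_mult[symmetric] power2_eq_square algebra_simps)
      ultimately show ?thesis
        by (simp add: power2_sum)
    qed
    have y2: "(cmod y)\<^sup>2 \<le> y0\<^sup>2 + 2 * y0 * p + r\<^sup>2"
    proof -
      have "(cmod y)\<^sup>2 = y0\<^sup>2 + 2 * y0 * p + (p\<^sup>2 + q\<^sup>2)"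
        unfolding cmod_power2 p_def q_def h_def by (simp add: power2_eq_square algebra_simps)
      then show ?thesis using pq by simp
    qed
    \<comment> \<open>The linear term \<open>- 2 * y0 * p\<close> cancels that of
      \<open>(cmod y)^2\<close> in \<open>sq\<close>, and the imaginary part contributes only its
      square divided by the real part. So only terms of order \<open>r^2\<close> and
      \<open>r^2 / \<sigma>\<close> remain.\<close>
    have "cmod (Complex (\<sigma> - 2 * y0 * p) (- 2 * y0 * q)) \<le> (\<sigma> - 2 * y0 * p) + 4 * r\<^sup>2 / \<sigma>"
    proof -
      define m where "m = \<sigma> - 2 * y0 * p"
      have "(2 * y0 * q)\<^sup>2 \<le> 4 * r\<^sup>2"
      proof -
        have "y0\<^sup>2 * q\<^sup>2 \<le> 1 * r\<^sup>2"
        proof (rule mult_mono)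
          show "q\<^sup>2 \<le> r\<^sup>2"
            using pq zero_le_power2[of p] by linarith
        qed (use y0 in \<open>auto simp: abs_square_le_1\<close>)
        then show ?thesis by (simp add: power_mult_distrib)
      qed
      also have "4 * r\<^sup>2 \<le> (2 * m) * (4 * r\<^sup>2 / \<sigma>)"
      proof -
        have "\<sigma> * (4 * r\<^sup>2 / \<sigma>) \<le> (2 * m) * (4 * r\<^sup>2 / \<sigma>)"
          using \<open>\<sigma> > 0\<close> \<open>\<sigma> - 2 * y0 * p \<ge> \<sigma> / 2\<close> by (intro mult_right_mono) (auto simp: m_def)
        then show ?thesis using \<open>\<sigma> > 0\<close> by simp
      qed
      also have "\<dots> \<le> (m + 4 * r\<^sup>2 / \<sigma>)\<^sup>2 - m\<^sup>2"
        by (simp add: power2_sum)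
      finally have "(cmod (Complex m (- 2 * y0 * q)))\<^sup>2 \<le> (m + 4 * r\<^sup>2 / \<sigma>)\<^sup>2"
        by (simp add: cmod_power2)
      moreover have "0 \<le> m + 4 * r\<^sup>2 / \<sigma>"
        using \<open>\<sigma> > 0\<close> \<open>\<sigma> - 2 * y0 * p \<ge> \<sigma> / 2\<close>
        by (intro add_nonneg_nonneg) (auto simp: m_def)
      ultimately show ?thesis
        unfolding m_def by (rule power2_le_imp_le)
    qed
    moreover have "y\<^sup>2 - 1 = - Complex (\<sigma> - 2 * y0 * p) (- 2 * y0 * q) + h\<^sup>2"
      by (simp add: complex_eq_iff \<sigma>_def p_def q_def h_def power2_eq_square algebra_simps)
    then have "cmod (y\<^sup>2 - 1) \<le> cmod (Complex (\<sigma> - 2 * y0 * p) (- 2 * y0 * q)) + r\<^sup>2"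
      using norm_triangle_ineq[of "- Complex (\<sigma> - 2 * y0 * p) (- 2 * y0 * q)" "h\<^sup>2"]
        power_mono[OF \<open>cmod h \<le> r\<close>, of 2] by (simp add: norm_power)
    ultimately have "(cmod (y - 1) + cmod (y + 1))\<^sup>2 \<le> 4 + 4 * r\<^sup>2 + 8 * (r\<^sup>2 / \<sigma>)"
      using y2 unfolding sq \<sigma>_def by simp
    also have "\<dots> \<le> 4 + 1 / real d ^ 2"
    proof -
      have "r\<^sup>2 / \<sigma> = 1 / (64 * real d ^ 2)"
        using \<open>\<sigma> > 0\<close> by (simp add: r2)
      moreover have "r\<^sup>2 \<le> 1 / (64 * real d ^ 2)"
        unfolding r2 using \<sigma> by (intro divide_right_mono) auto
      moreover have "1 / (64 * real d ^ 2) = (1 / real d ^ 2) / 64" "0 \<le> 1 / real d ^ 2"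
        by simp_all
      ultimately show ?thesis
        by linarith
    qed
    also have "\<dots> \<le> (2 + 1 / (4 * real d ^ 2))\<^sup>2"
      by (simp add: power2_sum)
    finally show ?thesis
      by (rule power2_le_imp_le) simp
  qed
qed

lemma deriv_funpow_poly: "(deriv ^^ n) (poly p) = poly ((pderiv ^^ n) (p :: complex poly))"
  by (induction n) (auto intro!: DERIV_imp_deriv poly_DERIV)

text \<open>
  The circle around \<open>y0\<close> on which the Cauchy estimate is applied has a radius comparable to that of
  the largest disk in the ellipse, chosen such that it stays away from the zero \<open>c\<close> of the weight.
\<close>

lemma poly_weighted_cauchy:
  fixes p :: "complex poly" and c y0 :: real
  assumes d: "d \<ge> (1::nat)" and y0: "\<bar>y0\<bar> \<le> 1" and c: "\<bar>c\<bar> \<le> 1"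
    and bound: "\<And>y. cmod (y - 1) + cmod (y + 1) \<le> 2 + 1 / (4 * real d ^ 2) \<Longrightarrow>
                  cmod (y - of_real c) * cmod (poly p y) \<le> 8 * (1 - c\<^sup>2)"
  shows "cmod (poly ((pderiv ^^ Suc n) p) (of_real y0)) \<le>
           fact (Suc n) * 9216 * real d ^ 2 * (32 * real d ^ 2) ^ n"
proof -
  define \<sigma> where "\<sigma> = 1 - y0\<^sup>2"
  define r where "r = max (sqrt \<sigma>) (1 / real d) / (8 * real d)"
  have \<sigma>: "0 \<le> \<sigma>"
    using y0 by (auto simp: \<sigma>_def abs_square_le_1)
  have r: "r > 0"
    using d by (simp add: r_def less_max_iff_disj)
  have "1 / (8 * real d ^ 2) \<le> r"
    using d by (simp add: r_def power2_eq_square field_simps)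
  then have inv_r: "1 / r \<le> 8 * real d ^ 2"
    using r d by (simp add: field_simps)
  have "sqrt \<sigma> \<le> 8 * real d * r"
    using d by (simp add: r_def)
  then have "(sqrt \<sigma>)\<^sup>2 \<le> (8 * real d * r)\<^sup>2"
    using \<sigma> by (intro power_mono) auto
  then have \<sigma>_r: "\<sigma> / r\<^sup>2 \<le> 64 * real d ^ 2"
    using r \<sigma> by (simp add: divide_le_eq power_mult_distrib)
  have "(y0 - c) * (y0 + c) \<le> \<bar>y0 - c\<bar> * 2"
  proof -
    have "(y0 - c) * (y0 + c) \<le> \<bar>y0 - c\<bar> * \<bar>y0 + c\<bar>"
      by (metis abs_ge_self abs_mult)
    also have "\<dots> \<le> \<bar>y0 - c\<bar> * 2"
      using y0 c by (intro mult_left_mono) auto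
    finally show ?thesis .
  qed
  \<comment> \<open>The numerator splits into \<open>\<sigma>\<close>, which is at most a multiple
    of \<open>d^2 * r^2\<close>, and a part absorbed by the distance from \<open>c\<close>.\<close>
  then have c2: "1 - c\<^sup>2 \<le> \<sigma> + 2 * \<bar>y0 - c\<bar>"
    by (simp add: \<sigma>_def power2_eq_square algebra_simps)
  have c2': "0 \<le> 1 - c\<^sup>2"
    using c by (simp add: abs_square_le_1)
  \<comment> \<open>The estimate on one circle of radius \<open>\<rho>\<close> on which the weight
    is at least \<open>m\<close>. From \<open>1 / \<rho> \<le> 4 / r\<close> and
    \<open>1 / r \<le> 8 * d^2\<close> comes the factor \<open>32 * d^2\<close> for each further
    derivative.\<close>
  have cauchy: ?thesis
    if \<rho>: "0 < \<rho>" "\<rho> \<le> r" "r / 4 \<le> \<rho>" and m: "m > 0" and B: "8 * (1 - c\<^sup>2) / m \<le> 9216 * real d ^ 2 * \<rho>"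
      and away: "\<And>y. cmod (of_real y0 - y) = \<rho> \<Longrightarrow> m \<le> cmod (y - of_real c)" for \<rho> m
  proof -
    have "cmod ((deriv ^^ Suc n) (poly p) (of_real y0)) \<le>
        fact (Suc n) * (9216 * real d ^ 2 * \<rho>) / \<rho> ^ Suc n"
    proof (rule Cauchy_inequality)
      fix y assume y: "cmod (of_real y0 - y) = \<rho>"
      then have "cmod (y - 1) + cmod (y + 1) \<le> 2 + 1 / (4 * real d ^ 2)"
        using \<rho> by (intro ball_in_ellipse[OF d y0]) (simp add: norm_minus_commute r_def \<sigma>_def)
      from bound[OF this] have "m * cmod (poly p y) \<le> 8 * (1 - c\<^sup>2)"
        using away[OF y] by (meson mult_right_mono norm_ge_zero order.trans)
      then have "cmod (poly p y) \<le> 8 * (1 - c\<^sup>2) / m"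
        using m by (simp add: field_simps)
      then show "cmod (poly p y) \<le> 9216 * real d ^ 2 * \<rho>"
        using B by linarith
    qed (use \<rho> in \<open>auto intro!: holomorphic_intros continuous_intros\<close>)
    also have "\<dots> = fact (Suc n) * 9216 * real d ^ 2 * (1 / \<rho>) ^ n"
      using \<rho> by (simp add: power_one_over field_simps)
    also have "\<dots> \<le> fact (Suc n) * 9216 * real d ^ 2 * (32 * real d ^ 2) ^ n"
    proof -
      have "1 / \<rho> \<le> 4 * (1 / r)"
        using \<rho> r by (simp add: field_simps)
      then show ?thesis
        using inv_r \<rho> by (intro mult_left_mono power_mono) auto
    qed
    finally show ?thesis
      unfolding deriv_funpow_poly .
  qed
  have tri: "\<bar>y0 - c\<bar> \<le> cmod (of_real y0 - y) + cmod (y - of_real c)"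
    and tri': "cmod (of_real y0 - y) \<le> \<bar>y0 - c\<bar> + cmod (y - of_real c)" for y
  proof -
    have *: "\<bar>y0 - c\<bar> = cmod (of_real y0 - of_real c)"
      by (metis norm_of_real of_real_diff)
    show "\<bar>y0 - c\<bar> \<le> cmod (of_real y0 - y) + cmod (y - of_real c)"
      unfolding * using norm_triangle_ineq[of "of_real y0 - y" "y - of_real c"] by simp
    show "cmod (of_real y0 - y) \<le> \<bar>y0 - c\<bar> + cmod (y - of_real c)"
      unfolding * using norm_triangle_ineq4[of "of_real y0 - of_real c" "y - of_real c"] by simp
  qed
  show ?thesis
  \<comment> \<open>If \<open>c\<close> is near \<open>y0\<close>, the full radius \<open>r\<close>
    leaves it inside, at distance at least \<open>r / 2\<close> from the circle; otherwise radius
    \<open>r / 4\<close> keeps the circle away from \<open>c\<close> by at least half of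
    \<open>\<bar>y0 - c\<bar>\<close>. The second case yields the larger constant
    \<open>64 * 144 = 9216\<close>.\<close>
  proof (cases "\<bar>y0 - c\<bar> \<le> r / 2")
    case True
    have "8 * (1 - c\<^sup>2) / (r / 2) = 16 * ((1 - c\<^sup>2) / r\<^sup>2) * r"
      using r by (simp add: power2_eq_square)
    also have "(1 - c\<^sup>2) / r\<^sup>2 \<le> (\<sigma> + r) / r\<^sup>2"
      using c2 True by (intro divide_right_mono) auto
    also have "\<dots> = \<sigma> / r\<^sup>2 + 1 / r"
      using r by (simp add: add_divide_distrib power2_eq_square)
    also have "\<dots> \<le> 72 * real d ^ 2"
      using inv_r \<sigma>_r by simp
    finally have "8 * (1 - c\<^sup>2) / (r / 2) \<le> 16 * (72 * real d ^ 2) * r"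
      using r by simp
    also have "\<dots> \<le> 9216 * real d ^ 2 * r"
      using r by simp
    finally have B: "8 * (1 - c\<^sup>2) / (r / 2) \<le> 9216 * real d ^ 2 * r" .
    show ?thesis
    proof (rule cauchy[of r "r / 2", rotated -1])
      show "r / 2 \<le> cmod (y - of_real c)" if "cmod (of_real y0 - y) = r" for y
        using tri'[of y] True that by linarith
    qed (use r B in auto)
  next
    case False
    define b where "b = \<bar>y0 - c\<bar>"
    have b: "b > r / 2" "b > 0"
      using False r by (auto simp: b_def)
    have "8 * (1 - c\<^sup>2) / (b / 2) = 64 * ((1 - c\<^sup>2) / (r * b)) * (r / 4)"
      using r b by (simp add: field_simps)
    also have "(1 - c\<^sup>2) / (r * b) \<le> (\<sigma> + 2 * b) / (r * b)"
      using c2 b r by (intro divide_right_mono) (auto simp: b_def)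
    also have "\<dots> = \<sigma> / (r * b) + 2 * (1 / r)"
      using r b by (simp add: add_divide_distrib)
    also have "\<sigma> / (r * b) \<le> \<sigma> / (r * (r / 2))"
      using r b \<sigma> by (intro divide_left_mono mult_left_mono) auto
    also have "\<dots> = 2 * (\<sigma> / r\<^sup>2)"
      by (simp add: power2_eq_square)
    also have "2 * (\<sigma> / r\<^sup>2) + 2 * (1 / r) \<le> 144 * real d ^ 2"
      using inv_r \<sigma>_r by simp
    finally have B: "8 * (1 - c\<^sup>2) / (b / 2) \<le> 9216 * real d ^ 2 * (r / 4)"
      using r by simp
    show ?thesis
    proof (rule cauchy[of "r / 4" "b / 2", rotated -1])
      show "b / 2 \<le> cmod (y - of_real c)" if "cmod (of_real y0 - y) = r / 4" for y
        using tri[of y] that b unfolding b_def[symmetric] by linarith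
    qed (use r b B in auto)
  qed
qed

context
  fixes a :: "nat \<Rightarrow> complex" and d :: nat
  assumes norm_a: "\<And>j. j < d \<Longrightarrow> cmod (a j) = 1" and inj_a: "inj_on a {..<d}"
    and quasi_leja: "\<And>j z. j < d \<Longrightarrow> cmod z \<le> 1 \<Longrightarrow>
          cmod (\<Prod>i<d. z - a i) \<le> 2 * cmod (\<Prod>i\<in>{..<d} - {j}. a j - a i)"
begin

text \<open>In Joukowski coordinates the numerator is \<open>\<bar>w\<bar>\<close> at
  \<open>u * \<zeta>\<close> times \<open>\<bar>w\<bar>\<close> at \<open>u * cnj \<zeta>\<close>,
  over \<open>2 ^ d * cmod \<zeta> ^ d\<close>. Comparing the first value with node \<open>s\<close>
  and the second with node \<open>t\<close> reproduces the product \<open>X * Y\<close> of the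
  denominator; only the chord length survives, once from each comparison, as
  \<open>2 * \<delta>^2\<close>.\<close>

lemma weighted_hak_poly_bound:
  assumes st: "s < t" "t < d"
    and y: "cmod (y - 1) + cmod (y + 1) \<le> 2 + 1 / (4 * real d ^ 2)"
  shows "cmod (y - of_real (coord a s t (a s))) * cmod (poly (hak_poly a d s t) y) \<le>
           8 * (1 - (coord a s t (a s))\<^sup>2)"
proof -
  define c where "c j = coord a s t (a j)" for j
  define u where "u = bisector (a s) (a t)"
  define X where "X = (\<Prod>j\<in>{..<d} - {s, t}. cmod (a s - a j))"
  define Y where "Y = (\<Prod>j\<in>{..<d} - {s, t}. cmod (a t - a j))"
  define \<delta> where "\<delta> = cmod (a s - a t)"
  have u: "cmod u = 1"
    unfolding u_def using norm_a st by (intro norm_bisector) auto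
  have "d \<ge> 1"
    using st by simp
  from joukowski_preimage[OF this y]
  obtain \<zeta> where \<zeta>: "y = (\<zeta> + 1 / \<zeta>) / 2" "\<zeta> \<noteq> 0" "cmod \<zeta> \<le> 1" "cmod \<zeta> ^ d \<ge> 1 / 2" .
  have s: "(\<Prod>i\<in>{..<d} - {s}. cmod (a s - a i)) = \<delta> * X"
  proof -
    have "{..<d} - {s} - {t} = {..<d} - {s, t}" by auto
    then show ?thesis
      using prod.remove[of "{..<d} - {s}" t "\<lambda>i. cmod (a s - a i)"] st by (simp add: X_def \<delta>_def)
  qed
  have t: "(\<Prod>i\<in>{..<d} - {t}. cmod (a t - a i)) = \<delta> * Y"
  proof -
    have "{..<d} - {t} - {s} = {..<d} - {s, t}" by auto
    then show ?thesis
      using prod.remove[of "{..<d} - {t}" s "\<lambda>i. cmod (a t - a i)"] st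
      by (simp add: Y_def \<delta>_def norm_minus_commute)
  qed
  have "0 < cmod (a s - a j)" "0 < cmod (a t - a j)" if "j \<in> {..<d} - {s, t}" for j
    using that inj_a st by (auto simp: inj_on_def)
  then have XY: "X > 0" "Y > 0"
    unfolding X_def Y_def by (intro prod_pos; blast)+
  have "cmod (\<Prod>j<d. y - of_real (c j)) = (\<Prod>j<d. cmod (u * \<zeta> - a j) * cmod (u * cnj \<zeta> - a j) / (2 * cmod \<zeta>))"
    unfolding prod_norm[symmetric]
  proof (rule prod.cong)
    show "cmod (y - of_real (c j)) = cmod (u * \<zeta> - a j) * cmod (u * cnj \<zeta> - a j) / (2 * cmod \<zeta>)"
      if "j \<in> {..<d}" for j
      unfolding \<zeta>(1) c_def coord_def u_def[symmetric]
      by (rule cmod_joukowski_diff) (use u norm_a that \<zeta> in auto)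
  qed simp
  also have "\<dots> = cmod (\<Prod>j<d. u * \<zeta> - a j) * cmod (\<Prod>j<d. u * cnj \<zeta> - a j) / (2 ^ d * cmod \<zeta> ^ d)"
    by (simp add: prod_dividef prod.distrib prod_norm power_mult_distrib)
  also have "\<dots> \<le> (2 * (\<delta> * X)) * (2 * (\<delta> * Y)) / (2 ^ d * (1 / 2))"
  proof (intro frac_le mult_mono)
    show "cmod (\<Prod>j<d. u * \<zeta> - a j) \<le> 2 * (\<delta> * X)"
      using quasi_leja[of s "u * \<zeta>"] u \<zeta> st s by (simp add: norm_mult prod_norm)
    show "cmod (\<Prod>j<d. u * cnj \<zeta> - a j) \<le> 2 * (\<delta> * Y)"
      using quasi_leja[of t "u * cnj \<zeta>"] u \<zeta> st t by (simp add: norm_mult prod_norm)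
  qed (use \<zeta> XY in \<open>auto simp: \<delta>_def\<close>)
  finally have num: "cmod (\<Prod>j<d. y - of_real (c j)) \<le> 8 * \<delta>\<^sup>2 * X * Y / 2 ^ d"
    by (simp add: power2_eq_square algebra_simps)
  have "\<bar>\<Prod>j\<in>{..<d} - {s, t}. c s - c j\<bar> = (\<Prod>j\<in>{..<d} - {s, t}. cmod (a s - a j) * cmod (a t - a j) / 2)"
    unfolding abs_prod c_def by (intro prod.cong coord_diff[OF norm_a inj_a st]) auto
  also have "\<dots> = X * Y / 2 ^ card ({..<d} - {s, t})"
    by (simp add: prod_dividef prod.distrib X_def Y_def)
  also have "card ({..<d} - {s, t}) = d - 2"
    using st by (simp add: card_Diff_subset)
  finally have den: "\<bar>\<Prod>j\<in>{..<d} - {s, t}. c s - c j\<bar> = X * Y / 2 ^ (d - 2)" .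
  have "(2::real) ^ d = 4 * 2 ^ (d - 2)"
  proof -
    have "d = Suc (Suc (d - 2))"
      using st by simp
    then have "(2::real) ^ d = 2 ^ Suc (Suc (d - 2))"
      by (rule arg_cong)
    then show ?thesis by simp
  qed
  then have q: "8 * \<delta>\<^sup>2 * X * Y / 2 ^ d / (X * Y / 2 ^ (d - 2)) = 2 * \<delta>\<^sup>2"
    using XY by simp
  have "(y - of_real (c s)) * (\<Prod>j\<in>{..<d} - {s}. y - of_real (c j)) = (\<Prod>j<d. y - of_real (c j))"
    by (rule prod.remove[symmetric]) (use st in auto)
  then have "cmod (y - of_real (c s)) * cmod (poly (hak_poly a d s t) y) =
      cmod (\<Prod>j<d. y - of_real (c j)) / \<bar>\<Prod>j\<in>{..<d} - {s, t}. c s - c j\<bar>"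
    unfolding poly_hak_poly norm_divide norm_of_real c_def[symmetric]
    by (simp add: norm_mult[symmetric] del: prod_norm)
  also have "\<dots> \<le> 2 * \<delta>\<^sup>2"
    unfolding den q[symmetric] using num XY by (intro divide_right_mono) auto
  also have "\<dots> = 8 * (1 - (c s)\<^sup>2)"
  proof -
    have "1 - (c s)\<^sup>2 = \<delta>\<^sup>2 / 4"
      unfolding c_def \<delta>_def by (rule one_minus_coord_sq) (use norm_a inj_a st in auto)
    then show ?thesis by simp
  qed
  finally show ?thesis
    unfolding c_def .
qed

lemma abs_coord_le: "s < t \<Longrightarrow> t < d \<Longrightarrow> cmod x \<le> 1 \<Longrightarrow> \<bar>coord a s t x\<bar> \<le> 1"
  using abs_Re_le_cmod[of "cnj (bisector (a s) (a t)) * x"] norm_a norm_bisector[of "a s" "a t"]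
  by (simp add: coord_def norm_mult)

lemma cmod_pderiv_hak_poly_le:
  assumes "s < t" "t < d" "cmod x \<le> 1"
  shows "cmod (poly ((pderiv ^^ Suc n) (hak_poly a d s t)) (of_real (coord a s t x))) \<le>
           fact (Suc n) * 9216 * real d ^ 2 * (32 * real d ^ 2) ^ n"
proof (rule poly_weighted_cauchy)
  show "\<bar>coord a s t (a s)\<bar> \<le> 1"
    using abs_coord_le[of s t "a s"] norm_a[of s] assms by simp
qed (use assms weighted_hak_poly_bound abs_coord_le in auto)

lemma abs_hak_basis_le:
  assumes "s < t" "t < d" "cmod x \<le> 1"
  shows "\<bar>hak_basis a d s t x\<bar> \<le> 9216 * real d ^ 2"
  using cmod_pderiv_hak_poly_le[OF assms, of 0] abs_Re_le_cmod order.trans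
  by (fastforce simp: hak_basis_def)

lemma abs_partial_deriv_hak_basis_le:
  assumes "s < t" "t < d" "cmod x \<le> 1" "cmod v = 1"
  shows "\<bar>partial_deriv v (hak_basis a d s t) x\<bar> \<le> 589824 * real d ^ 4"
proof -
  define u where "u = cnj (bisector (a s) (a t))"
  define p where "p = pderiv (hak_poly a d s t)"
  have "((\<lambda>x. poly p (of_real (Re (u * x)))) has_derivative
      (\<lambda>h. of_real (Re (u * h)) * poly (pderiv p) (of_real (Re (u * x))))) (at x)"
  proof -
    have "((\<lambda>x. poly p (of_real (Re (u * x)))) has_derivative
        (\<lambda>h. poly (pderiv p) (of_real (Re (u * x))) * of_real (Re (u * h)))) (at x)"
      by (rule has_derivative_compose[where g = "poly p", OF _ poly_DERIV[unfolded has_field_derivative_def]])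
         (auto intro!: derivative_eq_intros)
    then show ?thesis
      by (simp add: mult.commute)
  qed
  from has_derivative_Re[OF this]
  have "partial_deriv v (hak_basis a d s t) x = Re (of_real (Re (u * v)) * poly (pderiv p) (of_real (Re (u * x))))"
    unfolding hak_basis_def[abs_def] coord_def u_def[symmetric] p_def[symmetric]
    by (rule partial_deriv_eq)
  also have "\<bar>\<dots>\<bar> \<le> \<bar>Re (u * v)\<bar> * cmod (poly (pderiv p) (of_real (Re (u * x))))"
    using abs_Re_le_cmod[of "of_real (Re (u * v)) * poly (pderiv p) (of_real (Re (u * x)))"]
    by (simp only: norm_mult norm_of_real)
  also have "\<dots> \<le> 1 * cmod (poly (pderiv p) (of_real (Re (u * x))))"
  proof (rule mult_right_mono)
    show "\<bar>Re (u * v)\<bar> \<le> 1"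
      using abs_Re_le_cmod[of "u * v"] norm_a norm_bisector[of "a s" "a t"] assms
      by (simp add: u_def norm_mult)
  qed simp
  \<comment> \<open>\<open>589824 = fact 2 * 9216 * 32\<close>.\<close>
  also have "\<dots> \<le> 589824 * real d ^ 4"
    using cmod_pderiv_hak_poly_le[OF assms(1-3), of 1]
    by (simp add: p_def u_def coord_def power4_eq_xxxx power2_eq_square mult_ac)
  finally show ?thesis .
qed

lemma sum_pairs_le:
  assumes "\<And>s t. s < t \<Longrightarrow> t < d \<Longrightarrow> \<bar>g s t\<bar> \<le> m" "m \<ge> 0"
  shows "\<bar>\<Sum>(s, t)\<in>pairs d. g s t\<bar> \<le> real d ^ 2 * m"
proof -
  have "\<bar>\<Sum>(s, t)\<in>pairs d. g s t\<bar> \<le> (\<Sum>(s, t)\<in>pairs d. \<bar>g s t\<bar>)"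
    using sum_abs[of "\<lambda>(s, t). g s t" "pairs d"] by (simp add: case_prod_unfold)
  also have "\<dots> \<le> real (card (pairs d)) * m"
    using assms by (intro sum_bounded_above) auto
  also have "\<dots> \<le> real d ^ 2 * m"
    using assms card_pairs_le by (intro mult_right_mono)
  finally show ?thesis .
qed

lemma hakopian_bound:
  assumes f: "continuous_on unit_disk f" "\<And>x. x \<in> unit_disk \<Longrightarrow> \<bar>f x\<bar> \<le> m" and d: "2 \<le> d"
    and x: "x \<in> unit_disk"
  shows "\<bar>hakopian (map a [0..<d]) f x\<bar> \<le> 9216 * real d ^ 4 * m"
proof -
  have m: "m \<ge> 0"
    using f(2)[of 0] by simp
  have "\<bar>hakopian (map a [0..<d]) f x\<bar> \<le> real d ^ 2 * (m * (9216 * real d ^ 2))"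
    unfolding hakopian_eq[OF norm_a inj_a f(1) d, simplified]
  proof (rule sum_pairs_le)
    show "\<bar>seg_integral (a s) (a t) f * hak_basis a d s t x\<bar> \<le> m * (9216 * real d ^ 2)"
      if "s < t" "t < d" for s t
      unfolding abs_mult using that x m norm_a f
      by (intro mult_mono seg_integral_bound abs_hak_basis_le) auto
  qed (use m in auto)
  then show ?thesis
    by (simp add: power4_eq_xxxx power2_eq_square mult_ac)
qed

lemma hakopian_polys2_eq:
  assumes "P \<in> polys2 (d - 2)" "2 \<le> d"
  shows "hakopian (map a [0..<d]) P = P"
  using hakopian_eq[OF norm_a inj_a continuous_on_polys2[OF assms(1)] assms(2)]
    polys2_hak_expansion[OF norm_a inj_a assms]
  by (simp add: fun_eq_iff)

lemma hakopian_in_polys2: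
  assumes "continuous_on unit_disk f" "2 \<le> d"
  shows "hakopian (map a [0..<d]) f \<in> polys2 (d - 2)"
proof -
  have "(\<lambda>x. \<Sum>p\<in>pairs d. seg_integral (a (fst p)) (a (snd p)) f * hak_basis a d (fst p) (snd p) x)
      \<in> polys2 (d - 2)"
    by (intro polys2_sum polys2_cmult hak_basis_in_polys2) auto
  then show ?thesis
    by (simp add: hakopian_eq[OF norm_a inj_a assms] case_prod_unfold)
qed

text \<open>Lebesgue's inequality: interpolation is linear and reproduces
  \<open>polys2 (d - 2)\<close>, so its error on \<open>f\<close> equals its error on
  \<open>f - P\<close>.\<close>

lemma hakopian_error:
  assumes f: "continuous_on unit_disk f" and P: "P \<in> polys2 (d - 2)"
    and fP: "\<And>x. x \<in> unit_disk \<Longrightarrow> \<bar>f x - P x\<bar> \<le> m" and d: "2 \<le> d" and x: "x \<in> unit_disk"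
  shows "\<bar>hakopian (map a [0..<d]) f x - f x\<bar> \<le> (9216 * real d ^ 4 + 1) * m"
proof -
  have cont: "continuous_on unit_disk (\<lambda>x. f x - P x)"
    using f continuous_on_polys2[OF P] by (intro continuous_intros)
  have "seg_integral (a s) (a t) (\<lambda>x. f x - P x) = seg_integral (a s) (a t) f - seg_integral (a s) (a t) P"
    if "s < t" "t < d" for s t
    using that norm_a by (intro seg_integral_diff f continuous_on_polys2[OF P]) auto
  then have "hakopian (map a [0..<d]) (\<lambda>x. f x - P x) x =
      hakopian (map a [0..<d]) f x - hakopian (map a [0..<d]) P x"
    unfolding hakopian_eq[OF norm_a inj_a f d, simplified] hakopian_eq[OF norm_a inj_a cont d, simplified]
      hakopian_eq[OF norm_a inj_a continuous_on_polys2[OF P] d, simplified]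
    by (simp add: case_prod_unfold left_diff_distrib flip: sum_subtractf)
  then have "\<bar>hakopian (map a [0..<d]) f x - P x\<bar> \<le> 9216 * real d ^ 4 * m"
    using hakopian_bound[OF cont fP d x] hakopian_polys2_eq[OF P d] by simp
  then show ?thesis
    using fP[OF x] by (simp add: algebra_simps)
qed

text \<open>Obtained by differentiating the reproducing formula of \<open>P\<close>: at most
  \<open>d^2\<close> pairs, each with a basis derivative of order \<open>d^4\<close>. Any fixed
  power is good enough, as it is set against rates \<open>1 / d ^ k\<close> for all
  \<open>k\<close>.\<close>

lemma markov_disk:
  assumes P: "P \<in> polys2 (d - 2)" and m: "\<And>x. x \<in> unit_disk \<Longrightarrow> \<bar>P x\<bar> \<le> m"
    and d: "2 \<le> d" and x: "x \<in> unit_disk" and v: "v \<in> {1, \<i>}"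
  shows "\<bar>partial_deriv v P x\<bar> \<le> 589824 * real d ^ 6 * m"
proof -
  have m0: "m \<ge> 0"
    using m[of 0] by simp
  have cv: "cmod v = 1"
    using v by auto
  have der: "(hak_basis a d s t has_derivative (\<lambda>h. frechet_derivative (hak_basis a d s t) (at x) h)) (at x)"
    if "s < t" "t < d" for s t
  proof -
    have "hak_basis a d s t differentiable at x"
      using hak_basis_in_polys2[of s d a t] that has_derivative_polys2
      by (metis differentiableI less_trans)
    then show ?thesis
      by (simp add: frechet_derivative_works[symmetric])
  qed
  have P_eq: "P = (\<lambda>x. \<Sum>p\<in>pairs d. seg_integral (a (fst p)) (a (snd p)) P * hak_basis a d (fst p) (snd p) x)"
    using polys2_hak_expansion[OF norm_a inj_a P d] by (simp add: fun_eq_iff case_prod_unfold)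
  have "(P has_derivative (\<lambda>h. \<Sum>p\<in>pairs d. seg_integral (a (fst p)) (a (snd p)) P *
      frechet_derivative (hak_basis a d (fst p) (snd p)) (at x) h)) (at x)"
    by (subst P_eq, intro has_derivative_sum has_derivative_mult_right der) auto
  from partial_deriv_eq[OF this]
  have "partial_deriv v P x = (\<Sum>(s, t)\<in>pairs d. seg_integral (a s) (a t) P * partial_deriv v (hak_basis a d s t) x)"
    by (auto simp: case_prod_unfold partial_deriv_eq[OF der] intro!: sum.cong)
  also have "\<bar>\<dots>\<bar> \<le> real d ^ 2 * (m * (589824 * real d ^ 4))"
  proof (rule sum_pairs_le)
    show "\<bar>seg_integral (a s) (a t) P * partial_deriv v (hak_basis a d s t) x\<bar> \<le> m * (589824 * real d ^ 4)"
      if "s < t" "t < d" for s t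
      unfolding abs_mult using that x m0 m norm_a continuous_on_polys2[OF P] cv
      by (intro mult_mono seg_integral_bound abs_partial_deriv_hak_basis_le) auto
  qed (use m0 in auto)
  also have "\<dots> = 589824 * real d ^ 6 * m"
    by (simp add: mult_ac flip: power_add)
  finally show ?thesis .
qed

end

section \<open>Polynomial approximation on the disk\<close>

text \<open>The \<open>k\<close>-th power of identity minus shift, with the sign that gives
  \<open>f x\<close> the coefficient 1.\<close>

primrec fdiff :: "nat \<Rightarrow> complex \<Rightarrow> (complex \<Rightarrow> real) \<Rightarrow> complex \<Rightarrow> real" where
  "fdiff 0 s f x = f x"
| "fdiff (Suc k) s f x = fdiff k s f x - fdiff k s f (x + s)"

text \<open>The \<open>b j\<close> are binomial coefficients up to sign; the approximant is built
  from them because they do not depend on \<open>s\<close>, \<open>f\<close> and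
  \<open>x\<close>.\<close>

lemma fdiff_expansion:
  "\<exists>b. \<forall>s f x. fdiff k s f x = f x - (\<Sum>j=1..k. b j * f (x + of_nat j * s))"
proof -
  have "\<exists>c. c 0 = 1 \<and> (\<forall>s f x. fdiff k s f x = (\<Sum>j\<le>k. c j * f (x + of_nat j * s)))"
  proof (induction k)
    case 0
    show ?case by (rule exI[of _ "\<lambda>_. 1"]) simp
  next
    case (Suc k)
    then obtain c where c: "c 0 = 1" "\<And>s f x. fdiff k s f x = (\<Sum>j\<le>k. c j * f (x + of_nat j * s))"
      by blast
    define c' where "c' j = (if j \<le> k then c j else 0) - (if j = 0 then 0 else c (j - 1))" for j
    have "fdiff (Suc k) s f x = (\<Sum>j\<le>Suc k. c' j * f (x + of_nat j * s))" for s f x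
    proof -
      have "(\<Sum>j\<le>Suc k. c' j * f (x + of_nat j * s)) =
          (\<Sum>j\<le>Suc k. (if j \<le> k then c j else 0) * f (x + of_nat j * s)) -
          (\<Sum>j\<le>Suc k. (if j = 0 then 0 else c (j - 1)) * f (x + of_nat j * s))"
        by (simp only: c'_def left_diff_distrib sum_subtractf)
      also have "(\<Sum>j\<le>Suc k. (if j \<le> k then c j else 0) * f (x + of_nat j * s)) = fdiff k s f x"
        unfolding c(2) by (subst sum.atMost_Suc) simp
      also have "(\<Sum>j\<le>Suc k. (if j = 0 then 0 else c (j - 1)) * f (x + of_nat j * s)) = fdiff k s f (x + s)"
        unfolding c(2) by (subst sum.atMost_Suc_shift) (simp add: algebra_simps)
      finally show ?thesis by simp
    qed
    moreover have "c' 0 = 1"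
      using c by (simp add: c'_def)
    ultimately show ?case by blast
  qed
  then obtain c where c: "c 0 = 1" "\<And>s f x. fdiff k s f x = (\<Sum>j\<le>k. c j * f (x + of_nat j * s))"
    by blast
  have "fdiff k s f x = f x - (\<Sum>j=1..k. - c j * f (x + of_nat j * s))" for s f x
    unfolding c(2) atMost_atLeast0 using c(1)
    by (subst sum.atLeast_Suc_atMost) (simp_all add: sum_negf)
  then show ?thesis
    by (intro exI[of _ "\<lambda>j. - c j"]) blast
qed

lemma fdiff_linear:
  "fdiff k s (\<lambda>y. a * f y + b * g y) x = a * fdiff k s f x + b * fdiff k s g x"
  by (induction k arbitrary: x) (simp_all add: algebra_simps)

lemma has_real_derivative_fdiff:
  assumes "\<And>j. j \<le> k \<Longrightarrow> f differentiable at (x + of_real \<tau> * s + of_nat j * s)"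
  shows "((\<lambda>\<tau>. fdiff k s f (x + of_real \<tau> * s)) has_real_derivative
    fdiff k s (\<lambda>y. Re s * partial_deriv 1 f y + Im s * partial_deriv \<i> f y) (x + of_real \<tau> * s)) (at \<tau>)"
  using assms
proof (induction k arbitrary: x)
  case 0
  define z where "z = x + of_real \<tau> * s"
  obtain f' where f': "(f has_derivative f') (at z)"
    using 0[of 0] by (auto simp: differentiable_def z_def)
  interpret f': linear f'
    using f' by (rule has_derivative_linear)
  have "f' s = f' (Re s *\<^sub>R 1 + Im s *\<^sub>R \<i>)"
    by (rule arg_cong[of _ _ f']) (simp add: complex_eq_iff)
  then have s: "f' s = Re s * partial_deriv 1 f z + Im s * partial_deriv \<i> f z"
    unfolding f'.add f'.scale partial_deriv_eq[OF f'] by simp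
  have "((\<lambda>\<tau>. f (x + of_real \<tau> * s)) has_derivative (\<lambda>h. f' (of_real h * s))) (at \<tau>)"
    by (rule has_derivative_compose[of "\<lambda>\<tau>. x + of_real \<tau> * s" "\<lambda>h. of_real h * s" \<tau> UNIV f f'])
       (use f' in \<open>auto intro!: derivative_eq_intros simp: z_def\<close>)
  moreover have "(\<lambda>h. f' (of_real h * s)) = (*) (f' s)"
    using f'.scale[of _ s] by (simp add: scaleR_conv_of_real fun_eq_iff mult.commute)
  ultimately have "((\<lambda>\<tau>. f (x + of_real \<tau> * s)) has_real_derivative f' s) (at \<tau>)"
    by (simp only: has_field_derivative_def)
  then show ?case
    unfolding s fdiff.simps z_def .
next
  case (Suc k)
  have "f differentiable at (x + s + of_real \<tau> * s + of_nat j * s)" if "j \<le> k" for j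
    using Suc.prems[of "Suc j"] that by (simp add: algebra_simps)
  note IH2 = Suc.IH[OF this]
  have IH1: "((\<lambda>\<tau>. fdiff k s f (x + of_real \<tau> * s)) has_real_derivative
    fdiff k s (\<lambda>y. Re s * partial_deriv 1 f y + Im s * partial_deriv \<i> f y) (x + of_real \<tau> * s)) (at \<tau>)"
    by (rule Suc.IH) (use Suc.prems in auto)
  have shift: "x + of_real \<tau> * s + s = x + s + of_real \<tau> * s" for \<tau>
    by simp
  show ?case
    unfolding fdiff.simps shift by (intro DERIV_diff IH1 IH2)
qed

text \<open>By the mean value theorem one difference is traded for a derivative along
  \<open>s\<close>, which supplies a factor \<open>cmod s\<close>. The mean value point moves the
  base point to \<open>x + z * s\<close>, and convexity keeps the remaining shifts in
  \<open>K\<close>.\<close>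

lemma fdiff_bound:
  assumes "C_on k U f" and U: "open U" and K: "compact K" "convex K" "K \<subseteq> U"
  shows "\<exists>C\<ge>0. \<forall>x s. x \<in> K \<longrightarrow> x + of_nat k * s \<in> K \<longrightarrow> \<bar>fdiff k s f x\<bar> \<le> C * cmod s ^ k"
  using assms(1)
proof (induction k arbitrary: f)
  case 0
  then have "continuous_on K f"
    using K continuous_on_subset by simp blast
  then have "bounded (f ` K)"
    using compact_continuous_image compact_imp_bounded K by blast
  then obtain C where "\<And>x. x \<in> K \<Longrightarrow> \<bar>f x\<bar> \<le> C"
    by (auto simp: bounded_iff)
  then have "\<forall>x s. x \<in> K \<longrightarrow> x + of_nat 0 * s \<in> K \<longrightarrow> \<bar>fdiff 0 s f x\<bar> \<le> max C 0 * cmod s ^ 0"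
    by (auto intro: max.coboundedI1)
  then show ?case
    by (intro exI[of _ "max C 0"]) simp
next
  case (Suc k)
  have diff: "f differentiable at x" if "x \<in> K" for x
    using Suc.prems K that by auto
  obtain C1 where C1: "C1 \<ge> 0"
    "\<And>x s. x \<in> K \<Longrightarrow> x + of_nat k * s \<in> K \<Longrightarrow> \<bar>fdiff k s (partial_deriv 1 f) x\<bar> \<le> C1 * cmod s ^ k"
    using Suc.IH[of "partial_deriv 1 f"] Suc.prems by auto
  obtain C2 where C2: "C2 \<ge> 0"
    "\<And>x s. x \<in> K \<Longrightarrow> x + of_nat k * s \<in> K \<Longrightarrow> \<bar>fdiff k s (partial_deriv \<i> f) x\<bar> \<le> C2 * cmod s ^ k"
    using Suc.IH[of "partial_deriv \<i> f"] Suc.prems by auto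
  have "\<bar>fdiff (Suc k) s f x\<bar> \<le> (C1 + C2) * cmod s ^ Suc k"
    if x: "x \<in> K" "x + of_nat (Suc k) * s \<in> K" for x s
  proof -
    have seg: "x + of_real \<tau> * s \<in> K" if "0 \<le> \<tau>" "\<tau> \<le> real (Suc k)" for \<tau>
    proof -
      define w where "w = \<tau> / real (Suc k)"
      have w: "0 \<le> w" "w \<le> 1" "w * real (Suc k) = \<tau>"
        using that by (auto simp: w_def)
      have "(1 - w) *\<^sub>R x + w *\<^sub>R (x + of_nat (Suc k) * s) \<in> K"
        using w x K by (intro convexD) auto
      also have "(1 - w) *\<^sub>R x + w *\<^sub>R (x + of_nat (Suc k) * s) = x + of_real (w * real (Suc k)) * s"
        by (simp add: scaleR_conv_of_real algebra_simps)
      finally show ?thesis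
        unfolding w .
    qed
    define D where "D = (\<lambda>y. Re s * partial_deriv 1 f y + Im s * partial_deriv \<i> f y)"
    have "\<exists>z>0. z < 1 \<and> fdiff k s f (x + of_real 1 * s) - fdiff k s f (x + of_real 0 * s) =
        (1 - 0) * fdiff k s D (x + of_real z * s)"
    proof (rule MVT2)
      fix \<tau> :: real assume \<tau>: "0 \<le> \<tau>" "\<tau> \<le> 1"
      show "((\<lambda>\<tau>. fdiff k s f (x + of_real \<tau> * s)) has_real_derivative
          fdiff k s D (x + of_real \<tau> * s)) (at \<tau>)"
        unfolding D_def
      proof (rule has_real_derivative_fdiff)
        fix j assume "j \<le> k"
        then show "f differentiable at (x + of_real \<tau> * s + of_nat j * s)"
          using diff[OF seg[of "\<tau> + real j"]] \<tau> by (simp add: algebra_simps)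
      qed
    qed simp
    then obtain z where z: "0 < z" "z < 1" and
      eq: "fdiff (Suc k) s f x = - fdiff k s D (x + of_real z * s)"
      by auto
    have y: "x + of_real z * s \<in> K" "x + of_real z * s + of_nat k * s \<in> K"
      using seg[of z] seg[of "z + real k"] z by (auto simp: algebra_simps)
    have "\<bar>fdiff (Suc k) s f x\<bar> \<le> \<bar>Re s\<bar> * \<bar>fdiff k s (partial_deriv 1 f) (x + of_real z * s)\<bar> +
        \<bar>Im s\<bar> * \<bar>fdiff k s (partial_deriv \<i> f) (x + of_real z * s)\<bar>"
      unfolding eq D_def fdiff_linear by (simp flip: abs_mult add: abs_triangle_ineq)
    also have "\<dots> \<le> cmod s * (C1 * cmod s ^ k) + cmod s * (C2 * cmod s ^ k)"
      using y C1 C2 by (intro add_mono mult_mono abs_Re_le_cmod abs_Im_le_cmod) auto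
    finally show ?thesis
      by (simp add: algebra_simps)
  qed
  then show ?case
    using C1 C2 by (intro exI[of _ "C1 + C2"]) auto
qed

text \<open>\<open>kern l (sin \<phi> ^ 2) = sin ((2 * l + 1) * \<phi>) / sin \<phi>\<close>, the Dirichlet kernel.\<close>

fun kern :: "nat \<Rightarrow> real \<Rightarrow> real" where
  "kern 0 \<sigma> = 1"
| "kern (Suc 0) \<sigma> = 3 - 4 * \<sigma>"
| "kern (Suc (Suc l)) \<sigma> = 2 * (1 - 2 * \<sigma>) * kern (Suc l) \<sigma> - kern l \<sigma>"

text \<open>The recursion is \<open>sin (\<theta> + 2 * \<phi>) = 2 * cos (2 * \<phi>) * sin
  \<theta> - sin (\<theta> - 2 * \<phi>)\<close>. With \<open>sin \<phi> ^ 2\<close> as the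
  variable, the kernel can be fed a squared distance and is then polynomial in the
  coordinates.\<close>

lemma kern_sin: "kern l ((sin \<phi>)\<^sup>2) * sin \<phi> = sin (real (2 * l + 1) * \<phi>)"
proof (induction l "(sin \<phi>)\<^sup>2" rule: kern.induct)
  case 2
  have "sin (3 * \<phi>) = sin (2 * \<phi> + \<phi>)"
    by simp
  also have "\<dots> = (3 - 4 * (sin \<phi>)\<^sup>2) * sin \<phi>"
  proof -
    have "cos \<phi> * cos \<phi> = 1 - (sin \<phi>)\<^sup>2"
      using sin_cos_squared_add[of \<phi>] by (simp add: power2_eq_square)
    then have "2 * sin \<phi> * cos \<phi> * cos \<phi> = 2 * sin \<phi> * (1 - (sin \<phi>)\<^sup>2)"
      by simp
    then show ?thesis
      unfolding sin_add sin_double cos_double_sin by (simp add: algebra_simps)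
  qed
  finally show ?case by simp
next
  case (3 l)
  define \<theta> where "\<theta> = real (2 * l + 3) * \<phi>"
  have "kern (Suc (Suc l)) ((sin \<phi>)\<^sup>2) * sin \<phi> =
      2 * cos (2 * \<phi>) * (kern (Suc l) ((sin \<phi>)\<^sup>2) * sin \<phi>) - kern l ((sin \<phi>)\<^sup>2) * sin \<phi>"
    unfolding cos_double_sin by (simp add: algebra_simps)
  also have "\<dots> = 2 * cos (2 * \<phi>) * sin \<theta> - sin (\<theta> - 2 * \<phi>)"
    unfolding 3 by (simp add: \<theta>_def algebra_simps)
  also have "\<dots> = sin (\<theta> + 2 * \<phi>)"
    by (simp add: sin_add sin_diff algebra_simps)
  also have "\<theta> + 2 * \<phi> = real (2 * Suc (Suc l) + 1) * \<phi>"
    by (simp add: \<theta>_def algebra_simps)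
  finally show ?case .
qed simp

lemma kern_0: "kern l 0 = real (2 * l + 1)"
  by (induction l "0::real" rule: kern.induct) auto

lemma abs_sin_mult_le: "\<bar>sin (real n * \<phi>)\<bar> \<le> real n * \<bar>sin \<phi>\<bar>"
proof (induction n)
  case (Suc n)
  have "\<bar>sin (real (Suc n) * \<phi>)\<bar> = \<bar>sin (real n * \<phi>) * cos \<phi> + cos (real n * \<phi>) * sin \<phi>\<bar>"
  proof -
    have "real (Suc n) * \<phi> = real n * \<phi> + \<phi>"
      by (simp add: algebra_simps)
    then show ?thesis
      by (simp only: sin_add)
  qed
  also have "\<dots> \<le> \<bar>sin (real n * \<phi>)\<bar> * \<bar>cos \<phi>\<bar> + \<bar>cos (real n * \<phi>)\<bar> * \<bar>sin \<phi>\<bar>"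
    by (simp flip: abs_mult add: abs_triangle_ineq)
  also have "\<dots> \<le> \<bar>sin (real n * \<phi>)\<bar> * 1 + 1 * \<bar>sin \<phi>\<bar>"
    by (intro add_mono mult_left_mono mult_right_mono abs_cos_le_one) auto
  finally show ?case
    using Suc by (simp add: algebra_simps)
qed simp

text \<open>The three regimes of the Dirichlet kernel: its height, its decay away from 0, and at
  least half of the height close to 0. The first two bound the moments of the Jackson kernel from
  above, the third its mass from below.\<close>

lemma kern_bounds:
  assumes "0 \<le> \<sigma>" "\<sigma> \<le> 1"
  shows "\<bar>kern l \<sigma>\<bar> \<le> real (2 * l + 1)"
    and "sqrt \<sigma> * \<bar>kern l \<sigma>\<bar> \<le> 1"
    and "sqrt \<sigma> \<le> 1 / (2 * real (2 * l + 1)) \<Longrightarrow> kern l \<sigma> \<ge> real (2 * l + 1) / 2"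
proof -
  define n where "n = 2 * l + 1"
  define \<phi> where "\<phi> = arcsin (sqrt \<sigma>)"
  have sqrt_bounds: "-1 \<le> sqrt \<sigma>" "sqrt \<sigma> \<le> 1"
    using assms order.trans[of "-1" 0 "sqrt \<sigma>"] by simp_all
  then have s: "sin \<phi> = sqrt \<sigma>"
    unfolding \<phi>_def by (rule sin_arcsin)
  then have \<sigma>: "(sin \<phi>)\<^sup>2 = \<sigma>"
    using assms by simp
  have kern: "kern l \<sigma> * sin \<phi> = sin (real n * \<phi>)"
    using kern_sin[of l \<phi>] unfolding \<sigma> n_def .
  show "sqrt \<sigma> * \<bar>kern l \<sigma>\<bar> \<le> 1"
  proof -
    have "sqrt \<sigma> * \<bar>kern l \<sigma>\<bar> = \<bar>kern l \<sigma> * sin \<phi>\<bar>"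
      using assms by (simp add: abs_mult s)
    then show ?thesis
      unfolding kern by simp
  qed
  show "\<bar>kern l \<sigma>\<bar> \<le> real (2 * l + 1)"
  proof (cases "\<sigma> = 0")
    case False
    then have "sin \<phi> > 0"
      using assms s by simp
    moreover have "\<bar>kern l \<sigma>\<bar> * \<bar>sin \<phi>\<bar> \<le> real n * \<bar>sin \<phi>\<bar>"
      using abs_sin_mult_le[of n \<phi>] unfolding kern[symmetric] abs_mult .
    ultimately show ?thesis
      by (simp add: n_def)
  qed (simp add: kern_0)
  assume small: "sqrt \<sigma> \<le> 1 / (2 * real (2 * l + 1))"
  show "kern l \<sigma> \<ge> real (2 * l + 1) / 2"
  proof (cases "\<sigma> = 0")
    case False
    have sin_ge: "x / 2 \<le> sin x" if "0 \<le> x" "x \<le> 1" for x :: real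
    proof (cases "x = 0")
      case False
      have "\<exists>z>0. z < x \<and> sin x - sin 0 = (x - 0) * cos z"
        using that False by (intro MVT2) (auto intro!: derivative_eq_intros)
      then obtain z where z: "0 < z" "z < x" "sin x = x * cos z"
        by auto
      \<comment> \<open>\<open>z < 1 < pi / 3\<close>, so the sine has slope at least
        \<open>1 / 2\<close> here.\<close>
      have "cos (pi / 3) \<le> cos z"
        using z that pi_gt3 by (intro cos_monotone_0_pi_le) auto
      then have "x * (1 / 2) \<le> x * cos z"
        using that by (intro mult_left_mono) (auto simp: cos_60)
      then show ?thesis using z by simp
    qed simp
    have "sqrt \<sigma> \<le> 1 / 2"
      using small by (rule order.trans) (simp add: field_simps)
    then have "\<phi> \<le> arcsin (sin (pi / 6))"
      unfolding \<phi>_def using sqrt_bounds by (intro arcsin_le_arcsin) (auto simp: sin_30)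
    also have "\<dots> = pi / 6"
      using pi_gt_zero by (intro arcsin_sin) auto
    also have "\<dots> \<le> 1"
      using pi_less_4 by simp
    finally have \<phi>1: "\<phi> \<le> 1" .
    have \<phi>0: "0 \<le> \<phi>"
      unfolding \<phi>_def using assms arcsin_le_arcsin[of 0 "sqrt \<sigma>"] by simp
    have "\<phi> \<le> 2 * sqrt \<sigma>"
      using sin_ge[OF \<phi>0 \<phi>1] s by simp
    then have "real n * \<phi> \<le> real n * (2 * (1 / (2 * real n)))"
      using small by (intro mult_left_mono) (auto simp: n_def)
    then have n\<phi>: "real n * \<phi> \<le> 1"
      by (simp add: n_def)
    have "real n * sin \<phi> / 2 \<le> real n * \<phi> / 2"
      using sin_x_le_x[OF \<phi>0] by (intro divide_right_mono mult_left_mono) auto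
    also have "\<dots> \<le> kern l \<sigma> * sin \<phi>"
      unfolding kern using sin_ge[OF _ n\<phi>] \<phi>0 by simp
    finally have "(real n / 2) * sin \<phi> \<le> kern l \<sigma> * sin \<phi>"
      by simp
    moreover have "sin \<phi> > 0"
      using False assms s by simp
    ultimately show ?thesis
      by (simp add: n_def)
  qed (simp add: kern_0)
qed

lemma param_polys_const: "(\<lambda>x y. c) \<in> param_polys N"
  by (rule param_polys_coeff) simp

lemma param_polys_cmult: "F \<in> param_polys N \<Longrightarrow> (\<lambda>x y. c * F x y) \<in> param_polys N"
  by (rule param_polys_mult_coeff) auto

lemma param_polys_diff:
  "F \<in> param_polys N \<Longrightarrow> G \<in> param_polys N \<Longrightarrow> (\<lambda>x y. F x y - G x y) \<in> param_polys N"
  using param_polys_add[OF _ param_polys_cmult[of G N "-1"]] by simp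

lemma param_polys_kern:
  assumes F: "F \<in> param_polys 2"
  shows "(\<lambda>x y. kern l (F x y)) \<in> param_polys (2 * l)"
proof (induction l "0::real" rule: kern.induct)
  case 1
  then show ?case by (simp add: param_polys_const)
next
  case 2
  then show ?case
    using param_polys_diff[OF param_polys_const param_polys_cmult[OF F], of 3 4] by simp
next
  case (3 l)
  have "(\<lambda>x y. 2 * (1 - 2 * F x y)) \<in> param_polys 2"
    by (intro param_polys_cmult param_polys_diff param_polys_const F)
  from param_polys_diff[OF param_polys_mult[OF this 3(1)]] param_polys_mono[OF 3(2)]
  show ?case
    by (simp add: numeral_eq_Suc)
qed

lemma param_polys_dist:
  "(\<lambda>x y. c * (cmod (y - x))\<^sup>2) \<in> param_polys 2"
proof -
  have "(\<lambda>x y. c * ((Re y - Re x) ^ 2 + (Im y - Im x) ^ 2)) \<in> param_polys (2 * 1)"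
    by (intro param_polys_cmult param_polys_add param_polys_power param_polys_diff param_polys_Re param_polys_Im
        param_polys_coeff continuous_intros)
  then show ?thesis
    by (simp add: cmod_power2)
qed

lemma continuous_on_kern: "continuous_on S g \<Longrightarrow> continuous_on S (\<lambda>x. kern l (g x))"
  by (induction l "0::real" rule: kern.induct) (auto intro!: continuous_intros)

section \<open>Set integrals and approximation by convolution\<close>

lemma compact_set_integrable:
  fixes g :: "complex \<Rightarrow> real"
  assumes "compact S" "continuous_on S g"
  shows "set_integrable lborel S g"
  unfolding set_integrable_def by (rule borel_integrable_compact[OF assms])

lemma abs_set_integral_le:
  fixes g :: "complex \<Rightarrow> real"
  assumes "set_integrable lborel S g" "set_integrable lborel S h" "\<And>x. x \<in> S \<Longrightarrow> \<bar>g x\<bar> \<le> h x"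
  shows "\<bar>\<integral>x\<in>S. g x \<partial>lborel\<bar> \<le> (\<integral>x\<in>S. h x \<partial>lborel)"
proof -
  have "\<bar>\<integral>x\<in>S. g x \<partial>lborel\<bar> \<le> (\<integral>x. \<bar>indicator S x *\<^sub>R g x\<bar> \<partial>lborel)"
    unfolding set_lebesgue_integral_def by (rule integral_abs_bound)
  also have "\<dots> \<le> (\<integral>x\<in>S. h x \<partial>lborel)"
    unfolding set_lebesgue_integral_def using assms
    by (intro integral_mono) (auto simp: set_integrable_def indicator_def)
  finally show ?thesis .
qed

lemma set_integral_subset_mono:
  fixes h :: "complex \<Rightarrow> real"
  assumes "set_integrable lborel T h" "S \<in> sets lborel" "S \<subseteq> T" "\<And>x. x \<in> T \<Longrightarrow> 0 \<le> h x"
  shows "(\<integral>x\<in>S. h x \<partial>lborel) \<le> (\<integral>x\<in>T. h x \<partial>lborel)"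
  unfolding set_lebesgue_integral_def using set_integrable_subset[OF assms(1-3)] assms
  by (intro integral_mono) (auto simp: set_integrable_def indicator_def)

text \<open>Substitution \<open>y = x + j * s\<close>; the Jacobian is \<open>j^2\<close> since the
  plane has real dimension two.\<close>

lemma set_integral_affine_complex:
  fixes h :: "complex \<Rightarrow> real"
  assumes j: "j > 0" and h: "set_integrable lborel (cball 0 R) h"
  shows "(\<integral>y\<in>cball 0 R. h y \<partial>lborel) =
           j\<^sup>2 * (\<integral>s\<in>cball (- x /\<^sub>R j) (R / j). h (x + j *\<^sub>R s) \<partial>lborel)"
proof -
  define g where "g y = indicator (cball 0 R) y *\<^sub>R h y" for y
  have "integrable lborel g"
    using h unfolding g_def set_integrable_def .
  from borel_measurable_integrable[OF this] have [measurable]: "g \<in> borel_measurable borel"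
    by simp
  have "(\<integral>y. g y \<partial>lborel) =
      (\<integral>y. g y \<partial>density (distr lborel borel (\<lambda>s. x + j *\<^sub>R s)) (\<lambda>_. ennreal (j\<^sup>2)))"
    using lborel_affine[of j x] j by simp
  also have "\<dots> = (\<integral>y. j\<^sup>2 * g y \<partial>distr lborel borel (\<lambda>s. x + j *\<^sub>R s))"
    by (subst integral_density) auto
  also have "\<dots> = j\<^sup>2 * (\<integral>s. g (x + j *\<^sub>R s) \<partial>lborel)"
    by (subst integral_distr) auto
  also have "(\<lambda>s. g (x + j *\<^sub>R s)) = (\<lambda>s. indicator (cball (- x /\<^sub>R j) (R / j)) s *\<^sub>R h (x + j *\<^sub>R s))"
  proof
    fix s
    have "cmod (x + j *\<^sub>R s) = j * cmod (x /\<^sub>R j + s)"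
    proof -
      have "x + j *\<^sub>R s = j *\<^sub>R (x /\<^sub>R j + s)"
        using j by (simp add: scaleR_add_right)
      then show ?thesis
        using j by (simp only: norm_scaleR)
    qed
    moreover have "cmod (- x /\<^sub>R j - s) = cmod (x /\<^sub>R j + s)"
      using norm_minus_cancel[of "x /\<^sub>R j + s"] by simp
    ultimately have "x + j *\<^sub>R s \<in> cball 0 R \<longleftrightarrow> s \<in> cball (- x /\<^sub>R j) (R / j)"
      unfolding mem_cball_0 unfolding mem_cball dist_norm
      using j by (simp only: pos_le_divide_eq mult.commute)
    then show "g (x + j *\<^sub>R s) = indicator (cball (- x /\<^sub>R j) (R / j)) s *\<^sub>R h (x + j *\<^sub>R s)"
      by (simp add: g_def indicator_def)
  qed
  finally show ?thesis
    by (simp add: set_lebesgue_integral_def g_def)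
qed

text \<open>
  The approximant is \<open>\<Sum>j=1..k. b j * (\<integral>s. f (x + j * s) * K s)\<close>, cut off to the points \<open>x + j * s\<close> in the
  ball of radius \<open>1 + \<delta>\<close>; by \<open>fdiff_expansion\<close> it differs from \<open>f x\<close> by an integral of
  \<open>fdiff k s f x * K s\<close>, up to the tail of \<open>K\<close>.
\<close>

lemma kernel_approximation:
  assumes f: "f \<in> C_disk k"
  shows "\<exists>C\<ge>0. \<exists>\<eta>>0. \<eta> \<le> 1 \<and> (\<forall>K N. continuous_on UNIV K \<longrightarrow> (\<forall>s. 0 \<le> K s) \<longrightarrow>
           (\<forall>c. (\<lambda>x y. K (c *\<^sub>R (y - x))) \<in> param_polys N) \<longrightarrow>
           (\<integral>s\<in>cball 0 \<eta>. K s \<partial>lborel) > 0 \<longrightarrow>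
           (\<exists>P\<in>polys2 N. \<forall>x\<in>unit_disk. \<bar>f x - P x\<bar> \<le>
              C * (\<integral>s\<in>cball 0 3. cmod s ^ k * K s \<partial>lborel) / (\<integral>s\<in>cball 0 \<eta>. K s \<partial>lborel)))"
proof -
  obtain U where U: "open U" "unit_disk \<subseteq> U" "C_on k U f"
    using f by (auto simp: C_disk_def)
  obtain \<epsilon> where \<epsilon>: "\<epsilon> > 0" "(\<Union>x\<in>unit_disk. cball x \<epsilon>) \<subseteq> U"
    using compact_subset_open_imp_cball_epsilon_subset[of unit_disk U] U by auto
  define \<delta> where "\<delta> = min \<epsilon> 1"
  have \<delta>: "0 < \<delta>" "\<delta> \<le> 1"
    using \<epsilon> by (auto simp: \<delta>_def)
  define B :: "complex set" where "B = cball 0 (1 + \<delta>)"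
  have BU: "B \<subseteq> U"
  proof
    fix y assume y: "y \<in> B"
    \<comment> \<open>The point of the unit disk nearest to \<open>y\<close>.\<close>
    define x where "x = y /\<^sub>R max 1 (cmod y)"
    have x: "cmod x \<le> 1"
      by (simp add: x_def field_simps)
    have "y - x = (1 - 1 / max 1 (cmod y)) *\<^sub>R y"
      by (simp add: x_def scaleR_diff_left divide_inverse)
    moreover have "0 \<le> 1 - 1 / max 1 (cmod y)"
      by (simp add: field_simps)
    ultimately have "cmod (y - x) = (1 - 1 / max 1 (cmod y)) * cmod y"
      by (simp only: norm_scaleR abs_of_nonneg)
    then have "cmod (y - x) \<le> \<epsilon>"
    proof (cases "cmod y \<le> 1")
      case True
      then have "max 1 (cmod y) = 1" by simp
      with \<open>cmod (y - x) = _\<close> show ?thesis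
        using \<epsilon> by simp
    next
      case False
      then have "max 1 (cmod y) = cmod y" by simp
      moreover have "y \<noteq> 0"
        using False by auto
      ultimately have "cmod (y - x) = cmod y - 1"
        using \<open>cmod (y - x) = _\<close> by (simp add: left_diff_distrib)
      then show ?thesis
        using y by (simp add: B_def \<delta>_def)
    qed
    with x have "y \<in> (\<Union>x\<in>unit_disk. cball x \<epsilon>)"
      by (intro UN_I[of x]) (auto simp: dist_norm norm_minus_commute)
    then show "y \<in> U"
      using \<epsilon>(2) by blast
  qed
  have B: "compact B" "convex B"
    by (auto simp: B_def)
  have f_cont: "continuous_on B f"
  proof (cases k)
    case 0
    then show ?thesis using U BU continuous_on_subset by simp blast
  next
    case (Suc m)
    then have "f differentiable_on B"
      using U BU by (auto simp: differentiable_on_def intro: differentiable_at_withinI)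
    then show ?thesis
      by (rule differentiable_imp_continuous_on)
  qed
  obtain M where M: "M \<ge> 0" "\<And>x. x \<in> B \<Longrightarrow> \<bar>f x\<bar> \<le> M"
  proof -
    have "bounded (f ` B)"
      using compact_continuous_image[OF f_cont] compact_imp_bounded B by blast
    then obtain C where "\<And>x. x \<in> B \<Longrightarrow> \<bar>f x\<bar> \<le> C"
      by (auto simp: bounded_iff)
    then show thesis
      by (intro that[of "max C 0"]) (auto intro: max.coboundedI1)
  qed
  obtain C0 where C0: "C0 \<ge> 0"
    "\<And>x s. x \<in> B \<Longrightarrow> x + of_nat k * s \<in> B \<Longrightarrow> \<bar>fdiff k s f x\<bar> \<le> C0 * cmod s ^ k"
    using fdiff_bound[OF U(3,1) B BU] by blast
  obtain b where b: "\<And>s f x. fdiff k s f x = f x - (\<Sum>j=1..k. b j * f (x + of_nat j * s))"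
    using fdiff_expansion by blast
  \<comment> \<open>So small that \<open>x + j * s\<close> stays in \<open>B\<close> for all
    \<open>j \<le> k\<close> whenever \<open>cmod s \<le> \<eta>\<close>.\<close>
  define \<eta> where "\<eta> = \<delta> / real (Suc k)"
  have \<eta>: "0 < \<eta>" "\<eta> \<le> 1" "real k * \<eta> \<le> \<delta>"
    using \<delta> by (auto simp: \<eta>_def field_simps)
  \<comment> \<open>\<open>C0\<close> accounts for the differences on \<open>cball 0 \<eta>\<close>,
    the sum for the tail, where \<open>1 \<le> cmod s ^ k / \<eta> ^ k\<close> turns the bound
    \<open>M\<close> into a \<open>k\<close>-th moment.\<close>
  define C where "C = C0 + (\<Sum>j=1..k. \<bar>b j\<bar> * (M / \<eta> ^ k))"
  have C: "C \<ge> 0"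
    unfolding C_def using C0 M \<eta> by (intro add_nonneg_nonneg sum_nonneg) auto
  show ?thesis
  proof (rule exI[of _ C], rule conjI[OF C], rule exI[of _ \<eta>], intro conjI allI impI \<eta>(1,2))
    fix K N
    assume K: "continuous_on UNIV K" "\<forall>s. 0 \<le> K s"
      and poly: "\<forall>c. (\<lambda>x y. K (c *\<^sub>R (y - x))) \<in> param_polys N"
      and c_pos: "(\<integral>s\<in>cball 0 \<eta>. K s \<partial>lborel) > 0"
    define c where "c = (\<integral>s\<in>cball 0 \<eta>. K s \<partial>lborel)"
    define I where "I = (\<integral>s\<in>cball 0 3. cmod s ^ k * K s \<partial>lborel)"
    have K_cont: "continuous_on S K" for S
      using K(1) by (rule continuous_on_subset) simp
    \<comment> \<open>In the variable \<open>y = x + j * s\<close> the point \<open>x\<close> occurs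
      only in the kernel, which it enters polynomially; \<open>c\<close> normalises the mass and
      \<open>(real j)^2\<close> undoes the Jacobian.\<close>
    define P where "P x = (\<Sum>j=1..k. b j / (c * (real j)\<^sup>2) * (\<integral>y\<in>B. f y * K ((1 / real j) *\<^sub>R (y - x)) \<partial>lborel))" for x
    have "P \<in> polys2 N"
      unfolding P_def[abs_def] using B poly f_cont
      by (intro polys2_sum polys2_cmult integral_param_polys[of "\<lambda>x y. K (_ *\<^sub>R (y - x))"]) (auto simp: B_def)
    moreover have "\<bar>f x - P x\<bar> \<le> C * I / c" if x: "x \<in> unit_disk" for x
    proof -
      have xB: "x \<in> B"
        using x \<delta> by (auto simp: B_def)
      \<comment> \<open>The ball \<open>B\<close> in the variable \<open>s\<close>. It lies in
        \<open>cball 0 3\<close>, as 3 bounds \<open>1 + \<delta> + cmod x\<close>.\<close>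
      define T where "T j = cball (- x /\<^sub>R real j) ((1 + \<delta>) / real j)" for j :: nat
      have T_iff: "s \<in> T j \<longleftrightarrow> x + of_nat j * s \<in> B" if "j \<ge> 1" for s j
      proof -
        have "cmod (x + of_nat j * s) = real j * cmod (- x /\<^sub>R real j - s)"
        proof -
          have "x + real j *\<^sub>R s = - (real j *\<^sub>R (- x /\<^sub>R real j - s))"
            using that by (simp add: scaleR_diff_right)
          then have "x + of_nat j * s = - (real j *\<^sub>R (- x /\<^sub>R real j - s))"
            by (simp add: scaleR_conv_of_real)
          then show ?thesis
            by (simp only: norm_minus_cancel norm_scaleR abs_of_nat)
        qed
        then show ?thesis
          unfolding T_def B_def mem_cball_0 unfolding mem_cball dist_norm
          using that by (simp add: pos_le_divide_eq mult.commute)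
      qed
      have sub: "cball 0 \<eta> \<subseteq> T j" "T j \<subseteq> cball 0 3" if j: "j \<in> {1..k}" for j
      proof -
        have jB: "cmod (x + of_nat j * s) \<le> 1 + \<delta>" if "cmod s \<le> \<eta>" for s
        proof -
          have "cmod (x + of_nat j * s) \<le> cmod x + real j * cmod s"
            by (rule norm_triangle_le) (simp add: norm_mult)
          also have "real j * cmod s \<le> real k * \<eta>"
            using j that by (intro mult_mono) auto
          finally show ?thesis
            using x \<eta>(3) by simp
        qed
        then show "cball 0 \<eta> \<subseteq> T j"
          using j T_iff by (auto simp: B_def)
        show "T j \<subseteq> cball 0 3"
        proof
          fix s assume "s \<in> T j"
          then have "cmod (x + of_nat j * s) \<le> 2"
            using T_iff[of j s] j \<delta> by (auto simp: B_def)
          moreover have "real j * cmod s \<le> cmod (x + of_nat j * s) + cmod x"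
            using norm_triangle_ineq4[of "x + of_nat j * s" x] by (simp add: norm_mult)
          moreover have "1 * cmod s \<le> real j * cmod s"
            using j by (intro mult_right_mono) auto
          ultimately show "s \<in> cball 0 3"
            using x by simp
        qed
      qed
      have fj_cont: "continuous_on (T j) (\<lambda>s. f (x + of_nat j * s))" if "j \<in> {1..k}" for j
        using that T_iff by (intro continuous_on_compose2[OF f_cont]) (auto intro!: continuous_intros)
      have int_T: "set_integrable lborel (T j) (\<lambda>s. f (x + of_nat j * s) * K s)" if "j \<in> {1..k}" for j
        by (rule compact_set_integrable) (auto simp: T_def[symmetric] intro!: continuous_intros fj_cont[OF that] K_cont, simp add: T_def)
      have int_\<eta>: "set_integrable lborel (cball 0 \<eta>) (\<lambda>s. f (x + of_nat j * s) * K s)" if "j \<in> {1..k}" for j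
        by (rule set_integrable_subset[OF int_T[OF that]]) (use sub[OF that] in auto)
      have int_rest: "set_integrable lborel (T j - cball 0 \<eta>) (\<lambda>s. f (x + of_nat j * s) * K s)" if "j \<in> {1..k}" for j
        by (rule set_integrable_subset[OF int_T[OF that]]) (auto simp: T_def)
      have int_K: "set_integrable lborel (cball 0 3) (\<lambda>s. cmod s ^ k * K s)"
        by (rule compact_set_integrable) (auto intro!: continuous_intros K_cont)
      have P_eq: "P x = (\<Sum>j=1..k. b j / c * (\<integral>s\<in>T j. f (x + of_nat j * s) * K s \<partial>lborel))"
        unfolding P_def
      proof (intro sum.cong refl)
        fix j assume j: "j \<in> {1..k}"
        have "(\<integral>y\<in>B. f y * K ((1 / real j) *\<^sub>R (y - x)) \<partial>lborel) =
            (real j)\<^sup>2 * (\<integral>s\<in>T j. f (x + real j *\<^sub>R s) * K ((1 / real j) *\<^sub>R ((x + real j *\<^sub>R s) - x)) \<partial>lborel)"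
          unfolding B_def T_def
        proof (rule set_integral_affine_complex)
          show "set_integrable lborel (cball 0 (1 + \<delta>)) (\<lambda>y. f y * K ((1 / real j) *\<^sub>R (y - x)))"
            using f_cont by (intro compact_set_integrable continuous_intros continuous_on_compose2[OF K(1)])
              (auto simp: B_def)
        qed (use j in auto)
        then show "b j / (c * (real j)\<^sup>2) * (\<integral>y\<in>B. f y * K ((1 / real j) *\<^sub>R (y - x)) \<partial>lborel) =
            b j / c * (\<integral>s\<in>T j. f (x + of_nat j * s) * K s \<partial>lborel)"
          using j by (simp add: scaleR_conv_of_real)
      qed
      define R where "R j = (\<integral>s\<in>T j - cball 0 \<eta>. f (x + of_nat j * s) * K s \<partial>lborel)" for j
      have split: "(\<integral>s\<in>T j. f (x + of_nat j * s) * K s \<partial>lborel) =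
          (\<integral>s\<in>cball 0 \<eta>. f (x + of_nat j * s) * K s \<partial>lborel) + R j" if j: "j \<in> {1..k}" for j
      proof -
        have "T j = cball 0 \<eta> \<union> (T j - cball 0 \<eta>)"
          using sub[OF j] by auto
        then have "(\<integral>s\<in>T j. f (x + of_nat j * s) * K s \<partial>lborel) =
            (\<integral>s\<in>cball 0 \<eta> \<union> (T j - cball 0 \<eta>). f (x + of_nat j * s) * K s \<partial>lborel)"
          by simp
        also have "\<dots> = (\<integral>s\<in>cball 0 \<eta>. f (x + of_nat j * s) * K s \<partial>lborel) + R j"
          unfolding R_def by (rule set_integral_Un) (use int_\<eta>[OF j] int_rest[OF j] in auto)
        finally show ?thesis .
      qed
      have main: "c * f x - (\<Sum>j=1..k. b j * (\<integral>s\<in>cball 0 \<eta>. f (x + of_nat j * s) * K s \<partial>lborel)) =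
          (\<integral>s\<in>cball 0 \<eta>. fdiff k s f x * K s \<partial>lborel)"
      proof -
        have "(\<integral>s\<in>cball 0 \<eta>. (\<Sum>j=1..k. b j * (f (x + of_nat j * s) * K s)) \<partial>lborel) =
            (\<Sum>j=1..k. \<integral>s\<in>cball 0 \<eta>. b j * (f (x + of_nat j * s) * K s) \<partial>lborel)"
          unfolding set_lebesgue_integral_def scaleR_sum_right
          by (rule Bochner_Integration.integral_sum)
             (use set_integrable_mult_right[OF int_\<eta>] in \<open>auto simp: set_integrable_def\<close>)
        moreover have "(\<integral>s\<in>cball 0 \<eta>. f x * K s - (\<Sum>j=1..k. b j * (f (x + of_nat j * s) * K s)) \<partial>lborel) =
            (\<integral>s\<in>cball 0 \<eta>. f x * K s \<partial>lborel) -
            (\<integral>s\<in>cball 0 \<eta>. (\<Sum>j=1..k. b j * (f (x + of_nat j * s) * K s)) \<partial>lborel)"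
        proof (rule set_integral_diff(2))
          show "set_integrable lborel (cball 0 \<eta>) (\<lambda>s. f x * K s)"
            by (rule compact_set_integrable) (auto intro!: continuous_intros K_cont)
          show "set_integrable lborel (cball 0 \<eta>) (\<lambda>s. \<Sum>j=1..k. b j * (f (x + of_nat j * s) * K s))"
            unfolding set_integrable_def scaleR_sum_right
            by (rule Bochner_Integration.integrable_sum)
               (use set_integrable_mult_right[OF int_\<eta>] in \<open>auto simp: set_integrable_def\<close>)
        qed
        ultimately show ?thesis
          unfolding b c_def by (simp add: left_diff_distrib sum_distrib_right mult.assoc)
      qed
      have fdiff_le: "\<bar>\<integral>s\<in>cball 0 \<eta>. fdiff k s f x * K s \<partial>lborel\<bar> \<le> C0 * I"
      proof -
        have "\<bar>\<integral>s\<in>cball 0 \<eta>. fdiff k s f x * K s \<partial>lborel\<bar> \<le> (\<integral>s\<in>cball 0 \<eta>. C0 * (cmod s ^ k * K s) \<partial>lborel)"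
        proof (rule abs_set_integral_le)
          have "continuous_on (cball 0 \<eta>) (\<lambda>s. f (x + of_nat j * s))" if "j \<in> {1..k}" for j
            using fj_cont[OF that] sub(1)[OF that] by (rule continuous_on_subset)
          then show "set_integrable lborel (cball 0 \<eta>) (\<lambda>s. fdiff k s f x * K s)"
            unfolding b by (intro compact_set_integrable continuous_intros K_cont) auto
          show "set_integrable lborel (cball 0 \<eta>) (\<lambda>s. C0 * (cmod s ^ k * K s))"
            by (intro compact_set_integrable continuous_intros K_cont) auto
          fix s :: complex assume s: "s \<in> cball 0 \<eta>"
          have "x + of_nat k * s \<in> B"
          proof (cases "k = 0")
            case False
            then have "s \<in> T k"
              using sub(1)[of k] s by auto
            then show ?thesis
              using T_iff[of k s] False by simp
          qed (use xB in simp)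
          then have "\<bar>fdiff k s f x\<bar> * K s \<le> C0 * cmod s ^ k * K s"
            using C0(2)[OF xB] K by (intro mult_right_mono) auto
          then show "\<bar>fdiff k s f x * K s\<bar> \<le> C0 * (cmod s ^ k * K s)"
            using K by (simp add: abs_mult mult.assoc)
        qed
        also have "\<dots> = C0 * (\<integral>s\<in>cball 0 \<eta>. cmod s ^ k * K s \<partial>lborel)"
          by simp
        also have "\<dots> \<le> C0 * I"
          unfolding I_def using C0(1) K \<eta>
          by (intro mult_left_mono set_integral_subset_mono int_K) auto
        finally show ?thesis .
      qed
      have R_le: "\<bar>R j\<bar> \<le> M / \<eta> ^ k * I" if j: "j \<in> {1..k}" for j
      proof -
        have int: "set_integrable lborel (T j - cball 0 \<eta>) (\<lambda>s. cmod s ^ k * K s)"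
          by (rule set_integrable_subset[OF int_K]) (use sub[OF j] in \<open>auto simp: T_def\<close>)
        have "\<bar>R j\<bar> \<le> (\<integral>s\<in>T j - cball 0 \<eta>. M / \<eta> ^ k * (cmod s ^ k * K s) \<partial>lborel)"
          unfolding R_def
        proof (rule abs_set_integral_le[OF int_rest[OF j]])
          show "set_integrable lborel (T j - cball 0 \<eta>) (\<lambda>s. M / \<eta> ^ k * (cmod s ^ k * K s))"
            by (rule set_integrable_mult_right) (rule int)
          fix s assume s: "s \<in> T j - cball 0 \<eta>"
          then have "\<eta> ^ k \<le> cmod s ^ k"
            using \<eta> by (intro power_mono) auto
          then have "M * 1 \<le> M * (cmod s ^ k / \<eta> ^ k)"
            using M \<eta> by (intro mult_left_mono) auto
          moreover have "\<bar>f (x + of_nat j * s)\<bar> \<le> M"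
            using s T_iff[of j s] j M(2) by auto
          ultimately have "\<bar>f (x + of_nat j * s)\<bar> * K s \<le> M * (cmod s ^ k / \<eta> ^ k) * K s"
            using K by (intro mult_right_mono) auto
          then show "\<bar>f (x + of_nat j * s) * K s\<bar> \<le> M / \<eta> ^ k * (cmod s ^ k * K s)"
            using K by (simp add: abs_mult)
        qed
        also have "\<dots> = M / \<eta> ^ k * (\<integral>s\<in>T j - cball 0 \<eta>. cmod s ^ k * K s \<partial>lborel)"
          by (rule set_integral_mult_right)
        also have "\<dots> \<le> M / \<eta> ^ k * I"
          unfolding I_def using M \<eta> K sub[OF j]
          by (intro mult_left_mono set_integral_subset_mono int_K) (auto simp: T_def)
        finally show ?thesis .
      qed
      have "c * (f x - P x) = c * f x - (\<Sum>j=1..k. b j * (\<integral>s\<in>T j. f (x + of_nat j * s) * K s \<partial>lborel))"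
        unfolding P_eq using c_pos c_def by (simp add: right_diff_distrib sum_distrib_left)
      also have "\<dots> = (\<integral>s\<in>cball 0 \<eta>. fdiff k s f x * K s \<partial>lborel) - (\<Sum>j=1..k. b j * R j)"
        unfolding main[symmetric] by (simp add: split distrib_left sum.distrib)
      finally have "\<bar>c * (f x - P x)\<bar> \<le> \<bar>\<integral>s\<in>cball 0 \<eta>. fdiff k s f x * K s \<partial>lborel\<bar> + \<bar>\<Sum>j=1..k. b j * R j\<bar>"
        by simp
      also have "\<bar>\<Sum>j=1..k. b j * R j\<bar> \<le> (\<Sum>j=1..k. \<bar>b j * R j\<bar>)"
        by (rule sum_abs)
      also have "(\<Sum>j=1..k. \<bar>b j * R j\<bar>) \<le> (\<Sum>j=1..k. \<bar>b j\<bar> * (M / \<eta> ^ k * I))"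
        unfolding abs_mult by (intro sum_mono mult_left_mono R_le) auto
      also have "\<bar>\<integral>s\<in>cball 0 \<eta>. fdiff k s f x * K s \<partial>lborel\<bar> + (\<Sum>j=1..k. \<bar>b j\<bar> * (M / \<eta> ^ k * I)) \<le> C * I"
        using fdiff_le by (simp add: C_def distrib_right sum_distrib_right mult.assoc)
      finally have "c * \<bar>f x - P x\<bar> \<le> C * I"
        using c_pos by (simp add: abs_mult c_def)
      then show ?thesis
        using c_pos by (simp add: c_def pos_le_divide_eq mult.commute)
    qed
    ultimately have "\<exists>P\<in>polys2 N. \<forall>x\<in>unit_disk. \<bar>f x - P x\<bar> \<le> C * I / c"
      by blast
    then show "\<exists>P\<in>polys2 N. \<forall>x\<in>unit_disk. \<bar>f x - P x\<bar> \<le>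
        C * (\<integral>s\<in>cball 0 3. cmod s ^ k * K s \<partial>lborel) / (\<integral>s\<in>cball 0 \<eta>. K s \<partial>lborel)"
      unfolding I_def c_def .
  qed
qed

section \<open>The Jackson kernel and its moments\<close>

lemma power_split: "a = b + c \<Longrightarrow> x ^ a = x ^ b * (x ^ c :: 'a::monoid_mult)"
  by (simp add: power_add)

lemma nn_integral_inverse_quadratic_le: "(\<integral>\<^sup>+x. ennreal (1 / (1 + (n * x)\<^sup>2)) * indicator {-3..3} x \<partial>lborel) \<le> ennreal (pi / n)"
  if n: "n > 0" for n :: real
proof -
  have "(\<integral>\<^sup>+x. ennreal (1 / (1 + (n * x)\<^sup>2)) * indicator {-3..3} x \<partial>lborel) =
      ennreal (arctan (n * 3) / n - arctan (n * (-3)) / n)"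
  proof (rule nn_integral_FTC_Icc)
    show "((\<lambda>x. arctan (n * x) / n) has_real_derivative 1 / (1 + (n * x)\<^sup>2)) (at x)" for x
    proof -
      have "((\<lambda>x. arctan (n * x)) has_real_derivative inverse (1 + (n * x)\<^sup>2) * n) (at x)"
        by (auto intro!: derivative_eq_intros)
      from DERIV_cdivide[OF this, of n] show ?thesis
        using n by (simp add: inverse_eq_divide)
    qed
  qed (use n in \<open>auto intro!: add_nonneg_nonneg\<close>)
  also have "arctan (n * 3) / n - arctan (n * (-3)) / n \<le> pi / n"
    unfolding diff_divide_distrib[symmetric]
    using arctan_ubound[of "n * 3"] arctan_lbound[of "n * (-3)"] n
    by (intro divide_right_mono) auto
  finally show ?thesis
    using ennreal_leI by blast
qed

text \<open>The ball is enlarged to a square, over which the integrand is a product of functions of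
  one coordinate each; Tonelli's theorem and the arctangent finish the estimate.\<close>

lemma set_integral_inverse_quadratic_le:
  assumes n: "n > 0"
  shows "(\<integral>s\<in>cball 0 3. 1 / ((1 + (n * Re s)\<^sup>2) * (1 + (n * Im s)\<^sup>2)) \<partial>lborel) \<le> (pi / n)\<^sup>2"
proof -
  define g where "g x = 1 / (1 + (n * x)\<^sup>2) * indicator {-3..3} x" for x :: real
  define h where "h s = 1 / ((1 + (n * Re s)\<^sup>2) * (1 + (n * Im s)\<^sup>2))" for s
  have pos: "1 + (n * x)\<^sup>2 > 0" for x
    by (rule add_pos_nonneg) auto
  then have nz: "1 + (n * x)\<^sup>2 \<noteq> 0" for x
    by (metis less_irrefl)
  have g0: "0 \<le> g x" for x
    using pos[of x] by (simp add: g_def)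
  have h0: "0 \<le> h x" for x
    using pos[of "Re x"] pos[of "Im x"] by (simp add: h_def)
  have h_cont: "continuous_on S h" for S
    unfolding h_def using nz by (intro continuous_intros ballI) (simp only: mult_eq_0_iff, blast)
  have "ennreal (\<integral>s\<in>cball 0 3. h s \<partial>lborel) = (\<integral>\<^sup>+s. ennreal (indicator (cball 0 3) s * h s) \<partial>lborel)"
  proof -
    have "integrable lborel (\<lambda>s. indicator (cball 0 3) s *\<^sub>R h s)"
      by (rule borel_integrable_compact) (auto intro: h_cont)
    then show ?thesis
      unfolding set_lebesgue_integral_def using h0
      by (subst nn_integral_eq_integral) auto
  qed
  also have "\<dots> \<le> (\<integral>\<^sup>+(s::complex). (\<Prod>b\<in>Basis. ennreal (g (s \<bullet> b))) \<partial>lborel)"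
  proof (rule nn_integral_mono)
    fix s :: complex
    have "indicator (cball 0 3) s * h s \<le> g (Re s) * g (Im s)"
      using abs_Re_le_cmod[of s] abs_Im_le_cmod[of s] h0[of s] g0
      by (auto simp: indicator_def g_def h_def)
    then have "ennreal (indicator (cball 0 3) s * h s) \<le> ennreal (g (Re s) * g (Im s))"
      by (rule ennreal_leI)
    also have "\<dots> = (\<Prod>b\<in>Basis. ennreal (g (s \<bullet> b)))"
      using g0 by (simp add: Basis_complex_def ennreal_mult)
    finally show "ennreal (indicator (cball 0 3) s * h s) \<le> (\<Prod>b\<in>Basis. ennreal (g (s \<bullet> b)))" .
  qed
  also have "\<dots> = (\<Prod>b\<in>(Basis::complex set). (\<integral>\<^sup>+x. ennreal (g x) \<partial>lborel))"
    by (rule nn_integral_lborel_prod) (auto simp: g_def)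
  also have "\<dots> = (\<integral>\<^sup>+x. ennreal (g x) \<partial>lborel)\<^sup>2"
    by (simp add: Basis_complex_def power2_eq_square)
  also have "(\<integral>\<^sup>+x. ennreal (g x) \<partial>lborel) = (\<integral>\<^sup>+x. ennreal (1 / (1 + (n * x)\<^sup>2)) * indicator {-3..3} x \<partial>lborel)"
    by (intro nn_integral_cong) (auto simp: g_def indicator_def)
  also have "\<dots>\<^sup>2 \<le> (ennreal (pi / n))\<^sup>2"
    by (intro power_mono nn_integral_inverse_quadratic_le n) auto
  also have "\<dots> = ennreal ((pi / n)\<^sup>2)"
    using n by (simp add: ennreal_power)
  finally show ?thesis
    unfolding h_def[symmetric] by (simp add: ennreal_le_iff)
qed

lemma content_cball_complex: "r \<ge> 0 \<Longrightarrow> measure lborel (cball (0::complex) r) = pi * r\<^sup>2"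
  using content_cball[of r "0::complex"] by (simp add: unit_ball_vol_2)

text \<open>An even power of the Dirichlet kernel, made radial. Division by 3 keeps the argument of
  \<open>kern\<close> in \<open>{0..1}\<close> on \<open>cball 0 3\<close>. With exponent
  \<open>2 * k + 4\<close> the product with \<open>cmod s ^ k\<close> still decays like the power
  \<open>- (k + 4)\<close> of \<open>cmod s\<close>, which leaves room for an integrable
  majorant.\<close>

definition jackson_kernel :: "nat \<Rightarrow> nat \<Rightarrow> complex \<Rightarrow> real" where
  "jackson_kernel k l s = kern l ((cmod s / 3)\<^sup>2) ^ (2 * k + 4)"

lemma jackson_kernel_nonneg: "0 \<le> jackson_kernel k l s"
  unfolding jackson_kernel_def by (rule zero_le_even_power) simp

lemma continuous_on_jackson_kernel: "continuous_on S (jackson_kernel k l)"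
  unfolding jackson_kernel_def by (intro continuous_intros continuous_on_kern) auto

lemma param_polys_jackson_kernel:
  "(\<lambda>x y. jackson_kernel k l (c *\<^sub>R (y - x))) \<in> param_polys ((2 * k + 4) * (2 * l))"
proof -
  have "(\<lambda>x y. kern l (c\<^sup>2 / 9 * (cmod (y - x))\<^sup>2) ^ (2 * k + 4)) \<in> param_polys ((2 * k + 4) * (2 * l))"
    by (intro param_polys_power param_polys_kern param_polys_dist)
  then show ?thesis
    by (simp add: jackson_kernel_def power_divide power_mult_distrib)
qed

text \<open>The integrand is at most \<open>A / (1 + t^2)^2\<close> with
  \<open>t = n * cmod s\<close> and \<open>n = 2 * l + 1\<close>: the height of \<open>kern\<close>
  serves for \<open>t \<le> 1\<close>, its decay for \<open>t > 1\<close>. Passing to a product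
  majorant, whose integral is of order \<open>1 / n^2\<close>, avoids polar coordinates.\<close>

lemma jackson_kernel_moment:
  "(\<integral>s\<in>cball 0 3. cmod s ^ k * jackson_kernel k l s \<partial>lborel) \<le>
     4 * 3 ^ (2 * k + 4) * pi\<^sup>2 * real (2 * l + 1) ^ (k + 2)"
proof -
  define n where "n = real (2 * l + 1)"
  have n: "n \<ge> 1"
    by (simp add: n_def)
  define A where "A = 4 * 3 ^ (2 * k + 4) * n ^ (k + 4)"
  have A: "A \<ge> 0"
    using n by (simp add: A_def)
  have pos: "1 + (n * x)\<^sup>2 > 0" for x
    by (rule add_pos_nonneg) auto
  then have nz: "1 + (n * x)\<^sup>2 \<noteq> 0" for x
    by (metis less_irrefl)
  have le: "cmod s ^ k * jackson_kernel k l s \<le> A * (1 / ((1 + (n * Re s)\<^sup>2) * (1 + (n * Im s)\<^sup>2)))"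
    if s: "s \<in> cball 0 3" for s
  proof -
    define t where "t = n * cmod s"
    have t0: "t \<ge> 0"
      using n by (simp add: t_def)
    have \<sigma>: "0 \<le> (cmod s / 3)\<^sup>2" "(cmod s / 3)\<^sup>2 \<le> 1" "sqrt ((cmod s / 3)\<^sup>2) = cmod s / 3"
      using s by (auto intro!: power_le_one)
    have k1: "\<bar>kern l ((cmod s / 3)\<^sup>2)\<bar> \<le> n"
      using kern_bounds(1)[OF \<sigma>(1,2)] by (simp add: n_def)
    have k2: "cmod s * \<bar>kern l ((cmod s / 3)\<^sup>2)\<bar> \<le> 3"
      using kern_bounds(2)[OF \<sigma>(1,2), of l] unfolding \<sigma>(3) by simp
    have K_abs: "jackson_kernel k l s = \<bar>kern l ((cmod s / 3)\<^sup>2)\<bar> ^ (2 * k + 4)"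
      unfolding jackson_kernel_def by (rule power_even_abs[symmetric]) simp
    have "(1 + (n * Re s)\<^sup>2) * (1 + (n * Im s)\<^sup>2) \<le> (1 + t\<^sup>2) * (1 + t\<^sup>2)"
    proof (rule mult_mono)
      show "1 + (n * Re s)\<^sup>2 \<le> 1 + t\<^sup>2" "1 + (n * Im s)\<^sup>2 \<le> 1 + t\<^sup>2"
        unfolding t_def power_mult_distrib using n
        by (auto intro!: mult_left_mono simp: cmod_power2)
    qed (use pos[of "Im s"] in auto)
    also have "\<dots> = (1 + t\<^sup>2)\<^sup>2"
      by (simp add: power2_eq_square)
    finally have D: "(1 + (n * Re s)\<^sup>2) * (1 + (n * Im s)\<^sup>2) \<le> (1 + t\<^sup>2)\<^sup>2" .
    have "n ^ k * (cmod s ^ k * jackson_kernel k l s) * (1 + t\<^sup>2)\<^sup>2 \<le> n ^ k * A"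
    proof (cases "t \<le> 1")
      case True
      have "n ^ k * (cmod s ^ k * jackson_kernel k l s) * (1 + t\<^sup>2)\<^sup>2 =
          t ^ k * jackson_kernel k l s * (1 + t\<^sup>2)\<^sup>2"
        by (simp add: t_def power_mult_distrib)
      also have "\<dots> \<le> 1 * n ^ (2 * k + 4) * 2\<^sup>2"
        using True t0 k1 unfolding K_abs
        by (intro mult_mono power_mono power_le_one) (auto simp: power_le_one)
      also have "\<dots> \<le> n ^ k * A"
      proof -
        have "n ^ (2 * k + 4) = n ^ k * n ^ (k + 4)"
          by (rule power_split) simp
        moreover have "(1::real) \<le> 3 ^ (2 * k + 4)"
          by (rule one_le_power) simp
        moreover have "0 \<le> n ^ k * n ^ (k + 4)"
          using n by simp
        ultimately show ?thesis
          using mult_left_mono[of 1 "3 ^ (2 * k + 4)" "4 * (n ^ k * n ^ (k + 4))"]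
          by (simp add: A_def algebra_simps)
      qed
      finally show ?thesis .
    next
      case False
      have "t ^ (2 * k + 4) * jackson_kernel k l s = n ^ (2 * k + 4) * (cmod s * \<bar>kern l ((cmod s / 3)\<^sup>2)\<bar>) ^ (2 * k + 4)"
        unfolding K_abs t_def power_mult_distrib by simp
      also have "\<dots> \<le> n ^ (2 * k + 4) * 3 ^ (2 * k + 4)"
        using k2 n by (intro mult_left_mono power_mono) auto
      finally have tK: "t ^ (2 * k + 4) * jackson_kernel k l s \<le> n ^ (2 * k + 4) * 3 ^ (2 * k + 4)" .
      have "t ^ 4 \<le> t ^ (k + 4)"
        using False by (intro power_increasing) auto
      moreover have "(1 + t\<^sup>2)\<^sup>2 \<le> (2 * t\<^sup>2)\<^sup>2"
        using False one_le_power[of t 2] by (intro power_mono) auto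
      then have "(1 + t\<^sup>2)\<^sup>2 \<le> 4 * t ^ 4"
        by (simp add: power_mult_distrib)
      ultimately have "(1 + t\<^sup>2)\<^sup>2 \<le> 4 * t ^ (k + 4)"
        by linarith
      then have "(t ^ k * jackson_kernel k l s) * (1 + t\<^sup>2)\<^sup>2 \<le> (t ^ k * jackson_kernel k l s) * (4 * t ^ (k + 4))"
        using t0 jackson_kernel_nonneg by (intro mult_left_mono) auto
      also have "\<dots> = 4 * ((t ^ k * t ^ (k + 4)) * jackson_kernel k l s)"
        by (simp only: mult_ac)
      also have "t ^ k * t ^ (k + 4) = t ^ (2 * k + 4)"
        by (rule power_split[symmetric]) simp
      also have "4 * (t ^ (2 * k + 4) * jackson_kernel k l s) \<le> 4 * (n ^ (2 * k + 4) * 3 ^ (2 * k + 4))"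
        using tK by simp
      also have "n ^ (2 * k + 4) = n ^ k * n ^ (k + 4)"
        by (rule power_split) simp
      also have "4 * (n ^ k * n ^ (k + 4) * 3 ^ (2 * k + 4)) = n ^ k * A"
        by (simp only: A_def mult_ac)
      finally show ?thesis
        by (simp add: t_def power_mult_distrib mult.assoc)
    qed
    then have "n ^ k * ((cmod s ^ k * jackson_kernel k l s) * (1 + t\<^sup>2)\<^sup>2) \<le> n ^ k * A"
      by (simp only: mult.assoc)
    then have *: "(cmod s ^ k * jackson_kernel k l s) * (1 + t\<^sup>2)\<^sup>2 \<le> A"
      by (rule mult_left_le_imp_le) (use n in simp)
    have "(cmod s ^ k * jackson_kernel k l s) * ((1 + (n * Re s)\<^sup>2) * (1 + (n * Im s)\<^sup>2)) \<le>
        (cmod s ^ k * jackson_kernel k l s) * (1 + t\<^sup>2)\<^sup>2"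
      using D jackson_kernel_nonneg by (intro mult_left_mono) auto
    then have "(cmod s ^ k * jackson_kernel k l s) * ((1 + (n * Re s)\<^sup>2) * (1 + (n * Im s)\<^sup>2)) \<le> A"
      using * by linarith
    then show ?thesis
      using mult_pos_pos[OF pos pos, of "Re s" "Im s"] by (simp add: pos_le_divide_eq)
  qed
  have "(\<integral>s\<in>cball 0 3. cmod s ^ k * jackson_kernel k l s \<partial>lborel) \<le>
      (\<integral>s\<in>cball 0 3. A * (1 / ((1 + (n * Re s)\<^sup>2) * (1 + (n * Im s)\<^sup>2))) \<partial>lborel)"
  proof (rule set_integral_mono)
    show "set_integrable lborel (cball 0 3) (\<lambda>s. cmod s ^ k * jackson_kernel k l s)"
      by (intro compact_set_integrable continuous_intros continuous_on_jackson_kernel) auto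
    show "set_integrable lborel (cball 0 3) (\<lambda>s. A * (1 / ((1 + (n * Re s)\<^sup>2) * (1 + (n * Im s)\<^sup>2))))"
      using nz by (intro compact_set_integrable continuous_intros ballI) (simp_all only: mult_eq_0_iff compact_cball, blast)
  qed (use le in auto)
  also have "\<dots> = A * (\<integral>s\<in>cball 0 3. 1 / ((1 + (n * Re s)\<^sup>2) * (1 + (n * Im s)\<^sup>2)) \<partial>lborel)"
    by (rule set_integral_mult_right)
  also have "\<dots> \<le> A * (pi / n)\<^sup>2"
    using A n by (intro mult_left_mono set_integral_inverse_quadratic_le) auto
  also have "\<dots> = 4 * 3 ^ (2 * k + 4) * pi\<^sup>2 * n ^ (k + 2)"
  proof -
    have "n ^ (k + 4) = n ^ (k + 2) * n\<^sup>2"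
      by (rule power_split) simp
    then show ?thesis
      using n by (simp add: A_def power_divide)
  qed
  finally show ?thesis
    by (simp add: n_def)
qed

text \<open>On the ball of radius \<open>\<eta> / n\<close>, of area
  \<open>pi * \<eta>^2 / n^2\<close>, the kernel is at least
  \<open>(n / 2) ^ (2 * k + 4)\<close>.\<close>

lemma jackson_kernel_mass:
  assumes \<eta>: "0 < \<eta>" "\<eta> \<le> 1"
  shows "pi * \<eta>\<^sup>2 / 2 ^ (2 * k + 4) * real (2 * l + 1) ^ (2 * k + 2) \<le>
           (\<integral>s\<in>cball 0 \<eta>. jackson_kernel k l s \<partial>lborel)"
proof -
  define n where "n = real (2 * l + 1)"
  have n: "n \<ge> 1"
    by (simp add: n_def)
  define r where "r = \<eta> / n"
  have r: "0 < r" "r \<le> \<eta>" "r \<le> 1 / n"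
    using \<eta> n by (auto simp: r_def divide_right_mono field_simps)
  have "pi * \<eta>\<^sup>2 / 2 ^ (2 * k + 4) * n ^ (2 * k + 2) = measure lborel (cball (0::complex) r) *\<^sub>R (n / 2) ^ (2 * k + 4)"
  proof -
    have "n ^ (2 * k + 4) = n ^ (2 * k + 2) * n\<^sup>2"
      by (rule power_split) simp
    then have "pi * \<eta>\<^sup>2 / 2 ^ (2 * k + 4) * n ^ (2 * k + 2) = (pi * (\<eta> / n)\<^sup>2) * (n / 2) ^ (2 * k + 4)"
      unfolding power_divide using n by (simp del: power_mult)
    then show ?thesis
      using r by (simp add: content_cball_complex r_def)
  qed
  also have "\<dots> = (\<integral>s\<in>cball (0::complex) r. (n / 2) ^ (2 * k + 4) \<partial>lborel)"
    using emeasure_lborel_cball_finite[of "0::complex" r] by (subst set_integral_const) auto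
  also have "\<dots> \<le> (\<integral>s\<in>cball 0 r. jackson_kernel k l s \<partial>lborel)"
  proof (rule set_integral_mono)
    fix s assume s: "s \<in> cball (0::complex) r"
    have "r \<le> 1"
      using r \<eta> by simp
    then have \<sigma>: "0 \<le> (cmod s / 3)\<^sup>2" "(cmod s / 3)\<^sup>2 \<le> 1" "sqrt ((cmod s / 3)\<^sup>2) = cmod s / 3"
      using s by (auto intro!: power_le_one)
    have "cmod s / 3 \<le> (1 / n) / 2"
      using s r by simp
    then have "kern l ((cmod s / 3)\<^sup>2) \<ge> n / 2"
      using kern_bounds(3)[OF \<sigma>(1,2), of l] unfolding \<sigma>(3) by (simp add: n_def mult.commute)
    then show "(n / 2) ^ (2 * k + 4) \<le> jackson_kernel k l s"
      unfolding jackson_kernel_def using n by (intro power_mono) auto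
  qed (auto intro!: compact_set_integrable continuous_on_jackson_kernel)
  also have "\<dots> \<le> (\<integral>s\<in>cball 0 \<eta>. jackson_kernel k l s \<partial>lborel)"
    using r jackson_kernel_nonneg
    by (intro set_integral_subset_mono compact_set_integrable continuous_on_jackson_kernel) auto
  finally show ?thesis
    by (simp add: n_def)
qed

text \<open>Jackson's theorem: moment over mass is of order
  \<open>n ^ (k + 2) / n ^ (2 * k + 2)\<close>, that is \<open>1 / n ^ k\<close>. The denominator
  \<open>Suc N\<close> keeps the bound meaningful at \<open>N = 0\<close>.\<close>

lemma jackson_disk:
  assumes f: "f \<in> C_disk k"
  shows "\<exists>C\<ge>0. \<forall>N. \<exists>P\<in>polys2 N. \<forall>x\<in>unit_disk. \<bar>f x - P x\<bar> \<le> C / real (Suc N) ^ k"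
proof -
  obtain C \<eta> where C: "C \<ge> 0" and \<eta>: "0 < \<eta>" "\<eta> \<le> 1"
    and approx: "\<And>K N. continuous_on UNIV K \<Longrightarrow> (\<And>s. 0 \<le> K s) \<Longrightarrow>
           (\<And>c. (\<lambda>x y. K (c *\<^sub>R (y - x))) \<in> param_polys N) \<Longrightarrow>
           (\<integral>s\<in>cball 0 \<eta>. K s \<partial>lborel) > 0 \<Longrightarrow>
           (\<exists>P\<in>polys2 N. \<forall>x\<in>unit_disk. \<bar>f x - P x\<bar> \<le>
              C * (\<integral>s\<in>cball 0 3. cmod s ^ k * K s \<partial>lborel) / (\<integral>s\<in>cball 0 \<eta>. K s \<partial>lborel))"
    using kernel_approximation[OF f] by blast
  define A where "A = 4 * 3 ^ (2 * k + 4) * pi\<^sup>2"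
  define a where "a = pi * \<eta>\<^sup>2 / 2 ^ (2 * k + 4)"
  have Aa: "A \<ge> 0" "a > 0"
    using \<eta> by (auto simp: A_def a_def)
  \<comment> \<open>The kernel has degree \<open>q * l\<close>, so \<open>l = N div q\<close> is the
    largest order allowed, and \<open>2 * l + 1\<close> is still at least
    \<open>(N + 1) / q\<close>.\<close>
  define q where "q = 4 * k + 8"
  show ?thesis
  proof (intro exI[of _ "C * A / a * real q ^ k"] conjI allI)
    show "0 \<le> C * A / a * real q ^ k"
      using C Aa by simp
    fix N
    define l where "l = N div q"
    define n where "n = real (2 * l + 1)"
    have n: "n \<ge> 1"
      by (simp add: n_def)
    define I where "I = (\<integral>s\<in>cball 0 3. cmod s ^ k * jackson_kernel k l s \<partial>lborel)"
    define c where "c = (\<integral>s\<in>cball 0 \<eta>. jackson_kernel k l s \<partial>lborel)"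
    have I: "I \<le> A * n ^ (k + 2)"
      using jackson_kernel_moment[of k l] by (simp only: I_def A_def n_def)
    have c: "a * n ^ (2 * k + 2) \<le> c"
      using jackson_kernel_mass[OF \<eta>, of k l] by (simp only: c_def a_def n_def)
    have an: "0 < a * n ^ (2 * k + 2)"
      using Aa n by simp
    then have "c > 0"
      using c by linarith
    then obtain P where P: "P \<in> polys2 ((2 * k + 4) * (2 * l))"
      "\<And>x. x \<in> unit_disk \<Longrightarrow> \<bar>f x - P x\<bar> \<le> C * I / c"
      using approx[OF continuous_on_jackson_kernel jackson_kernel_nonneg param_polys_jackson_kernel, of k l]
      unfolding I_def c_def by blast
    have "(2 * k + 4) * (2 * l) = q * l"
      by (simp add: q_def algebra_simps)
    also have "\<dots> \<le> N"
      by (simp add: l_def)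
    finally have "P \<in> polys2 N"
      using P(1) polys2_mono by blast
    moreover have "C * I / c \<le> C * A / a * real q ^ k / real (Suc N) ^ k"
    proof -
      have "C * I / c \<le> C * (A * n ^ (k + 2)) / (a * n ^ (2 * k + 2))"
        using C I c an Aa n by (intro frac_le mult_left_mono) auto
      also have "\<dots> = C * A / a * (1 / n) ^ k"
      proof -
        have "n ^ (2 * k + 2) = n ^ (k + 2) * n ^ k"
          by (rule power_split) simp
        then show ?thesis
          using n unfolding power_divide by simp
      qed
      also have "\<dots> \<le> C * A / a * (real q / real (Suc N)) ^ k"
      proof -
        have "N < q * (l + 1)"
          unfolding l_def using dividend_less_times_div[of q N] by (simp add: q_def)
        then have "Suc N \<le> q * (2 * l + 1)"
          by (simp add: algebra_simps)
        then have "real (Suc N) \<le> real q * n"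
          unfolding n_def by (simp only: of_nat_le_iff flip: of_nat_mult)
        then have "1 / n \<le> real q / real (Suc N)"
          using n by (simp add: field_simps)
        then show ?thesis
          using C Aa n by (intro mult_left_mono power_mono) auto
      qed
      finally show ?thesis
        by (simp add: power_divide)
    qed
    ultimately show "\<exists>P\<in>polys2 N. \<forall>x\<in>unit_disk. \<bar>f x - P x\<bar> \<le> C * A / a * real q ^ k / real (Suc N) ^ k"
      using P(2) by (meson order.trans)
  qed
qed

section \<open>Convergence\<close>

lemma continuous_on_C_disk:
  assumes "f \<in> C_disk k"
  shows "continuous_on unit_disk f"
proof -
  obtain U where U: "open U" "unit_disk \<subseteq> U" "C_on k U f"
    using assms by (auto simp: C_disk_def)
  show ?thesis
  proof (cases k)
    case 0
    then show ?thesis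
      using U continuous_on_subset by simp blast
  next
    case (Suc m)
    then have "f differentiable_on unit_disk"
      using U by (auto simp: differentiable_on_def intro: differentiable_at_withinI)
    then show ?thesis
      by (rule differentiable_imp_continuous_on)
  qed
qed

text \<open>Explicit rates instead of uniform limits: a rate for every \<open>k\<close> survives the
  polynomial losses of differentiation.\<close>

definition converges_at_rate :: "nat \<Rightarrow> (nat \<Rightarrow> complex \<Rightarrow> real) \<Rightarrow> (complex \<Rightarrow> real) \<Rightarrow> bool" where
  "converges_at_rate k q g \<longleftrightarrow> (\<exists>C\<ge>0. \<forall>d\<ge>2. \<forall>x\<in>unit_disk. \<bar>q d x - g x\<bar> \<le> C / real d ^ k)"

lemma uniform_limit_of_rate:
  assumes "converges_at_rate (Suc k) q g"
  shows "uniform_limit unit_disk q g sequentially"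
proof (rule uniform_limitI)
  fix \<epsilon> :: real assume "\<epsilon> > 0"
  obtain C where C: "C \<ge> 0" "\<And>d x. 2 \<le> d \<Longrightarrow> x \<in> unit_disk \<Longrightarrow> \<bar>q d x - g x\<bar> \<le> C / real d ^ Suc k"
    using assms unfolding converges_at_rate_def by blast
  have "(\<lambda>d. C / real d) \<longlonglongrightarrow> 0"
    by (rule lim_const_over_n)
  then have "\<forall>\<^sub>F d in sequentially. C / real d < \<epsilon>"
    using \<open>\<epsilon> > 0\<close> by (rule order_tendstoD)
  then show "\<forall>\<^sub>F d in sequentially. \<forall>x\<in>unit_disk. dist (q d x) (g x) < \<epsilon>"
    using eventually_ge_at_top[of 2]
  proof eventually_elim
    case (elim d)
    have "C / real d ^ Suc k \<le> C / real d"
    proof (rule divide_left_mono)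
      show "real d \<le> real d ^ Suc k"
        using elim self_le_power[of "real d" "Suc k"] by simp
    qed (use C elim in auto)
    show ?case
    proof
      fix x assume "x \<in> unit_disk"
      then have "\<bar>q d x - g x\<bar> \<le> C / real d ^ Suc k"
        using C(2) elim(2) by blast
      then show "dist (q d x) (g x) < \<epsilon>"
        using \<open>C / real d ^ Suc k \<le> C / real d\<close> elim(1) unfolding dist_real_def by linarith
    qed
  qed
qed

section \<open>Convergence rates of the interpolants and their derivatives\<close>

context
  fixes e :: "nat \<Rightarrow> complex"
  assumes leja: "leja_disk e" and e0: "e 0 = 1"
begin

lemma inj_on_leja: "inj_on e {..<d}"
  using inj_leja_disk[OF leja e0] by (rule inj_on_subset) simp

text \<open>Four orders of smoothness pay for the operator norm of order \<open>d^4\<close>.\<close>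

lemma hakopian_rate:
  assumes f: "f \<in> C_disk (k + 4)"
  shows "converges_at_rate k (\<lambda>d. hakopian (map e [0..<d]) f) f"
proof -
  obtain C where C: "C \<ge> 0"
    and approx: "\<And>N. \<exists>P\<in>polys2 N. \<forall>x\<in>unit_disk. \<bar>f x - P x\<bar> \<le> C / real (Suc N) ^ (k + 4)"
    using jackson_disk[OF f] by blast
  define C' where "C' = 9217 * C * 2 ^ (k + 4)"
  have "\<bar>hakopian (map e [0..<d]) f x - f x\<bar> \<le> C' / real d ^ k"
    if d: "2 \<le> d" and x: "x \<in> unit_disk" for d x
  proof -
    obtain P where P: "P \<in> polys2 (d - 2)"
      "\<And>x. x \<in> unit_disk \<Longrightarrow> \<bar>f x - P x\<bar> \<le> C / real (Suc (d - 2)) ^ (k + 4)"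
      using approx by blast
    \<comment> \<open>\<open>Suc (d - 2)\<close> is \<open>d - 1\<close>, at least half of
      \<open>d\<close>; this costs the factor \<open>2 ^ (k + 4)\<close>.\<close>
    have "real d / 2 \<le> real (Suc (d - 2))"
      using d by (simp add: of_nat_diff)
    then have "C / real (Suc (d - 2)) ^ (k + 4) \<le> C / (real d / 2) ^ (k + 4)"
      using C d by (intro divide_left_mono power_mono mult_pos_pos zero_less_power) auto
    then have "\<bar>f y - P y\<bar> \<le> C / (real d / 2) ^ (k + 4)" if "y \<in> unit_disk" for y
      using P(2)[OF that] by linarith
    then have "\<bar>hakopian (map e [0..<d]) f x - f x\<bar> \<le>
        (9216 * real d ^ 4 + 1) * (C / (real d / 2) ^ (k + 4))"
      using norm_leja_disk[OF leja e0] inj_on_leja leja_disk_prod_le[OF leja e0]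
        continuous_on_C_disk[OF f] P(1) d x
      by (intro hakopian_error)
    also have "\<dots> \<le> (9217 * real d ^ 4) * (C / (real d / 2) ^ (k + 4))"
    proof (rule mult_right_mono)
      have "1 \<le> real d ^ 4"
        using d by (intro one_le_power) auto
      then show "9216 * real d ^ 4 + 1 \<le> 9217 * real d ^ 4"
        by simp
    qed (use C in auto)
    also have "\<dots> = C' / real d ^ k"
      using d unfolding power_divide C'_def power_add by (simp add: field_simps)
    finally show ?thesis .
  qed
  moreover have "C' \<ge> 0"
    using C by (simp add: C'_def)
  ultimately show ?thesis
    unfolding converges_at_rate_def by blast
qed

text \<open>Markov's inequality does not apply to \<open>q d - g\<close>, as \<open>g\<close> need
  not be a polynomial. It is applied to successive differences instead, which lie in
  \<open>polys2 (Suc d - 2)\<close> and telescope.\<close>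

lemma partial_deriv_Cauchy_rate:
  assumes poly: "\<And>d. 2 \<le> d \<Longrightarrow> q d \<in> polys2 (d - 2)"
    and rate: "\<And>k. converges_at_rate k q g" and v: "v \<in> {1, \<i>}"
  shows "\<exists>C\<ge>0. \<forall>d\<ge>2. \<forall>m\<ge>d. \<forall>x\<in>unit_disk.
           \<bar>partial_deriv v (q m) x - partial_deriv v (q d) x\<bar> \<le> C / real d ^ k"
proof -
  \<comment> \<open>Of the 8 extra orders, 6 are lost in Markov's inequality and 2 make the
    differences summable.\<close>
  obtain C where C: "C \<ge> 0"
    "\<And>d x. 2 \<le> d \<Longrightarrow> x \<in> unit_disk \<Longrightarrow> \<bar>q d x - g x\<bar> \<le> C / real d ^ (k + 8)"
    using rate[of "k + 8"] unfolding converges_at_rate_def by blast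
  define A where "A = 589824 * 2 ^ 6 * (2 * C)"
  have A: "A \<ge> 0"
    using C by (simp add: A_def)
  have step: "\<bar>partial_deriv v (q (Suc d)) x - partial_deriv v (q d) x\<bar> \<le> A / real d ^ (k + 2)"
    if d: "2 \<le> d" and x: "x \<in> unit_disk" for d x
  proof -
    have q1: "q (Suc d) \<in> polys2 (Suc d - 2)" and q2: "q d \<in> polys2 (Suc d - 2)"
      using poly[of "Suc d"] poly[of d] d polys2_mono[of "q d" "d - 2" "Suc d - 2"] by auto
    obtain P1 P2 where P: "(q (Suc d) has_derivative (\<lambda>h. Re h * P1 x + Im h * P2 x)) (at x)"
      using has_derivative_polys2[OF q1] by metis
    obtain Q1 Q2 where Q: "(q d has_derivative (\<lambda>h. Re h * Q1 x + Im h * Q2 x)) (at x)"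
      using has_derivative_polys2[OF q2] by metis
    have "partial_deriv v (\<lambda>x. q (Suc d) x - q d x) x = partial_deriv v (q (Suc d)) x - partial_deriv v (q d) x"
      unfolding partial_deriv_eq[OF has_derivative_diff[OF P Q]] partial_deriv_eq[OF P] partial_deriv_eq[OF Q] ..
    moreover have "\<bar>partial_deriv v (\<lambda>x. q (Suc d) x - q d x) x\<bar> \<le>
        589824 * real (Suc d) ^ 6 * (2 * C / real d ^ (k + 8))"
    proof (rule markov_disk)
      show "(\<lambda>x. q (Suc d) x - q d x) \<in> polys2 (Suc d - 2)"
        using q1 q2 by (rule polys2_diff)
      fix y assume y: "y \<in> unit_disk"
      have "C / real (Suc d) ^ (k + 8) \<le> C / real d ^ (k + 8)"
        using C d by (intro divide_left_mono power_mono mult_pos_pos zero_less_power) auto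
      then show "\<bar>q (Suc d) y - q d y\<bar> \<le> 2 * C / real d ^ (k + 8)"
        using C(2)[of "Suc d" y] C(2)[of d y] y d by simp
    next
      show "cmod (\<Prod>i<Suc d. z - e i) \<le> 2 * cmod (\<Prod>i\<in>{..<Suc d} - {j}. e j - e i)"
        if "j < Suc d" "cmod z \<le> 1" for j z
        using leja_disk_prod_le[OF leja e0 that] .
    qed (use norm_leja_disk[OF leja e0] inj_on_leja d x v in auto)
    moreover have "589824 * real (Suc d) ^ 6 * (2 * C / real d ^ (k + 8)) \<le>
        589824 * (2 * real d) ^ 6 * (2 * C / real d ^ (k + 8))"
      using d C by (intro mult_right_mono mult_left_mono power_mono) auto
    moreover have "589824 * (2 * real d) ^ 6 * (2 * C / real d ^ (k + 8)) = A / real d ^ (k + 2)"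
    proof -
      have "real d ^ (k + 8) = real d ^ 6 * real d ^ (k + 2)"
        by (rule power_split) simp
      then show ?thesis
        using d unfolding A_def power_mult_distrib by simp
    qed
    ultimately show ?thesis
      by linarith
  qed
  \<comment> \<open>The bound has the telescoping form behind
    \<open>1 / m^2 \<le> 1 / (m - 1) - 1 / m\<close>, so that induction on \<open>m\<close> can
    prove it with a constant independent of \<open>m\<close>.\<close>
  have "\<bar>partial_deriv v (q m) x - partial_deriv v (q d) x\<bar> \<le> A / real d ^ k * (1 / (real d - 1) - 1 / (real m - 1))"
    if d: "2 \<le> d" "d \<le> m" and x: "x \<in> unit_disk" for d m x
    using d(2)
  proof (induction m rule: dec_induct)
    case (step m)
    have m: "2 \<le> m" "d \<le> m"
      using step d by auto
    have "A / real m ^ (k + 2) \<le> A / real d ^ k * (1 / (real m - 1) - 1 / real m)"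
    proof -
      have "A / real m ^ (k + 2) = A / real m ^ k * (1 / (real m)\<^sup>2)"
        by (simp add: power_add power2_eq_square)
      also have "\<dots> \<le> A / real d ^ k * (1 / (real m - 1) - 1 / real m)"
      proof (intro mult_mono divide_left_mono power_mono mult_pos_pos zero_less_power)
        show "1 / (real m)\<^sup>2 \<le> 1 / (real m - 1) - 1 / real m"
          using m by (simp add: field_simps power2_eq_square)
      qed (use m d A in auto)
      finally show ?thesis .
    qed
    then have "\<bar>partial_deriv v (q (Suc m)) x - partial_deriv v (q m) x\<bar> \<le>
        A / real d ^ k * (1 / (real m - 1) - 1 / real m)"
      using \<open>\<And>d x. 2 \<le> d \<Longrightarrow> x \<in> unit_disk \<Longrightarrow>
        \<bar>partial_deriv v (q (Suc d)) x - partial_deriv v (q d) x\<bar> \<le> A / real d ^ (k + 2)\<close>[OF m(1) x]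
      by linarith
    then have "\<bar>partial_deriv v (q (Suc m)) x - partial_deriv v (q d) x\<bar> \<le>
        A / real d ^ k * (1 / (real m - 1) - 1 / real m) +
        A / real d ^ k * (1 / (real d - 1) - 1 / (real m - 1))"
      using step.IH by linarith
    also have "\<dots> = A / real d ^ k * (1 / (real d - 1) - 1 / (real (Suc m) - 1))"
    proof -
      have "B * (x - y) + B * (z - x) = B * (z - y)" for B x y z :: real
        by (simp add: algebra_simps)
      moreover have "real (Suc m) - 1 = real m"
        by simp
      ultimately show ?thesis
        by (simp only:)
    qed
    finally show ?case .
  qed simp
  note telescope = this
  have "\<bar>partial_deriv v (q m) x - partial_deriv v (q d) x\<bar> \<le> A / real d ^ k"
    if d: "2 \<le> d" "d \<le> m" and x: "x \<in> unit_disk" for d m x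
  proof -
    have "1 / (real d - 1) \<le> 1" "0 \<le> 1 / (real m - 1)"
      using d by (auto simp: field_simps)
    then have "1 / (real d - 1) - 1 / (real m - 1) \<le> 1"
      by linarith
    then have "A / real d ^ k * (1 / (real d - 1) - 1 / (real m - 1)) \<le> A / real d ^ k * 1"
      using A by (intro mult_left_mono) auto
    then show ?thesis
      using telescope[OF d x] by linarith
  qed
  then show ?thesis
    using A by blast
qed

text \<open>A rate against the still unknown limit comes from letting \<open>m\<close> tend to
  infinity in the Cauchy estimate. Continuity of \<open>h\<close> will be used on the boundary
  circle.\<close>

lemma partial_deriv_limit:
  assumes poly: "\<And>d. 2 \<le> d \<Longrightarrow> q d \<in> polys2 (d - 2)"
    and rate: "\<And>k. converges_at_rate k q g" and v: "v \<in> {1, \<i>}"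
  obtains h where "continuous_on unit_disk h"
    and "\<And>k. converges_at_rate k (\<lambda>d. partial_deriv v (q d)) h"
proof -
  define r where "r d = partial_deriv v (q d)" for d
  have cauchy: "\<exists>C\<ge>0. \<forall>d\<ge>2. \<forall>m\<ge>d. \<forall>x\<in>unit_disk. \<bar>r m x - r d x\<bar> \<le> C / real d ^ k" for k
    unfolding r_def by (rule partial_deriv_Cauchy_rate[OF poly rate v])
  have "\<exists>h. (\<lambda>d. r d x) \<longlonglongrightarrow> h" if x: "x \<in> unit_disk" for x
  proof -
    obtain C where C: "C \<ge> 0" "\<And>d m. 2 \<le> d \<Longrightarrow> d \<le> m \<Longrightarrow> \<bar>r m x - r d x\<bar> \<le> C / real d"
      using cauchy[of 1] x by auto
    have "Cauchy (\<lambda>d. r d x)"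
    proof (rule CauchyI')
      fix \<epsilon> :: real assume "0 < \<epsilon>"
      have "(\<lambda>d. C / real d) \<longlonglongrightarrow> 0"
        by (rule lim_const_over_n)
      then have "\<forall>\<^sub>F d in sequentially. C / real d < \<epsilon>"
        using \<open>0 < \<epsilon>\<close> by (rule order_tendstoD)
      then obtain M where M: "\<And>d. M \<le> d \<Longrightarrow> C / real d < \<epsilon>"
        by (auto simp: eventually_sequentially)
      have "dist (r d x) (r m x) < \<epsilon>" if "max 2 M \<le> d" "d < m" for d m
        using C(2)[of d m] M[of d] that by (simp add: dist_real_def abs_minus_commute)
      then show "\<exists>M. \<forall>m\<ge>M. \<forall>n>m. dist (r m x) (r n x) < \<epsilon>"
        by blast
    qed
    then show ?thesis
      using Cauchy_convergent convergent_def by blast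
  qed
  then obtain h where h: "\<And>x. x \<in> unit_disk \<Longrightarrow> (\<lambda>d. r d x) \<longlonglongrightarrow> h x"
    by metis
  have rate_r: "converges_at_rate k r h" for k
  proof -
    obtain C where C: "C \<ge> 0" "\<And>d m x. 2 \<le> d \<Longrightarrow> d \<le> m \<Longrightarrow> x \<in> unit_disk \<Longrightarrow> \<bar>r m x - r d x\<bar> \<le> C / real d ^ k"
      using cauchy[of k] by blast
    have "\<bar>r d x - h x\<bar> \<le> C / real d ^ k" if "2 \<le> d" "x \<in> unit_disk" for d x
    proof (rule LIMSEQ_le_const2)
      show "(\<lambda>m. \<bar>r d x - r m x\<bar>) \<longlonglongrightarrow> \<bar>r d x - h x\<bar>"
        using h[OF that(2)] by (intro tendsto_intros)
      show "\<exists>N. \<forall>m\<ge>N. \<bar>r d x - r m x\<bar> \<le> C / real d ^ k"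
        using C(2)[OF that(1) _ that(2)] by (metis abs_minus_commute)
    qed
    then show ?thesis
      unfolding converges_at_rate_def using C(1) by blast
  qed
  have "continuous_on unit_disk h"
  proof (rule uniform_limit_theorem[OF _ uniform_limit_of_rate[OF rate_r[of "Suc 0"]]])
    show "\<forall>\<^sub>F d in sequentially. continuous_on unit_disk (r d)"
      using eventually_ge_at_top[of 2]
    proof eventually_elim
      case (elim d)
      then show ?case
        unfolding r_def by (rule continuous_on_polys2[OF partial_deriv_polys2[OF poly v]])
    qed
  qed simp
  then show thesis
    using that rate_r unfolding r_def by blast
qed

text \<open>
  The limit of the partial derivatives is identified in the open disk by termwise differentiation,
  and on the boundary circle by continuity.
\<close>

lemma partial_deriv_rate:
  assumes poly: "\<And>d. 2 \<le> d \<Longrightarrow> q d \<in> polys2 (d - 2)"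
    and rate: "\<And>k. converges_at_rate k q g" and v: "v \<in> {1, \<i>}"
    and g: "unit_disk \<subseteq> U" "C_on 1 U g"
  shows "converges_at_rate k (\<lambda>d. partial_deriv v (q d)) (partial_deriv v g)"
proof -
  obtain h1 where h1: "continuous_on unit_disk h1" "\<And>k. converges_at_rate k (\<lambda>d. partial_deriv 1 (q d)) h1"
    using partial_deriv_limit[OF poly rate, of 1] by auto
  obtain h2 where h2: "continuous_on unit_disk h2" "\<And>k. converges_at_rate k (\<lambda>d. partial_deriv \<i> (q d)) h2"
    using partial_deriv_limit[OF poly rate, of \<i>] by auto
  have der_q: "(q d has_derivative (\<lambda>h. Re h * partial_deriv 1 (q d) x + Im h * partial_deriv \<i> (q d) x)) (at x)"
    if d: "2 \<le> d" for d x
  proof -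
    obtain P1 P2 where P: "\<And>x. (q d has_derivative (\<lambda>h. Re h * P1 x + Im h * P2 x)) (at x)"
      using has_derivative_polys2[OF poly[OF d]] by metis
    show ?thesis
      using P[of x] partial_deriv_eq[OF P, of 1 x] partial_deriv_eq[OF P, of \<i> x] by simp
  qed
  have q_lim: "(\<lambda>d. q d x) \<longlonglongrightarrow> g x" if "x \<in> unit_disk" for x
    using uniform_limit_of_rate[OF rate[of "Suc 0"]] that by (rule tendsto_uniform_limitI)
  \<comment> \<open>The index is shifted by 2 because \<open>q d\<close> is known to be a polynomial
    only from \<open>d = 2\<close> on.\<close>
  have "\<exists>G. \<forall>x\<in>ball 0 1. (\<lambda>n. q (n + 2) x) \<longlonglongrightarrow> G x \<and>
      (G has_derivative (\<lambda>h. Re h * h1 x + Im h * h2 x)) (at x within ball 0 1)"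
  proof (rule has_derivative_sequence)
    show "(q (n + 2) has_derivative
        (\<lambda>h. Re h * partial_deriv 1 (q (n + 2)) x + Im h * partial_deriv \<i> (q (n + 2)) x)) (at x within ball 0 1)" for n x
      using der_q[of "n + 2" x] by (auto intro: has_derivative_at_withinI)
    show "(\<lambda>n. q (n + 2) 0) \<longlonglongrightarrow> g 0"
      using LIMSEQ_ignore_initial_segment[OF q_lim[of 0], of 2] by simp
    fix \<epsilon> :: real assume \<epsilon>: "0 < \<epsilon>"
    have "\<forall>\<^sub>F d in sequentially. (\<forall>x\<in>unit_disk. dist (partial_deriv 1 (q d) x) (h1 x) < \<epsilon> / 2) \<and>
        (\<forall>x\<in>unit_disk. dist (partial_deriv \<i> (q d) x) (h2 x) < \<epsilon> / 2)"
      using uniform_limitD[OF uniform_limit_of_rate[OF h1(2)[of "Suc 0"]], of "\<epsilon> / 2"]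
        uniform_limitD[OF uniform_limit_of_rate[OF h2(2)[of "Suc 0"]], of "\<epsilon> / 2"] \<epsilon>
      by (simp add: eventually_conj)
    then have "\<forall>\<^sub>F n in sequentially. (\<forall>x\<in>unit_disk. dist (partial_deriv 1 (q (n + 2)) x) (h1 x) < \<epsilon> / 2) \<and>
        (\<forall>x\<in>unit_disk. dist (partial_deriv \<i> (q (n + 2)) x) (h2 x) < \<epsilon> / 2)"
      by (subst eventually_sequentially_seg)
    then show "\<forall>\<^sub>F n in sequentially. \<forall>x\<in>ball 0 1. \<forall>h.
        norm (Re h * partial_deriv 1 (q (n + 2)) x + Im h * partial_deriv \<i> (q (n + 2)) x -
          (Re h * h1 x + Im h * h2 x)) \<le> \<epsilon> * norm h"
    proof eventually_elim
      case (elim n)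
      show ?case
      proof (intro ballI allI)
        fix x h :: complex assume x: "x \<in> ball 0 1"
        define a b where "a = partial_deriv 1 (q (n + 2)) x - h1 x" and "b = partial_deriv \<i> (q (n + 2)) x - h2 x"
        have ab: "\<bar>a\<bar> \<le> \<epsilon> / 2" "\<bar>b\<bar> \<le> \<epsilon> / 2"
        proof -
          have "x \<in> unit_disk"
            using x by auto
          with elim have "\<bar>a\<bar> < \<epsilon> / 2" "\<bar>b\<bar> < \<epsilon> / 2"
            unfolding a_def b_def dist_real_def by blast+
          then show "\<bar>a\<bar> \<le> \<epsilon> / 2" "\<bar>b\<bar> \<le> \<epsilon> / 2"
            by simp_all
        qed
        have "\<bar>Re h * a + Im h * b\<bar> \<le> \<bar>Re h\<bar> * \<bar>a\<bar> + \<bar>Im h\<bar> * \<bar>b\<bar>"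
          by (simp flip: abs_mult add: abs_triangle_ineq)
        also have "\<dots> \<le> cmod h * (\<epsilon> / 2) + cmod h * (\<epsilon> / 2)"
          using ab by (intro add_mono mult_mono abs_Re_le_cmod abs_Im_le_cmod) auto
        finally show "norm (Re h * partial_deriv 1 (q (n + 2)) x + Im h * partial_deriv \<i> (q (n + 2)) x -
            (Re h * h1 x + Im h * h2 x)) \<le> \<epsilon> * norm h"
          by (simp add: a_def b_def algebra_simps)
      qed
    qed
  qed auto
  then obtain G where G: "\<And>x. x \<in> ball 0 1 \<Longrightarrow> (\<lambda>n. q (n + 2) x) \<longlonglongrightarrow> G x"
    "\<And>x. x \<in> ball 0 1 \<Longrightarrow> (G has_derivative (\<lambda>h. Re h * h1 x + Im h * h2 x)) (at x within ball 0 1)"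
    by blast
  have "G x = g x" if "x \<in> ball 0 1" for x
    using G(1)[OF that] LIMSEQ_ignore_initial_segment[OF q_lim[of x], of 2] that
    by (auto intro: LIMSEQ_unique)
  then have der_g: "(g has_derivative (\<lambda>h. Re h * h1 x + Im h * h2 x)) (at x)" if "x \<in> ball 0 1" for x
    using that G(2)[OF that] by (intro has_derivative_transform_within_open[of G _ x UNIV "ball 0 1" g])
      (auto simp: at_within_open[of x "ball 0 1"])
  define h where "h = (if v = 1 then h1 else h2)"
  have h: "continuous_on unit_disk h" "converges_at_rate k (\<lambda>d. partial_deriv v (q d)) h"
    using h1 h2 v by (auto simp: h_def)
  have "partial_deriv v g x - h x = 0" if "x \<in> unit_disk" for x
  proof (rule continuous_constant_on_closure[where f = "\<lambda>x. partial_deriv v g x - h x" and S = "ball 0 1"])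
    have "continuous_on U (partial_deriv v g)"
      using g v by auto
    then show "continuous_on (closure (ball 0 1)) (\<lambda>x. partial_deriv v g x - h x)"
      using g(1) h(1) by (intro continuous_intros) (auto intro: continuous_on_subset)
    show "partial_deriv v g x - h x = 0" if "x \<in> ball 0 1" for x
      using partial_deriv_eq[OF der_g[OF that], of v] v by (auto simp: h_def)
  qed (use that in auto)
  then show ?thesis
    using h(2) unfolding converges_at_rate_def by simp
qed

text \<open>Degree, rates and smoothness travel together, since a step of the induction needs all
  three for the previous derivative; \<open>k\<close> is arbitrary because the step uses higher
  orders than it returns.\<close>

lemma iterated_partial_deriv_rate:
  assumes v: "v \<in> {1, \<i>}" and U: "unit_disk \<subseteq> U"
    and poly: "\<And>d. 2 \<le> d \<Longrightarrow> q d \<in> polys2 (d - 2)"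
    and rate: "\<And>k. converges_at_rate k q g" and g: "\<And>k. C_on k U g"
  shows "(2 \<le> d \<longrightarrow> (partial_deriv v ^^ n) (q d) \<in> polys2 (d - 2)) \<and>
    converges_at_rate k (\<lambda>d. (partial_deriv v ^^ n) (q d)) ((partial_deriv v ^^ n) g) \<and>
    C_on k U ((partial_deriv v ^^ n) g)"
proof (induction n arbitrary: d k)
  case 0
  then show ?case
    using poly rate g by simp
next
  case (Suc n)
  have "C_on (Suc k) U ((partial_deriv v ^^ n) g)"
    using Suc by blast
  then have "C_on k U (partial_deriv v ((partial_deriv v ^^ n) g))"
    using v by auto
  moreover have "converges_at_rate k (\<lambda>d. partial_deriv v ((partial_deriv v ^^ n) (q d)))
      (partial_deriv v ((partial_deriv v ^^ n) g))"
    by (rule partial_deriv_rate[OF _ _ v U]) (use Suc in blast)+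
  ultimately show ?case
    using Suc partial_deriv_polys2[OF _ v] by auto
qed

lemma hakopian_multi_deriv_rate:
  assumes "f \<in> C_inf_disk"
  shows "converges_at_rate k (\<lambda>d. multi_deriv \<beta> (hakopian (map e [0..<d]) f)) (multi_deriv \<beta> f)"
proof -
  obtain U where U: "open U" "unit_disk \<subseteq> U" "\<And>k. C_on k U f"
    using assms by (auto simp: C_inf_disk_def)
  then have f: "f \<in> C_disk k" for k
    by (auto simp: C_disk_def)
  have poly: "hakopian (map e [0..<d]) f \<in> polys2 (d - 2)" if "2 \<le> d" for d
    using norm_leja_disk[OF leja e0] inj_on_leja leja_disk_prod_le[OF leja e0] continuous_on_C_disk[OF f[of 0]] that
    by (intro hakopian_in_polys2)
  obtain b1 b2 where \<beta>: "\<beta> = (b1, b2)"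
    by fastforce
  note * = iterated_partial_deriv_rate[of \<i> U "\<lambda>d. hakopian (map e [0..<d]) f" f _ b2, OF _ U(2) poly hakopian_rate[OF f] U(3)]
  show ?thesis
    unfolding \<beta> multi_deriv.simps
    \<comment> \<open>The derivatives along \<open>\<i>\<close> come first, those along 1 act on
      their result. Only the rate is extracted, so the degree statement is instantiated at the
      sample value \<open>d = 2\<close>.\<close>
    using iterated_partial_deriv_rate[of 1 U "\<lambda>d. (partial_deriv \<i> ^^ b2) (hakopian (map e [0..<d]) f)"
        "(partial_deriv \<i> ^^ b2) f" 2 b1 k] * U(2) by blast
qed

end

theorem theorem4p5:
  fixes e :: "nat \<Rightarrow> complex"
  assumes "leja_disk e" and "e 0 = 1"
  shows "(\<forall>f \<in> C_disk 5.
            uniform_limit unit_disk (\<lambda>d. hakopian (map e [0..<d]) f) f sequentially) \<and>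
         (\<forall>f \<in> C_inf_disk. \<forall>\<beta> :: nat \<times> nat.
            uniform_limit unit_disk (\<lambda>d. multi_deriv \<beta> (hakopian (map e [0..<d]) f))
              (multi_deriv \<beta> f) sequentially)"
proof (intro conjI ballI allI)
  fix f assume "f \<in> C_disk 5"
  \<comment> \<open>\<open>5 = Suc 0 + 4\<close>: one order of smoothness is left over as the rate
    \<open>1 / d\<close>.\<close>
  then have "converges_at_rate (Suc 0) (\<lambda>d. hakopian (map e [0..<d]) f) f"
    by (intro hakopian_rate assms) simp
  then show "uniform_limit unit_disk (\<lambda>d. hakopian (map e [0..<d]) f) f sequentially"
    by (rule uniform_limit_of_rate)
next
  fix f and \<beta> :: "nat \<times> nat" assume "f \<in> C_inf_disk"
  then show "uniform_limit unit_disk (\<lambda>d. multi_deriv \<beta> (hakopian (map e [0..<d]) f)) (multi_deriv \<beta> f) sequentially"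
    by (intro uniform_limit_of_rate[of 0] hakopian_multi_deriv_rate assms)
qed

end
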